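(* Let $k$ be an uncountable field and let $R$ be an affine prime Goldie non-simple $k$-algebra with $\operatorname{GKdim}(R)<3$. Then $R$ is PI or the center of $R$ is a finite dimensional field extension of $k$.
   Context: All algebras are associative with 1. A $k$-algebra is affine if it is finitely generated as a $k$-algebra. $\operatorname{GKdim}$ is Gelfand--Kirillov dimension over $k$. PI means satisfying a (nontrivial) polynomial identity. Goldie means left and right Goldie. *)

theory Defs
  imports "HOL-Algebra.Algebra" "HOL-Library.Extended_Real" "HOL-Library.Liminf_Limsup"
    "HOL-Library.Countable_Set"
begin

section \<open>Rings\<close>

definition ring_center :: "('a, 'm) ring_scheme \<Rightarrow> 'a set"
  where "ring_center R = {z \<in> carrier R. \<forall>x \<in> carrier R. z \<otimes>\<^bsub>R\<^esub> x = x \<otimes>\<^bsub>R\<^esub> z}"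

definition simple_ring :: "('a, 'm) ring_scheme \<Rightarrow> bool"
  where "simple_ring R \<longleftrightarrow> ring R \<and> carrier R \<noteq> {\<zero>\<^bsub>R\<^esub>} \<and>
    (\<forall>I. ideal I R \<longrightarrow> I = {\<zero>\<^bsub>R\<^esub>} \<or> I = carrier R)"

text \<open>The library locale \<open>primeideal\<close> is confined to commutative rings.\<close>

definition prime_ring :: "('a, 'm) ring_scheme \<Rightarrow> bool"
  where "prime_ring R \<longleftrightarrow> ring R \<and> carrier R \<noteq> {\<zero>\<^bsub>R\<^esub>} \<and>
    (\<forall>I J. ideal I R \<longrightarrow> ideal J R \<longrightarrow> ideal_prod R I J = {\<zero>\<^bsub>R\<^esub>}
        \<longrightarrow> I = {\<zero>\<^bsub>R\<^esub>} \<or> J = {\<zero>\<^bsub>R\<^esub>})"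


section \<open>Goldie rings\<close>

definition left_ideal :: "'a set \<Rightarrow> ('a, 'm) ring_scheme \<Rightarrow> bool"
  where "left_ideal I R \<longleftrightarrow> additive_subgroup I R \<and>
    (\<forall>r \<in> carrier R. \<forall>a \<in> I. r \<otimes>\<^bsub>R\<^esub> a \<in> I)"

definition left_annihilator :: "('a, 'm) ring_scheme \<Rightarrow> 'a set \<Rightarrow> 'a set"
  where "left_annihilator R S = {r \<in> carrier R. \<forall>s \<in> S. r \<otimes>\<^bsub>R\<^esub> s = \<zero>\<^bsub>R\<^esub>}"

definition acc_left_annihilators :: "('a, 'm) ring_scheme \<Rightarrow> bool"
  where "acc_left_annihilators R \<longleftrightarrow>
    (\<forall>A :: nat \<Rightarrow> 'a set.
        (\<forall>n. \<exists>S \<subseteq> carrier R. A n = left_annihilator R S) \<longrightarrow> (\<forall>n. A n \<subseteq> A (Suc n))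
        \<longrightarrow> (\<exists>N. \<forall>n \<ge> N. A n = A N))"

text \<open>The sum of a sequence of left ideals is direct.\<close>

definition direct_left_ideals :: "('a, 'm) ring_scheme \<Rightarrow> (nat \<Rightarrow> 'a set) \<Rightarrow> bool"
  where "direct_left_ideals R I \<longleftrightarrow> (\<forall>n. left_ideal (I n) R) \<and>
    (\<forall>n x. (\<forall>i < n. x i \<in> I i) \<longrightarrow> finsum R x {..<n} = \<zero>\<^bsub>R\<^esub> \<longrightarrow> (\<forall>i < n. x i = \<zero>\<^bsub>R\<^esub>))"

definition left_goldie :: "('a, 'm) ring_scheme \<Rightarrow> bool"
  where "left_goldie R \<longleftrightarrow> ring R \<and> acc_left_annihilators R \<and>
    \<not> (\<exists>I. direct_left_ideals R I \<and> (\<forall>n. I n \<noteq> {\<zero>\<^bsub>R\<^esub>}))"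

definition opposite_ring :: "('a, 'm) ring_scheme \<Rightarrow> ('a, 'm) ring_scheme"
  where "opposite_ring R = R\<lparr>mult := \<lambda>x y. y \<otimes>\<^bsub>R\<^esub> x\<rparr>"

text \<open>Right ideals and right annihilators of a ring are the left ones of its opposite.\<close>

definition right_goldie :: "('a, 'm) ring_scheme \<Rightarrow> bool"
  where "right_goldie R \<longleftrightarrow> left_goldie (opposite_ring R)"

definition goldie_ring :: "('a, 'm) ring_scheme \<Rightarrow> bool"
  where "goldie_ring R \<longleftrightarrow> left_goldie R \<and> right_goldie R"


section \<open>Algebras over a field\<close>

text \<open>
  A possibly noncommutative unital algebra, given by its structure map: scalars act by
  \<open>c \<cdot> x = \<eta> c \<otimes> x\<close>. If the algebra is nonzero, \<open>scalars\<close> is a subfield isomorphic to the base field,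
  with the same linear algebra, so that the dimension theory of \<open>Embedded_Algebras\<close> applies.
\<close>

locale field_algebra = K: field K + ring R
  for K :: "('k, 'n) ring_scheme" and R :: "('a, 'm) ring_scheme" (structure) +
  fixes \<eta> :: "'k \<Rightarrow> 'a"
  assumes structure_map_hom: "\<eta> \<in> ring_hom K R"
    and structure_map_central: "\<eta> ` carrier K \<subseteq> ring_center R"
begin

definition scalars :: "'a set"
  where "scalars = \<eta> ` carrier K"

definition affine :: bool
  where "affine \<longleftrightarrow>
    (\<exists>S. finite S \<and> S \<subseteq> carrier R \<and> generate_ring R (scalars \<union> S) = carrier R)"

text \<open>
  Elements of the free algebra over \<open>K\<close> on countably many variables: the words in the variables
  form a basis, so an element is a finitely supported family of coefficients.
\<close>

definition free_algebra :: "(nat list \<Rightarrow> 'k) set"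
  where "free_algebra = {f. (\<forall>w. f w \<in> carrier K) \<and> finite {w. f w \<noteq> \<zero>\<^bsub>K\<^esub>}}"

definition eval_word :: "(nat \<Rightarrow> 'a) \<Rightarrow> nat list \<Rightarrow> 'a"
  where "eval_word x w = foldr (\<lambda>i y. x i \<otimes> y) w \<one>"

definition eval_free :: "(nat \<Rightarrow> 'a) \<Rightarrow> (nat list \<Rightarrow> 'k) \<Rightarrow> 'a"
  where "eval_free x f = finsum R (\<lambda>w. \<eta> (f w) \<otimes> eval_word x w) {w. f w \<noteq> \<zero>\<^bsub>K\<^esub>}"

definition polynomial_identity :: "(nat list \<Rightarrow> 'k) \<Rightarrow> bool"
  where "polynomial_identity f \<longleftrightarrow> f \<in> free_algebra \<and>
    (\<forall>x. (\<forall>i. x i \<in> carrier R) \<longrightarrow> eval_free x f = \<zero>)"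

definition PI_algebra :: bool
  where "PI_algebra \<longleftrightarrow> (\<exists>f. polynomial_identity f \<and> (\<exists>w. f w \<noteq> \<zero>\<^bsub>K\<^esub>))"

text \<open>
  The subspace spanned by the \<open>n\<close>-fold products of elements of \<open>V\<close>. For subspaces,
  \<open>ideal_prod\<close> is the additive span of the products, hence the product of subspaces.
\<close>

primrec subspace_power :: "'a set \<Rightarrow> nat \<Rightarrow> 'a set"
  where
    "subspace_power V 0 = scalars"
  | "subspace_power V (Suc n) = ideal_prod R (subspace_power V n) V"

text \<open>\<open>K + V + \<dots> + V\<^sup>n\<close>\<close>

primrec growth_space :: "'a set \<Rightarrow> nat \<Rightarrow> 'a set"
  where
    "growth_space V 0 = scalars"
  | "growth_space V (Suc n) = growth_space V n <+> subspace_power V (Suc n)"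

text \<open>
  \<open>finite_dimension scalars V\<close> says that \<open>V\<close> is a finite-dimensional subspace of \<open>R\<close>.
  Meaningful for nonzero algebras only, where \<open>scalars\<close> is a field and all dimensions are positive.
\<close>

definition GKdim :: ereal
  where "GKdim = (SUP V \<in> {V. finite_dimension scalars V}.
    limsup (\<lambda>n. ereal (ln (real ((dim over scalars) (growth_space V n))) / ln (real n))))"

end

end

theory Submission
  imports Defs "HOL-Combinatorics.Permutations"
begin

text \<open>
  Let \<open>k\<close> be the field of scalars and \<open>Z\<close> the center. For a central subring \<open>D\<close> and an ideal \<open>I\<close> of \<open>R\<close>,
  call a word in the generators normal if it is not \<open>D\<close>-dependent modulo \<open>I\<close> on smaller words. Normal
  words are independent and closed under factors, so Bergman's gap theorem applies to them: either
  there are more than \<open>n\<close> of each length \<open>n\<close>, or all are of the form \<open>u p\<^sup>k v\<close> with \<open>u\<close>, \<open>p\<close>, \<open>v\<close> bounded, and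
  their growth is linear. If \<open>y\<close> is such that the products of normal words by powers of \<open>y\<close> are independent
  over \<open>k\<close>, then the first alternative gives cubic growth, which \<open>GKdim R < 3\<close> excludes.

  If \<open>z \<in> Z\<close> is transcendental over \<open>k\<close>, take \<open>D = k[z]\<close>, \<open>I = 0\<close> and \<open>y = z\<close>. If all the \<open>p\<close> are algebraic
  over \<open>D\<close>, then \<open>R\<close> has finite rank over \<open>D\<close>. Otherwise some \<open>p\<close> is transcendental, and by linear growth
  \<open>R/T\<close> has finite rank over \<open>D[p]\<close>, where the torsion submodule \<open>T\<close> is a left ideal containing no nonzero
  two-sided ideal. In both cases \<open>R\<close> acts faithfully on a torsion-free module of some finite rank \<open>r\<close> and
  satisfies the standard identity of degree \<open>r\<^sup>2 + 1\<close>.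

  If \<open>Z\<close> is algebraic over \<open>k\<close>, it is a field. A proper nonzero ideal \<open>I\<close> contains a regular element \<open>y\<close>, so
  with \<open>D = k\<close> the growth of \<open>R/I\<close> is linear. For a subfield \<open>F \<subseteq> Z\<close> of large finite degree over \<open>k\<close> this
  leaves only finitely many words that are normal with respect to \<open>F\<close>. Hence \<open>R/I\<close> is finite-dimensional
  over \<open>k\<close>, and \<open>Z\<close> embeds into it.
\<close>

section \<open>Linear algebra over a commutative subring\<close>

text \<open>All counting takes place in R/T over the fraction field of a commutative subring E, but
  neither is constructed: independence is taken modulo T, and closures allow a nonzero denominator.
  Scalars act from the right because E = D[p] need not be central and T is then only a left ideal;
  left multiplication by R is still E-linear.

  Linear growth becomes finite rank by a comparison of slopes. If J is independent over D[p] modulo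
  T, the products j p^s with s < n are independent over D and involve words of length at most l + M
  n, where M bounds the length of p. Hence card J * n is at most C (l + M n + 1) for all n, and card
  J is at most C M. In the algebraic case the slope C is beaten by C + 1 independent elements of F.

  T contains no nonzero two-sided ideal because the chain condition gives one denominator e for all
  torsion: if a R lies in T, then a R e = 0, and a = 0 by primeness.

  The degree r^2 + 1 comes from the dimension of the r by r matrices: that many operators on a
  module of rank r are dependent, and an alternating multilinear expression vanishes on
  them.\<close>

context ring
begin

section \<open>Finite sums in a ring\<close>

lemma finsum_mem_additive_subgroup:
  assumes "additive_subgroup T R" and "\<And>j. j \<in> J \<Longrightarrow> f j \<in> T"
  shows "finsum R f J \<in> T"
proof -
  interpret T: additive_subgroup T R by fact
  show ?thesis
    using assms(2)
  proof (induction J rule: infinite_finite_induct)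
    case (insert x F)
    then have "f \<in> F \<rightarrow> carrier R" "f x \<in> carrier R" by auto
    with insert show ?case by (simp add: finsum_insert)
  qed (auto simp: finsum_infinite)
qed

lemma additive_subgroup_preimage:
  assumes C: "additive_subgroup C R" and f: "\<And>m. m \<in> carrier R \<Longrightarrow> f m \<in> carrier R"
    and add: "\<And>m n. m \<in> carrier R \<Longrightarrow> n \<in> carrier R \<Longrightarrow> f (m \<oplus> n) = f m \<oplus> f n"
  shows "additive_subgroup {m \<in> carrier R. f m \<in> C} R"
proof (rule additive_subgroup.intro, rule add.subgroupI)
  interpret C: additive_subgroup C R by (rule C)
  have "f \<zero> \<oplus> f \<zero> = f \<zero> \<oplus> \<zero>" using add[of \<zero> \<zero>] f[of \<zero>] by simp
  then have f0: "f \<zero> = \<zero>" using f[of \<zero>] by (metis add.l_cancel zero_closed)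
  then have "\<zero> \<in> {m \<in> carrier R. f m \<in> C}" using C.zero_closed by simp
  then show "{m \<in> carrier R. f m \<in> C} \<noteq> {}" by blast
  fix m assume m: "m \<in> {m \<in> carrier R. f m \<in> C}"
  then have mc: "m \<in> carrier R" "\<ominus> m \<in> carrier R" by auto
  have "f (\<ominus> m) \<oplus> f m = \<zero>" using add[OF mc(2,1)] mc f0 by (simp add: l_neg)
  then have "f (\<ominus> m) = \<ominus> f m" using minus_equality f mc by metis
  then show "\<ominus> m \<in> {m \<in> carrier R. f m \<in> C}" using m C.a_inv_closed by simp
  fix n assume n: "n \<in> {m \<in> carrier R. f m \<in> C}"
  then show "m \<oplus> n \<in> {m \<in> carrier R. f m \<in> C}" using m add C.a_closed by simp
qed auto

lemma finsum_a_inv: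
  assumes "f \<in> J \<rightarrow> carrier R"
  shows "finsum R (\<lambda>j. \<ominus> f j) J = \<ominus> finsum R f J"
  using assms
proof (induction J rule: infinite_finite_induct)
  case (insert x F)
  then have "f \<in> F \<rightarrow> carrier R" "f x \<in> carrier R" by auto
  with insert show ?case by (simp add: finsum_insert Pi_def minus_add)
qed (auto simp: finsum_infinite)

lemma finsum_diff:
  assumes "f \<in> J \<rightarrow> carrier R" "g \<in> J \<rightarrow> carrier R"
  shows "finsum R (\<lambda>j. f j \<ominus> g j) J = finsum R f J \<ominus> finsum R g J"
proof -
  have "finsum R (\<lambda>j. f j \<oplus> \<ominus> g j) J = finsum R f J \<oplus> finsum R (\<lambda>j. \<ominus> g j) J"
    using assms by (intro finsum_addf) auto
  then show ?thesis using assms by (simp add: minus_eq finsum_a_inv)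
qed

lemma finsum_swap:
  assumes "finite J" "finite B" "\<And>j b. j \<in> J \<Longrightarrow> b \<in> B \<Longrightarrow> f j b \<in> carrier R"
  shows "finsum R (\<lambda>j. finsum R (f j) B) J = finsum R (\<lambda>b. finsum R (\<lambda>j. f j b) J) B"
  using assms(1,3)
proof (induction J rule: finite_induct)
  case (insert x F)
  have 1: "(\<lambda>j. finsum R (f j) B) \<in> F \<rightarrow> carrier R" "finsum R (f x) B \<in> carrier R"
    using insert.prems by (auto intro!: finsum_closed)
  have "finsum R (\<lambda>b. finsum R (\<lambda>j. f j b) (insert x F)) B
      = finsum R (\<lambda>b. f x b \<oplus> finsum R (\<lambda>j. f j b) F) B"
    using insert by (intro finsum_cong' refl) (auto intro!: finsum_closed finsum_insert)
  also have "\<dots> = finsum R (f x) B \<oplus> finsum R (\<lambda>b. finsum R (\<lambda>j. f j b) F) B"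
    using insert by (intro finsum_addf) (auto intro!: finsum_closed)
  finally show ?case using insert 1 by (simp add: finsum_insert)
qed simp

lemma finsum_Sigma:
  assumes "finite J" "finite B" "\<And>j b. j \<in> J \<Longrightarrow> b \<in> B \<Longrightarrow> f j b \<in> carrier R"
  shows "finsum R (\<lambda>(j, b). f j b) (J \<times> B) = finsum R (\<lambda>j. finsum R (f j) B) J"
  using assms(1,3)
proof (induction J rule: finite_induct)
  case (insert x F)
  have "finsum R (\<lambda>(j, b). f j b) (insert x F \<times> B) =
      finsum R (\<lambda>(j, b). f j b) ({x} \<times> B) \<oplus> finsum R (\<lambda>(j, b). f j b) (F \<times> B)"
    using insert assms(2) by (subst finsum_Un_disjoint[symmetric])
        (auto simp: insert_Times_insert intro!: arg_cong[where f = "finsum R _"])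
  also have "finsum R (\<lambda>(j, b). f j b) ({x} \<times> B) = finsum R (f x) B"
  proof -
    have "finsum R (\<lambda>(j, b). f j b) (Pair x ` B) = finsum R (\<lambda>b. case (x, b) of (j, b) \<Rightarrow> f j b) B"
      by (rule finsum_reindex) (use insert in \<open>auto simp: inj_on_def\<close>)
    moreover have "Pair x ` B = {x} \<times> B" by auto
    ultimately show ?thesis by simp
  qed
  finally show ?case using insert by (auto simp: finsum_insert finsum_closed Pi_def)
qed simp

lemma finsum_delete:
  assumes "finite J" "i \<in> J" "f \<in> J \<rightarrow> carrier R"
  shows "finsum R f J = f i \<oplus> finsum R f (J - {i})"
proof -
  have "finsum R f (insert i (J - {i})) = f i \<oplus> finsum R f (J - {i})"
    using assms by (intro finsum_insert) auto
  with assms(2) show ?thesis by (simp add: insert_absorb)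
qed

lemma finsum_delta:
  assumes "finite J" "i \<in> J" "a \<in> carrier R"
  shows "finsum R (\<lambda>j. if j = i then a else \<zero>) J = a"
proof -
  have "finsum R (\<lambda>j. if j = i then a else \<zero>) (J - {i}) = finsum R (\<lambda>j. \<zero>) (J - {i})"
    by (rule finsum_cong') auto
  then show ?thesis using assms by (subst finsum_delete[OF assms(1,2)]) auto
qed

text \<open>Coefficients stand on the right, so that multiplying a relation by ring elements from
  the left is harmless. With \<open>T = {\<zero>}\<close> this is ordinary independence.\<close>

definition lin_indep :: "'a set \<Rightarrow> 'a set \<Rightarrow> 'i set \<Rightarrow> ('i \<Rightarrow> 'a) \<Rightarrow> bool"
  where "lin_indep E T J b \<longleftrightarrow> (\<forall>c. (\<forall>j \<in> J. c j \<in> E) \<longrightarrow> finsum R (\<lambda>j. b j \<otimes> c j) J \<in> T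
    \<longrightarrow> (\<forall>j \<in> J. c j = \<zero>))"

text \<open>For R/T torsion-free over a domain E, this is the preimage in R of the span of the
  \<open>b j\<close> over the fraction field of E; the denominator \<open>e\<close> replaces
  division.\<close>

definition lin_closure :: "'a set \<Rightarrow> 'a set \<Rightarrow> 'i set \<Rightarrow> ('i \<Rightarrow> 'a) \<Rightarrow> 'a set"
  where "lin_closure E T J b = {m \<in> carrier R. \<exists>e \<in> E - {\<zero>}. \<exists>c t. (\<forall>j \<in> J. c j \<in> E) \<and> t \<in> T \<and>
    m \<otimes> e = finsum R (\<lambda>j. b j \<otimes> c j) J \<oplus> t}"

end

text \<open>The axioms say that R/T is a nonzero torsion-free right module over the commutative ring
  E. The instances are k modulo a proper ideal, a central subring modulo 0, D[p] modulo its torsion,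
  and a finite extension F of k modulo an ideal.\<close>

locale torsion_closed = ring R for R (structure) +
  fixes E T :: "'a set"
  assumes E_subring: "subring E R"
    and E_comm: "e \<in> E \<Longrightarrow> f \<in> E \<Longrightarrow> e \<otimes> f = f \<otimes> e"
    and T_subgroup: "additive_subgroup T R"
    and T_mult: "t \<in> T \<Longrightarrow> e \<in> E \<Longrightarrow> t \<otimes> e \<in> T"
    and T_torsion_free: "m \<in> carrier R \<Longrightarrow> e \<in> E \<Longrightarrow> e \<noteq> \<zero> \<Longrightarrow> m \<otimes> e \<in> T \<Longrightarrow> m \<in> T"
    and T_proper: "T \<noteq> carrier R"
begin

sublocale E: subring E R by (rule E_subring)
sublocale T: additive_subgroup T R by (rule T_subgroup)

lemma E_carr [simp]: "e \<in> E \<Longrightarrow> e \<in> carrier R"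
  using E.subset by auto

lemma E_closed [simp, intro]:
  "\<zero> \<in> E" "\<one> \<in> E" "e \<in> E \<Longrightarrow> f \<in> E \<Longrightarrow> e \<otimes> f \<in> E" "e \<in> E \<Longrightarrow> f \<in> E \<Longrightarrow> e \<oplus> f \<in> E"
  "e \<in> E \<Longrightarrow> \<ominus> e \<in> E" "e \<in> E \<Longrightarrow> f \<in> E \<Longrightarrow> e \<ominus> f \<in> E"
  using subringE[OF E_subring] by (auto simp: minus_eq)

lemma E_additive: "additive_subgroup E R"
  using E_subring by (simp add: subring_def additive_subgroup_def)

lemma E_finsum: "(\<And>j. j \<in> J \<Longrightarrow> f j \<in> E) \<Longrightarrow> finsum R f J \<in> E"
  by (rule finsum_mem_additive_subgroup[OF E_additive])

text \<open>If e f = 0 with e and f nonzero, every m satisfies m e f = 0, so torsion-freeness puts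
  all of R into T.\<close>

lemma E_integral:
  assumes "e \<in> E" "f \<in> E" "e \<otimes> f = \<zero>"
  shows "e = \<zero> \<or> f = \<zero>"
proof (rule ccontr)
  assume *: "\<not> (e = \<zero> \<or> f = \<zero>)"
  have "m \<in> T" if m: "m \<in> carrier R" for m
  proof -
    have "(m \<otimes> e) \<otimes> f \<in> T" using assms m by (simp add: m_assoc)
    then show ?thesis using * assms m by (meson T_torsion_free E_carr m_closed)
  qed
  then show False using T_proper T.a_subset by auto
qed

lemma one_not_zero': "\<one> \<noteq> \<zero>"
proof
  assume "\<one> = \<zero>"
  then have "carrier R = {\<zero>}" by (metis carrier_one_zero)
  then show False using T_proper T.a_subset T.zero_closed by auto
qed

text \<open>Gaussian elimination without division, by induction on the number of equations.\<close>

lemma homogeneous_system: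
  assumes "finite B" "finite J" "card B < card J" "\<And>j b. j \<in> J \<Longrightarrow> b \<in> B \<Longrightarrow> c j b \<in> E"
  shows "\<exists>e. (\<forall>j \<in> J. e j \<in> E) \<and> (\<exists>j \<in> J. e j \<noteq> \<zero>) \<and>
    (\<forall>b \<in> B. finsum R (\<lambda>j. c j b \<otimes> e j) J = \<zero>)"
  using assms
proof (induction B arbitrary: J c rule: finite_induct)
  case empty
  then have "J \<noteq> {}" by auto
  then show ?case using one_not_zero' by (intro exI[of _ "\<lambda>_. \<one>"]) auto
next
  case (insert b B)
  have c: "c j b' \<in> carrier R" "c j b' \<in> E" if "j \<in> J" "b' \<in> insert b B" for j b'
    using insert.prems(3) that by auto
  show ?case
  proof (cases "\<forall>j \<in> J. c j b = \<zero>")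
    case True
    obtain e where e: "\<forall>j \<in> J. e j \<in> E" "\<exists>j \<in> J. e j \<noteq> \<zero>"
      "\<forall>b \<in> B. finsum R (\<lambda>j. c j b \<otimes> e j) J = \<zero>"
      using insert.IH[of J c] insert.prems insert.hyps by auto
    have "finsum R (\<lambda>j. c j b \<otimes> e j) J = finsum R (\<lambda>j. \<zero>) J"
      using True e by (intro finsum_cong') auto
    with e show ?thesis by (intro exI[of _ e]) auto
  next
    case False
    then obtain i where i: "i \<in> J" "c i b \<noteq> \<zero>" by auto
    define J' where "J' = J - {i}"
    have J': "finite J'" "card B < card J'" "J' \<subseteq> J"
      using insert i by (auto simp: J'_def)
    \<comment> \<open>The unknown \<open>i\<close> is eliminated with the pivot
      \<open>c i b\<close>, by cross-multiplication.\<close>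
    define c' where "c' j b' = c j b' \<otimes> c i b \<ominus> c i b' \<otimes> c j b" for j b'
    have c'E: "c' j b' \<in> E" if "j \<in> J" "b' \<in> B" for j b'
      using c i that by (auto simp: c'_def)
    obtain e where e: "\<forall>j \<in> J'. e j \<in> E" "\<exists>j \<in> J'. e j \<noteq> \<zero>"
      "\<forall>b \<in> B. finsum R (\<lambda>j. c' j b \<otimes> e j) J' = \<zero>"
      using insert.IH[OF J'(1,2), of c'] J'(3) c'E by blast
    define s where "s = finsum R (\<lambda>j. c j b \<otimes> e j) J'"
    have sE: "s \<in> E" unfolding s_def using c e J' by (intro E_finsum) auto
    \<comment> \<open>Scaling the reduced solution by the pivot allows the eliminated unknown to be
      \<open>\<ominus> s\<close>, which solves equation \<open>b\<close>. The solution stays nonzero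
      because E is a domain.\<close>
    define e' where "e' j = (if j = i then \<ominus> s else c i b \<otimes> e j)" for j
    have sum: "finsum R (\<lambda>j. c j b' \<otimes> e' j) J =
        finsum R (\<lambda>j. (c j b' \<otimes> c i b) \<otimes> e j) J' \<ominus> c i b' \<otimes> s" if b': "b' \<in> insert b B" for b'
    proof -
      have "finsum R (\<lambda>j. c j b' \<otimes> e' j) J = c i b' \<otimes> e' i \<oplus> finsum R (\<lambda>j. c j b' \<otimes> e' j) J'"
        unfolding J'_def using insert.prems(1) i(1) c e sE b' J'
        by (intro finsum_delete) (auto simp: e'_def J'_def)
      also have "finsum R (\<lambda>j. c j b' \<otimes> e' j) J' = finsum R (\<lambda>j. (c j b' \<otimes> c i b) \<otimes> e j) J'"
        using c e b' i J' by (intro finsum_cong') (auto simp: e'_def J'_def m_assoc)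
      finally have eq: "finsum R (\<lambda>j. c j b' \<otimes> e' j) J =
          c i b' \<otimes> e' i \<oplus> finsum R (\<lambda>j. (c j b' \<otimes> c i b) \<otimes> e j) J'" .
      have "finsum R (\<lambda>j. (c j b' \<otimes> c i b) \<otimes> e j) J' \<in> carrier R"
        using c e b' i J' by (intro finsum_closed) auto
      then show ?thesis unfolding eq using c[OF i(1) b'] sE
        by (simp add: e'_def r_minus minus_eq a_comm)
    qed
    have "finsum R (\<lambda>j. c j b' \<otimes> e' j) J = \<zero>" if b': "b' \<in> insert b B" for b'
    proof (cases "b' = b")
      case True
      have "finsum R (\<lambda>j. (c j b \<otimes> c i b) \<otimes> e j) J' = finsum R (\<lambda>j. c i b \<otimes> (c j b \<otimes> e j)) J'"
      proof (rule finsum_cong'[OF refl])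
        fix j assume j: "j \<in> J'"
        then show "c j b \<otimes> c i b \<otimes> e j = c i b \<otimes> (c j b \<otimes> e j)"
          using c[of j b] c[of i b] e i J' E_comm[of "c j b" "c i b"] by (auto simp: m_assoc)
      qed (use c e i J' in auto)
      also have "\<dots> = c i b \<otimes> s" unfolding s_def
        using c e i J' by (intro finsum_rdistr[symmetric]) auto
      finally show ?thesis using sum[OF b'] True c i sE by (auto simp: minus_eq r_neg)
    next
      case False
      then have b'B: "b' \<in> B" using b' by auto
      have "finsum R (\<lambda>j. c' j b' \<otimes> e j) J' =
        finsum R (\<lambda>j. (c j b' \<otimes> c i b) \<otimes> e j \<ominus> c i b' \<otimes> (c j b \<otimes> e j)) J'"
      proof (rule finsum_cong'[OF refl])
        fix j assume j: "j \<in> J'"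
        then show "c' j b' \<otimes> e j = (c j b' \<otimes> c i b) \<otimes> e j \<ominus> c i b' \<otimes> (c j b \<otimes> e j)"
          using c[of j b] c[of i b]  c[of j b'] c[of i b'] b'B e i J'
          by (auto simp: c'_def m_assoc l_distr minus_eq l_minus)
      qed (use c e i J' b'B in auto)
      also have "\<dots> = finsum R (\<lambda>j. (c j b' \<otimes> c i b) \<otimes> e j) J' \<ominus> finsum R (\<lambda>j. c i b' \<otimes> (c j b \<otimes> e j)) J'"
        using c e i J' b' by (intro finsum_diff) auto
      also have "finsum R (\<lambda>j. c i b' \<otimes> (c j b \<otimes> e j)) J' = c i b' \<otimes> s" unfolding s_def
        using c e i J' b' by (intro finsum_rdistr[symmetric]) auto
      finally show ?thesis using sum[OF b'] e(3) b'B by simp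
    qed
    moreover have "\<forall>j \<in> J. e' j \<in> E" using c e sE i by (auto simp: e'_def J'_def)
    moreover have "\<exists>j \<in> J. e' j \<noteq> \<zero>"
    proof -
      obtain j where j: "j \<in> J'" "e j \<noteq> \<zero>" using e by auto
      then have "c i b \<otimes> e j \<noteq> \<zero>" using E_integral[of "c i b" "e j"] e c i by auto
      then show ?thesis using j by (intro bexI[of _ j]) (auto simp: e'_def J'_def)
    qed
    ultimately show ?thesis by blast
  qed
qed

end

section \<open>Closure, exchange and rank over E modulo T\<close>

context torsion_closed
begin

abbreviation indep :: "'i set \<Rightarrow> ('i \<Rightarrow> 'a) \<Rightarrow> bool"
  where "indep \<equiv> lin_indep E T"

abbreviation cl :: "'i set \<Rightarrow> ('i \<Rightarrow> 'a) \<Rightarrow> 'a set"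
  where "cl \<equiv> lin_closure E T"

lemma indepD:
  "indep J b \<Longrightarrow> (\<And>j. j \<in> J \<Longrightarrow> c j \<in> E) \<Longrightarrow> finsum R (\<lambda>j. b j \<otimes> c j) J \<in> T \<Longrightarrow> j \<in> J \<Longrightarrow> c j = \<zero>"
  by (auto simp: lin_indep_def)

lemma clI:
  assumes "m \<in> carrier R" "e \<in> E" "e \<noteq> \<zero>" "\<And>j. j \<in> J \<Longrightarrow> c j \<in> E" "t \<in> T"
    "m \<otimes> e = finsum R (\<lambda>j. b j \<otimes> c j) J \<oplus> t"
  shows "m \<in> cl J b"
  unfolding lin_closure_def using assms by blast

lemma clE:
  assumes "m \<in> cl J b"
  obtains e c t where "m \<in> carrier R" "e \<in> E" "e \<noteq> \<zero>" "\<forall>j \<in> J. c j \<in> E" "t \<in> T"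
    "m \<otimes> e = finsum R (\<lambda>j. b j \<otimes> c j) J \<oplus> t"
  using assms unfolding lin_closure_def by blast

lemma cl_carrier: "cl J b \<subseteq> carrier R"
  by (auto simp: lin_closure_def)

lemma mult_right_sum:
  assumes "\<And>j. j \<in> J \<Longrightarrow> b j \<in> carrier R" "\<And>j. j \<in> J \<Longrightarrow> c j \<in> E" "e \<in> E" "finite J"
  shows "finsum R (\<lambda>j. b j \<otimes> c j) J \<otimes> e = finsum R (\<lambda>j. b j \<otimes> (c j \<otimes> e)) J"
proof -
  have "finsum R (\<lambda>j. b j \<otimes> c j) J \<otimes> e = finsum R (\<lambda>j. b j \<otimes> c j \<otimes> e) J"
    using assms by (intro finsum_ldistr) auto
  also have "\<dots> = finsum R (\<lambda>j. b j \<otimes> (c j \<otimes> e)) J"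
    using assms by (intro finsum_cong') (auto simp: m_assoc)
  finally show ?thesis .
qed

lemma sum_carrier:
  assumes "\<And>j. j \<in> J \<Longrightarrow> b j \<in> carrier R" "\<And>j. j \<in> J \<Longrightarrow> c j \<in> E"
  shows "finsum R (\<lambda>j. b j \<otimes> c j) J \<in> carrier R"
  using assms by (intro finsum_closed) auto

lemma cl_of_zero: "m \<in> lin_closure E {\<zero>} J b \<Longrightarrow> m \<in> cl J b"
  unfolding lin_closure_def using T.zero_closed by blast

lemma cl_mult:
  assumes m: "m \<in> cl J b" and f: "f \<in> E" and J: "finite J" "\<And>j. j \<in> J \<Longrightarrow> b j \<in> carrier R"
  shows "m \<otimes> f \<in> cl J b"
proof -
  from m obtain e c t where *: "m \<in> carrier R" "e \<in> E" "e \<noteq> \<zero>" "\<forall>j \<in> J. c j \<in> E" "t \<in> T"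
    "m \<otimes> e = finsum R (\<lambda>j. b j \<otimes> c j) J \<oplus> t" by (rule clE)
  have "m \<otimes> f \<otimes> e = (m \<otimes> e) \<otimes> f" using *(1-3) f E_comm[of e f] by (simp add: m_assoc)
  also have "\<dots> = finsum R (\<lambda>j. b j \<otimes> (c j \<otimes> f)) J \<oplus> t \<otimes> f"
    unfolding *(6) using * f J by (subst l_distr) (auto simp: mult_right_sum sum_carrier)
  finally show ?thesis using * f by (intro clI[of _ e _ "\<lambda>j. c j \<otimes> f" "t \<otimes> f"]) (auto simp: T_mult)
qed

lemma cl_torsion_free:
  assumes m: "m \<otimes> f \<in> cl J b" "m \<in> carrier R" and f: "f \<in> E" "f \<noteq> \<zero>"
  shows "m \<in> cl J b"
proof -
  from m(1) obtain e c t where *: "e \<in> E" "e \<noteq> \<zero>" "\<forall>j \<in> J. c j \<in> E" "t \<in> T"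
    "m \<otimes> f \<otimes> e = finsum R (\<lambda>j. b j \<otimes> c j) J \<oplus> t" by (rule clE)
  with m f E_integral[of f e] show ?thesis
    by (intro clI[of _ "f \<otimes> e" _ c t]) (auto simp: m_assoc)
qed

lemma cl_add:
  assumes m: "m \<in> cl J b" and m': "m' \<in> cl J b" and J: "finite J" "\<And>j. j \<in> J \<Longrightarrow> b j \<in> carrier R"
  shows "m \<oplus> m' \<in> cl J b"
proof -
  from m obtain e c t where *: "m \<in> carrier R" "e \<in> E" "e \<noteq> \<zero>" "\<forall>j \<in> J. c j \<in> E" "t \<in> T"
    "m \<otimes> e = finsum R (\<lambda>j. b j \<otimes> c j) J \<oplus> t" by (rule clE)
  from m' obtain e' c' t' where **: "m' \<in> carrier R" "e' \<in> E" "e' \<noteq> \<zero>" "\<forall>j \<in> J. c' j \<in> E" "t' \<in> T"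
    "m' \<otimes> e' = finsum R (\<lambda>j. b j \<otimes> c' j) J \<oplus> t'" by (rule clE)
  have "(m \<oplus> m') \<otimes> (e \<otimes> e') = (m \<otimes> e) \<otimes> e' \<oplus> (m' \<otimes> e') \<otimes> e"
    using *(1-3) **(1-3) E_comm[of e e'] by (simp add: l_distr m_assoc)
  also have "\<dots> = (finsum R (\<lambda>j. b j \<otimes> (c j \<otimes> e')) J \<oplus> t \<otimes> e') \<oplus> (finsum R (\<lambda>j. b j \<otimes> (c' j \<otimes> e)) J \<oplus> t' \<otimes> e)"
    unfolding *(6) **(6) using * ** J by (simp add: l_distr mult_right_sum sum_carrier)
  also have "\<dots> = (finsum R (\<lambda>j. b j \<otimes> (c j \<otimes> e')) J \<oplus> finsum R (\<lambda>j. b j \<otimes> (c' j \<otimes> e)) J) \<oplus> (t \<otimes> e' \<oplus> t' \<otimes> e)"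
    using * ** J sum_carrier[of J b "\<lambda>j. c j \<otimes> e'"] sum_carrier[of J b "\<lambda>j. c' j \<otimes> e"]
    by (simp add: a_ac)
  also have "finsum R (\<lambda>j. b j \<otimes> (c j \<otimes> e')) J \<oplus> finsum R (\<lambda>j. b j \<otimes> (c' j \<otimes> e)) J
      = finsum R (\<lambda>j. b j \<otimes> (c j \<otimes> e') \<oplus> b j \<otimes> (c' j \<otimes> e)) J"
    using * ** J by (intro finsum_addf[symmetric]) auto
  also have "\<dots> = finsum R (\<lambda>j. b j \<otimes> (c j \<otimes> e' \<oplus> c' j \<otimes> e)) J"
    using * ** J by (intro finsum_cong') (auto simp: r_distr)
  finally show ?thesis using * ** E_integral[of e e']
    by (intro clI[of _ "e \<otimes> e'" _ "\<lambda>j. c j \<otimes> e' \<oplus> c' j \<otimes> e" "t \<otimes> e' \<oplus> t' \<otimes> e"]) (auto intro: T_mult)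
qed

lemma cl_T: "t \<in> T \<Longrightarrow> (\<And>j. j \<in> J \<Longrightarrow> b j \<in> carrier R) \<Longrightarrow> t \<in> cl J b"
proof (rule clI[of _ \<one> _ "\<lambda>_. \<zero>" t])
  assume "\<And>j. j \<in> J \<Longrightarrow> b j \<in> carrier R"
  then have "finsum R (\<lambda>j. b j \<otimes> \<zero>) J = finsum R (\<lambda>j. \<zero>) J" by (intro finsum_cong') auto
  moreover assume "t \<in> T"
  ultimately show "t \<otimes> \<one> = finsum R (\<lambda>j. b j \<otimes> \<zero>) J \<oplus> t" by auto
qed (auto simp: one_not_zero')

lemma cl_incl:
  assumes "finite J" "\<And>j. j \<in> J \<Longrightarrow> b j \<in> carrier R" "j \<in> J"
  shows "b j \<in> cl J b"
proof (rule clI[of _ \<one> _ "\<lambda>i. if i = j then \<one> else \<zero>" \<zero>])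
  have "finsum R (\<lambda>i. b i \<otimes> (if i = j then \<one> else \<zero>)) J = finsum R (\<lambda>i. if i = j then b j else \<zero>) J"
    using assms by (intro finsum_cong') auto
  then show "b j \<otimes> \<one> = finsum R (\<lambda>i. b i \<otimes> (if i = j then \<one> else \<zero>)) J \<oplus> \<zero>"
    using assms by (simp add: finsum_delta)
qed (use assms one_not_zero' in auto)

lemma cl_subgroup:
  assumes "finite J" "\<And>j. j \<in> J \<Longrightarrow> b j \<in> carrier R"
  shows "additive_subgroup (cl J b) R"
proof (rule additive_subgroup.intro, rule add.subgroupI)
  have 1: "\<ominus> \<one> \<in> E" by auto
  fix m assume m: "m \<in> cl J b"
  then have "m \<in> carrier R" using cl_carrier by blast
  then have "m \<otimes> (\<ominus> \<one>) = \<ominus> m" by (simp add: r_minus)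
  then show "\<ominus>m \<in> cl J b" using cl_mult[OF m 1] assms by auto
next
  show "cl J b \<noteq> {}" using cl_T[OF T.zero_closed] assms by auto
next
  fix m m' assume "m \<in> cl J b" "m' \<in> cl J b"
  then show "m \<oplus> m' \<in> cl J b" using cl_add assms by auto
qed (use cl_carrier in auto)

lemma cl_min:
  assumes S: "additive_subgroup S R" and mult: "\<And>m e. m \<in> S \<Longrightarrow> e \<in> E \<Longrightarrow> m \<otimes> e \<in> S"
    and tf: "\<And>m e. m \<in> carrier R \<Longrightarrow> e \<in> E \<Longrightarrow> e \<noteq> \<zero> \<Longrightarrow> m \<otimes> e \<in> S \<Longrightarrow> m \<in> S"
    and TS: "T \<subseteq> S" and b: "\<And>j. j \<in> J \<Longrightarrow> b j \<in> S"
  shows "cl J b \<subseteq> S"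
proof
  fix m assume "m \<in> cl J b"
  then obtain e c t where *: "m \<in> carrier R" "e \<in> E" "e \<noteq> \<zero>" "\<forall>j \<in> J. c j \<in> E" "t \<in> T"
    "m \<otimes> e = finsum R (\<lambda>j. b j \<otimes> c j) J \<oplus> t" by (rule clE)
  have "finsum R (\<lambda>j. b j \<otimes> c j) J \<in> S"
    by (rule finsum_mem_additive_subgroup[OF S]) (use * mult b in auto)
  then have "m \<otimes> e \<in> S" using * TS additive_subgroup.a_closed[OF S] by auto
  then show "m \<in> S" using tf *(1-3) by blast
qed

text \<open>The preimage of a saturated submodule under a right E-linear map is saturated, so
  \<open>cl_min\<close> applies to it.\<close>

lemma cl_map:
  assumes C: "additive_subgroup C R" "\<And>m e. m \<in> C \<Longrightarrow> e \<in> E \<Longrightarrow> m \<otimes> e \<in> C"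
      "\<And>m e. m \<in> carrier R \<Longrightarrow> e \<in> E \<Longrightarrow> e \<noteq> \<zero> \<Longrightarrow> m \<otimes> e \<in> C \<Longrightarrow> m \<in> C"
    and f: "\<And>m. m \<in> carrier R \<Longrightarrow> f m \<in> carrier R"
      "\<And>m n. m \<in> carrier R \<Longrightarrow> n \<in> carrier R \<Longrightarrow> f (m \<oplus> n) = f m \<oplus> f n"
      "\<And>m e. m \<in> carrier R \<Longrightarrow> e \<in> E \<Longrightarrow> f (m \<otimes> e) = f m \<otimes> e"
    and T: "\<And>t. t \<in> T \<Longrightarrow> f t \<in> C" and b: "\<And>j. j \<in> J \<Longrightarrow> b j \<in> carrier R" "\<And>j. j \<in> J \<Longrightarrow> f (b j) \<in> C"
    and m: "m \<in> cl J b"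
  shows "f m \<in> C"
proof -
  have "cl J b \<subseteq> {m \<in> carrier R. f m \<in> C}"
  proof (rule cl_min)
    show "additive_subgroup {m \<in> carrier R. f m \<in> C} R" by (rule additive_subgroup_preimage[OF C(1) f(1,2)])
    show "m \<otimes> e \<in> {m \<in> carrier R. f m \<in> C}" if "m \<in> {m \<in> carrier R. f m \<in> C}" "e \<in> E" for m e
      using that f(3)[of m e] C(2)[of "f m" e] by simp
    show "m \<in> {m \<in> carrier R. f m \<in> C}"
      if "m \<in> carrier R" "e \<in> E" "e \<noteq> \<zero>" "m \<otimes> e \<in> {m \<in> carrier R. f m \<in> C}" for m e
      using that f(3)[of m e] C(3)[OF f(1)[OF that(1)] that(2,3)] by simp
  qed (use T b in auto)
  with m show ?thesis by blast
qed

lemma cl_map_cl: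
  assumes B: "finite B" "\<And>i. i \<in> B \<Longrightarrow> \<beta> i \<in> carrier R"
    and f: "\<And>m. m \<in> carrier R \<Longrightarrow> f m \<in> carrier R"
      "\<And>m n. m \<in> carrier R \<Longrightarrow> n \<in> carrier R \<Longrightarrow> f (m \<oplus> n) = f m \<oplus> f n"
      "\<And>m e. m \<in> carrier R \<Longrightarrow> e \<in> E \<Longrightarrow> f (m \<otimes> e) = f m \<otimes> e"
    and T: "\<And>t. t \<in> T \<Longrightarrow> f t \<in> cl B \<beta>"
    and b: "\<And>j. j \<in> J \<Longrightarrow> b j \<in> carrier R" "\<And>j. j \<in> J \<Longrightarrow> f (b j) \<in> cl B \<beta>" and m: "m \<in> cl J b"
  shows "f m \<in> cl B \<beta>"
proof (rule cl_map[OF cl_subgroup[OF B] _ _ f T b m])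
  show "m \<otimes> e \<in> cl B \<beta>" if "m \<in> cl B \<beta>" "e \<in> E" for m e by (rule cl_mult[OF that B])
  show "m \<in> cl B \<beta>" if "m \<in> carrier R" "e \<in> E" "e \<noteq> \<zero>" "m \<otimes> e \<in> cl B \<beta>" for m e
    by (rule cl_torsion_free[OF that(4,1-3)])
qed

lemma cl_subset:
  assumes "finite B" "\<And>j. j \<in> B \<Longrightarrow> \<beta> j \<in> carrier R" "\<And>j. j \<in> J \<Longrightarrow> b j \<in> cl B \<beta>"
  shows "cl J b \<subseteq> cl B \<beta>"
  using assms by (intro cl_min cl_subgroup) (auto intro: cl_mult cl_T cl_torsion_free)

text \<open>Steinitz: after clearing denominators, more vectors than generators give a homogeneous
  system with more unknowns than equations. Its nonzero solution is a relation modulo T among the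
  \<open>b j\<close>, with coefficients \<open>q j \<otimes> e j\<close>.\<close>

lemma exchange:
  assumes J: "finite J" and B: "finite B" "\<And>j. j \<in> B \<Longrightarrow> \<beta> j \<in> carrier R"
    and ind: "indep J b" and sub: "\<And>j. j \<in> J \<Longrightarrow> b j \<in> cl B \<beta>"
  shows "card J \<le> card B"
proof (rule ccontr)
  assume "\<not> card J \<le> card B"
  have "\<forall>j \<in> J. \<exists>q c t. q \<in> E \<and> q \<noteq> \<zero> \<and> (\<forall>i \<in> B. c i \<in> E) \<and> t \<in> T \<and>
      b j \<otimes> q = finsum R (\<lambda>i. \<beta> i \<otimes> c i) B \<oplus> t"
    using sub unfolding lin_closure_def by blast
  then have "\<exists>q c t. \<forall>j \<in> J. q j \<in> E \<and> q j \<noteq> \<zero> \<and> (\<forall>i \<in> B. c j i \<in> E) \<and> t j \<in> T \<and>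
      b j \<otimes> q j = finsum R (\<lambda>i. \<beta> i \<otimes> c j i) B \<oplus> t j"
    unfolding bchoice_iff .
  then obtain q c t where *: "\<forall>j \<in> J. q j \<in> E \<and> q j \<noteq> \<zero> \<and> (\<forall>i \<in> B. c j i \<in> E) \<and> t j \<in> T \<and>
      b j \<otimes> q j = finsum R (\<lambda>i. \<beta> i \<otimes> c j i) B \<oplus> t j"
    by (elim exE)
  then have q: "\<And>j. j \<in> J \<Longrightarrow> q j \<in> E" "\<And>j. j \<in> J \<Longrightarrow> q j \<noteq> \<zero>"
    and c: "\<And>j i. j \<in> J \<Longrightarrow> i \<in> B \<Longrightarrow> c j i \<in> E" and t: "\<And>j. j \<in> J \<Longrightarrow> t j \<in> T"
    and eq: "\<And>j. j \<in> J \<Longrightarrow> b j \<otimes> q j = finsum R (\<lambda>i. \<beta> i \<otimes> c j i) B \<oplus> t j"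
    by blast+
  have "card B < card J" using \<open>\<not> card J \<le> card B\<close> by simp
  then have "\<exists>e. (\<forall>j \<in> J. e j \<in> E) \<and> (\<exists>j \<in> J. e j \<noteq> \<zero>) \<and>
      (\<forall>i \<in> B. finsum R (\<lambda>j. c j i \<otimes> e j) J = \<zero>)"
    using c by (intro homogeneous_system B J)
  then
  obtain e where e: "\<forall>j \<in> J. e j \<in> E" "\<exists>j \<in> J. e j \<noteq> \<zero>"
    "\<forall>i \<in> B. finsum R (\<lambda>j. c j i \<otimes> e j) J = \<zero>"
    by (elim exE conjE)
  have b: "b j \<in> carrier R" if "j \<in> J" for j using sub cl_carrier that by blast
  have "finsum R (\<lambda>j. b j \<otimes> (q j \<otimes> e j)) J =
      finsum R (\<lambda>j. finsum R (\<lambda>i. \<beta> i \<otimes> (c j i \<otimes> e j)) B \<oplus> t j \<otimes> e j) J"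
  proof (rule finsum_cong'[OF refl])
    fix j assume j: "j \<in> J"
    then have "b j \<otimes> (q j \<otimes> e j) = (b j \<otimes> q j) \<otimes> e j" using b q e by (simp add: m_assoc)
    then show "b j \<otimes> (q j \<otimes> e j) = finsum R (\<lambda>i. \<beta> i \<otimes> (c j i \<otimes> e j)) B \<oplus> t j \<otimes> e j"
      unfolding eq[OF j] using j B c e t by (simp add: l_distr sum_carrier mult_right_sum)
  qed (use B c e t in \<open>auto intro!: sum_carrier\<close>)
  also have "\<dots> = finsum R (\<lambda>j. finsum R (\<lambda>i. \<beta> i \<otimes> (c j i \<otimes> e j)) B) J \<oplus> finsum R (\<lambda>j. t j \<otimes> e j) J"
    using B c e t by (intro finsum_addf) (auto intro!: sum_carrier)
  also have "finsum R (\<lambda>j. finsum R (\<lambda>i. \<beta> i \<otimes> (c j i \<otimes> e j)) B) J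
      = finsum R (\<lambda>i. finsum R (\<lambda>j. \<beta> i \<otimes> (c j i \<otimes> e j)) J) B"
    using B J c e by (intro finsum_swap) auto
  also have "\<dots> = finsum R (\<lambda>i. \<zero>) B"
  proof (rule finsum_cong'[OF refl])
    fix i assume i: "i \<in> B"
    have "finsum R (\<lambda>j. \<beta> i \<otimes> (c j i \<otimes> e j)) J = \<beta> i \<otimes> finsum R (\<lambda>j. c j i \<otimes> e j) J"
      using i B J c e by (intro finsum_rdistr[symmetric]) auto
    then show "finsum R (\<lambda>j. \<beta> i \<otimes> (c j i \<otimes> e j)) J = \<zero>" using e(3) i B by simp
  qed auto
  also have "finsum R (\<lambda>i. \<zero>) B \<oplus> finsum R (\<lambda>j. t j \<otimes> e j) J \<in> T"
    using t e by (auto intro!: finsum_mem_additive_subgroup[OF T_subgroup] T_mult)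
  finally have inT: "finsum R (\<lambda>j. b j \<otimes> (q j \<otimes> e j)) J \<in> T" .
  have "q j \<otimes> e j = \<zero>" if "j \<in> J" for j
    by (rule indepD[OF ind _ inT that]) (use q e(1) in auto)
  moreover obtain j where "j \<in> J" "e j \<noteq> \<zero>" using e(2) by blast
  ultimately show False using E_integral[of "q j" "e j"] q[of j] e(1) by auto
qed

text \<open>In a nontrivial relation, the vector of highest rank with a nonzero coefficient would
  lie in the closure of its predecessors.\<close>

lemma indep_of_rank:
  fixes r :: "'i \<Rightarrow> nat"
  assumes J: "finite J" "\<And>j. j \<in> J \<Longrightarrow> b j \<in> carrier R" and r: "inj_on r J"
    and new: "\<And>j. j \<in> J \<Longrightarrow> b j \<notin> cl {i \<in> J. r i < r j} b"
  shows "indep J b"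
  unfolding lin_indep_def
proof (intro allI impI, rule ccontr)
  fix c assume c: "\<forall>j \<in> J. c j \<in> E" and s: "finsum R (\<lambda>j. b j \<otimes> c j) J \<in> T"
    and nz: "\<not> (\<forall>j \<in> J. c j = \<zero>)"
  define S where "S = {j \<in> J. c j \<noteq> \<zero>}"
  have "finite S" "S \<noteq> {}" using J nz by (auto simp: S_def)
  then have "Max (r ` S) \<in> r ` S" by (intro Max_in) auto
  then obtain j where j: "j \<in> S" "r j = Max (r ` S)" by auto
  have le: "r i \<le> r j" if "i \<in> S" for i using j that \<open>finite S\<close> by auto
  define L where "L = {i \<in> J. r i < r j}"
  have jJ: "j \<in> J" and cj: "c j \<noteq> \<zero>" using j by (auto simp: S_def)
  have L: "finite L" "L \<subseteq> J - {j}" using J by (auto simp: L_def)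
  have "finsum R (\<lambda>j. b j \<otimes> c j) J = b j \<otimes> c j \<oplus> finsum R (\<lambda>j. b j \<otimes> c j) (J - {j})"
    using J jJ c by (intro finsum_delete) auto
  also have "finsum R (\<lambda>j. b j \<otimes> c j) (J - {j}) = finsum R (\<lambda>j. b j \<otimes> c j) L"
  proof (rule add.finprod_mono_neutral_cong_right)
    show "b i \<otimes> c i = \<zero>" if i: "i \<in> J - {j} - L" for i
    proof -
      from i have "r i \<noteq> r j" using inj_onD[OF r, of i j] jJ by blast
      then have "i \<notin> S" using le[of i] i by (auto simp: L_def)
      then show "b i \<otimes> c i = \<zero>" using i J by (auto simp: S_def)
    qed
  qed (use J c L in auto)
  finally have *: "b j \<otimes> c j \<oplus> finsum R (\<lambda>j. b j \<otimes> c j) L \<in> T" (is "?t \<in> T") using s by simp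
  have neg: "finsum R (\<lambda>j. b j \<otimes> \<ominus> c j) L = \<ominus> finsum R (\<lambda>j. b j \<otimes> c j) L"
  proof -
    have "finsum R (\<lambda>j. b j \<otimes> \<ominus> c j) L = finsum R (\<lambda>j. \<ominus> (b j \<otimes> c j)) L"
      using J c L by (intro finsum_cong') (auto simp: r_minus)
    also have "\<dots> = \<ominus> finsum R (\<lambda>j. b j \<otimes> c j) L" 
      using J c L by (intro finsum_a_inv) auto
    finally show ?thesis .
  qed
  have "finsum R (\<lambda>j. b j \<otimes> c j) L \<in> carrier R" using J c L by (intro sum_carrier) auto
  moreover have "b j \<otimes> c j \<in> carrier R" using J c jJ by auto
  ultimately have "b j \<otimes> c j = finsum R (\<lambda>j. b j \<otimes> \<ominus> c j) L \<oplus> ?t"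
    unfolding neg by (simp add: a_ac r_neg r_neg1 r_neg2)
  then have "b j \<in> cl L b" using * J c jJ cj L by (intro clI[of _ "c j" _ "\<lambda>i. \<ominus> c i" ?t]) auto
  then show False using new[OF jJ] unfolding L_def by simp
qed

lemma indep_insert:
  assumes J: "finite J" "\<And>j. j \<in> J \<Longrightarrow> b j \<in> carrier R" "b x \<in> carrier R" and ind: "indep J b"
    and new: "b x \<notin> cl J b"
  shows "indep (insert x J) b"
  unfolding lin_indep_def
proof (intro allI impI)
  have xJ: "x \<notin> J" using cl_incl[where J = J and b = b and j = x, OF J(1,2)] new by blast
  fix c assume c: "\<forall>j \<in> insert x J. c j \<in> E"
    and s: "finsum R (\<lambda>j. b j \<otimes> c j) (insert x J) \<in> T"
  have ins: "finsum R (\<lambda>j. b j \<otimes> c j) (insert x J) = b x \<otimes> c x \<oplus> finsum R (\<lambda>j. b j \<otimes> c j) J"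
    using c J xJ by (intro finsum_insert) auto
  have car: "finsum R (\<lambda>j. b j \<otimes> c j) J \<in> carrier R" "b x \<otimes> c x \<in> carrier R" 
    using c J by (auto intro!: sum_carrier)
  have cl: "finsum R (\<lambda>j. b j \<otimes> c j) J \<in> cl J b"
    using c J by (intro finsum_mem_additive_subgroup[OF cl_subgroup]) (auto intro!: cl_mult cl_incl)
  interpret C: additive_subgroup "cl J b" R using J by (intro cl_subgroup)
  have t: "finsum R (\<lambda>j. b j \<otimes> c j) (insert x J) \<in> cl J b" using s cl_T J by auto
  have "b x \<otimes> c x = finsum R (\<lambda>j. b j \<otimes> c j) (insert x J) \<oplus> \<ominus> finsum R (\<lambda>j. b j \<otimes> c j) J"
    unfolding ins using car by (simp add: a_assoc r_neg)
  also have "\<dots> \<in> cl J b" using t cl by auto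
  finally have cx: "c x = \<zero>" using new cl_torsion_free[of "b x" "c x" J b] J c by auto
  then have inT: "finsum R (\<lambda>j. b j \<otimes> c j) J \<in> T" using s ins car J by simp
  have "c j = \<zero>" if "j \<in> J" for j
    by (rule indepD[OF ind _ inT that]) (use c in auto)
  then show "\<forall>j \<in> insert x J. c j = \<zero>" using cx by auto
qed

text \<open>An independent set of the largest size is a basis: by \<open>indep_insert\<close>, any
  vector outside its closure could be added.\<close>

lemma finite_basis:
  assumes bound: "\<And>J. finite J \<Longrightarrow> J \<subseteq> carrier R \<Longrightarrow> indep J id \<Longrightarrow> card J \<le> n"
  shows "\<exists>B. finite B \<and> B \<subseteq> carrier R \<and> cl B id = carrier R"
proof -
  define P where "P J \<longleftrightarrow> finite J \<and> J \<subseteq> carrier R \<and> indep J id" for J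
  have "P {}" by (auto simp: P_def lin_indep_def)
  moreover have "\<forall>J. P J \<longrightarrow> card J < Suc n" using bound by (auto simp: P_def less_Suc_eq_le)
  ultimately obtain J where J: "P J" "\<forall>J'. P J' \<longrightarrow> card J' \<le> card J"
    using ex_has_greatest_nat[of P "{}" card "Suc n"] by blast
  have "carrier R \<subseteq> cl J id"
  proof (rule subsetI, rule ccontr)
    fix m assume m: "m \<in> carrier R" "m \<notin> cl J id"
    have "indep (insert m J) id" using m J by (intro indep_insert) (auto simp: P_def)
    then have "card (insert m J) \<le> card J" using m J by (auto simp: P_def)
    moreover have "m \<notin> J" using m cl_incl[of J id m] J by (auto simp: P_def)
    ultimately show False using J by (auto simp: P_def)
  qed
  then have "cl J id = carrier R" using cl_carrier[of J id] by (rule subset_antisym[rotated])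
  then show ?thesis using J(1) unfolding P_def by blast
qed

text \<open>The independence half of the tower law: the inner sums are E-coefficients of a relation
  among the \<open>b j\<close>, hence vanish, and each is a D-relation among the
  \<open>\<epsilon> s\<close>.\<close>

lemma tower:
  assumes D: "D \<subseteq> E" "subring D R" and J: "finite J" "\<And>j. j \<in> J \<Longrightarrow> b j \<in> carrier R"
    and S: "finite S" "\<And>s. s \<in> S \<Longrightarrow> \<epsilon> s \<in> E" "lin_indep D {\<zero>} S \<epsilon>" and ind: "indep J b"
  shows "lin_indep D T (J \<times> S) (\<lambda>(j, s). b j \<otimes> \<epsilon> s)"
  unfolding lin_indep_def
proof (intro allI impI ballI)
  fix c p assume c: "\<forall>p \<in> J \<times> S. c p \<in> D" and s: "finsum R (\<lambda>p. (case p of (j, s) \<Rightarrow> b j \<otimes> \<epsilon> s) \<otimes> c p) (J \<times> S) \<in> T"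
    and p: "p \<in> J \<times> S"
  have cE: "c (j, s) \<in> E" if "j \<in> J" "s \<in> S" for j s using c that D by auto
  have \<epsilon>E: "\<epsilon> s \<in> carrier R" if "s \<in> S" for s using S that by auto
  have "finsum R (\<lambda>p. (case p of (j, s) \<Rightarrow> b j \<otimes> \<epsilon> s) \<otimes> c p) (J \<times> S)
      = finsum R (\<lambda>(j, s). b j \<otimes> \<epsilon> s \<otimes> c (j, s)) (J \<times> S)"
    by (rule arg_cong[where f = "\<lambda>f. finsum R f (J \<times> S)"]) auto
  also have "\<dots> = finsum R (\<lambda>j. finsum R (\<lambda>s. b j \<otimes> \<epsilon> s \<otimes> c (j, s)) S) J"
    using J S cE \<epsilon>E by (intro finsum_Sigma) auto
  also have "\<dots> = finsum R (\<lambda>j. b j \<otimes> finsum R (\<lambda>s. \<epsilon> s \<otimes> c (j, s)) S) J"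
  proof (rule finsum_cong'[OF refl])
    fix j assume j: "j \<in> J"
    have "finsum R (\<lambda>s. b j \<otimes> \<epsilon> s \<otimes> c (j, s)) S = finsum R (\<lambda>s. b j \<otimes> (\<epsilon> s \<otimes> c (j, s))) S"
      using j J S cE \<epsilon>E by (intro finsum_cong') (auto simp: m_assoc)
    also have "\<dots> = b j \<otimes> finsum R (\<lambda>s. \<epsilon> s \<otimes> c (j, s)) S"
      using j J S cE \<epsilon>E by (intro finsum_rdistr[symmetric]) auto
    finally show "finsum R (\<lambda>s. b j \<otimes> \<epsilon> s \<otimes> c (j, s)) S = b j \<otimes> finsum R (\<lambda>s. \<epsilon> s \<otimes> c (j, s)) S" .
  qed (use J S cE \<epsilon>E in \<open>auto intro!: sum_carrier\<close>)
  finally have inT: "finsum R (\<lambda>j. b j \<otimes> finsum R (\<lambda>s. \<epsilon> s \<otimes> c (j, s)) S) J \<in> T" using s by simp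
  have inE: "finsum R (\<lambda>s. \<epsilon> s \<otimes> c (j, s)) S \<in> E" if "j \<in> J" for j
    using that cE S by (intro E_finsum) auto
  have 0: "finsum R (\<lambda>s. \<epsilon> s \<otimes> c (j, s)) S = \<zero>" if "j \<in> J" for j
    by (rule indepD[OF ind _ inT that]) (rule inE)
  obtain j s' where js: "p = (j, s')" "j \<in> J" "s' \<in> S" using p by auto
  have "\<forall>s \<in> S. c (j, s) \<in> D" using c js by blast
  moreover have "finsum R (\<lambda>s. \<epsilon> s \<otimes> c (j, s)) S \<in> {\<zero>}" using 0[OF js(2)] by simp
  ultimately have "\<forall>s \<in> S. c (j, s) = \<zero>"
    using S(3)[unfolded lin_indep_def, rule_format, of "\<lambda>s. c (j, s)"] by blast
  then show "c p = \<zero>" using js by auto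
qed

end

section \<open>Factor-closed sets of words with few words of some length\<close>

lemma periodic_list_decomp:
  assumes "p \<ge> 1" "\<And>t. t + p < length y \<Longrightarrow> y ! t = y ! (t + p)"
  shows "\<exists>k v. y = concat (replicate k (take p y)) @ v \<and> length v < p"
  using assms(2)
proof (induction "length y" arbitrary: y rule: less_induct)
  case less
  show ?case
  proof (cases "length y < p")
    case True
    then show ?thesis by (intro exI[of _ 0] exI[of _ y]) auto
  next
    case False
    define z where "z = drop p y"
    have y: "y = take p y @ z" by (simp add: z_def)
    have "length z < length y" using False assms(1) by (simp add: z_def)
    moreover have "z ! t = z ! (t + p)" if "t + p < length z" for t
      using less.prems[of "t + p"] that by (simp add: z_def add.commute)
    ultimately obtain k v where kv: "z = concat (replicate k (take p z)) @ v" "length v < p"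
      using less.hyps[of z] by blast
    show ?thesis
    proof (cases "length z < p")
      case True
      then show ?thesis using y by (intro exI[of _ 1] exI[of _ z]) auto
    next
      case False
      have "take p z = take p y"
      proof (rule nth_equalityI)
        fix t assume "t < length (take p z)"
        then have "t < p" "t + p < length y" using False by (auto simp: z_def)
        then show "take p z ! t = take p y ! t"
          using less.prems[of t] by (simp add: z_def add.commute)
      qed (use False in \<open>auto simp: z_def\<close>)
      then have "y = concat (replicate (Suc k) (take p y)) @ v"
        using kv(1) y by simp
      with kv(2) show ?thesis by blast
    qed
  qed
qed

text \<open>The argument of Morse and Hedlund. For some m < n there are no more factors of length m
  + 1 than of length m, so a factor of length m determines the letter after it. Once such a factor
  recurs, the word repeats with period equal to the distance between the two occurrences.\<close>

lemma few_factors_imp_periodic: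
  fixes w :: "'a list"
  assumes n: "n \<ge> 1" and fac: "card {take n (drop i w) | i. i + n \<le> length w} \<le> n"
  shows "\<exists>u p v k. w = u @ concat (replicate k p) @ v \<and> p \<noteq> [] \<and>
    length u \<le> 2 * n \<and> length p \<le> 2 * n \<and> length v \<le> 2 * n \<or>
    w = u \<and> length u \<le> 2 * n"
proof (cases "length w \<le> 2 * n")
  case True
  then show ?thesis by blast
next
  case False
  define N where "N = length w"
  have N: "2 * n < N" using False by (simp add: N_def)
  define s where "s m i = take m (drop i w)" for m i
  \<comment> \<open>Starting positions stop at \<open>N - n\<close> for every \<open>m\<close>, so
    that each factor counted in \<open>F m\<close> with m < n extends to one counted in
    \<open>F (Suc m)\<close>.\<close>
  define F where "F m = s m ` {..N - n}" for m
  have fin: "finite (F m)" for m by (simp add: F_def)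
  have take_s: "take m (s (Suc m) i) = s m i" for m i by (simp add: s_def)
  have img: "F m = take m ` F (Suc m)" for m
    by (simp add: F_def image_image take_s)
  have le: "card (F m) \<le> card (F (Suc m))" for m
    unfolding img[of m] by (rule card_image_le[OF fin])
  have "F n \<subseteq> {take n (drop i w) | i. i + n \<le> length w}"
    using N by (auto simp: F_def s_def N_def)
  moreover have "finite {take n (drop i w) | i. i + n \<le> length w}"
    by (rule finite_subset[of _ "s n ` {..length w}"]) (auto simp: s_def)
  ultimately have Fn: "card (F n) \<le> n"
    using fac card_mono order_trans by meson
  \<comment> \<open>The count is at least 1 for m = 0 and at most n for m = n, which leaves no room
    for n strict increases.\<close>
  have "\<exists>m < n. card (F m) = card (F (Suc m))"
  proof (rule ccontr)
    assume "\<not> ?thesis"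
    then have less: "card (F m) < card (F (Suc m))" if "m < n" for m
      using le[of m] that by (meson le_neq_implies_less)
    have "m \<le> n \<Longrightarrow> Suc m \<le> card (F m)" for m
    proof (induction m)
      case 0
      have "F 0 \<noteq> {}" by (auto simp: F_def)
      then show ?case using fin[of 0] by (simp add: Suc_le_eq card_gt_0_iff)
    next
      case (Suc m)
      then show ?case using less[of m] by simp
    qed
    then show False using Fn by (meson Suc_n_not_le_n order_refl order_trans)
  qed
  then obtain m where m: "m < n" "card (F m) = card (F (Suc m))" by blast
  have inj: "inj_on (take m) (F (Suc m))"
    using m(2) img[of m] by (intro eq_card_imp_inj_on fin) simp
  have det: "s (Suc m) i = s (Suc m) j" if "i \<le> N - n" "j \<le> N - n" "s m i = s m j" for i j
  proof (rule inj_onD[OF inj])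
    show "take m (s (Suc m) i) = take m (s (Suc m) j)" using that by (simp add: take_s)
  qed (use that in \<open>auto simp: F_def\<close>)
  \<comment> \<open>There are n + 1 positions from 0 to n, all admissible because N > 2 n, but at
    most n factors of length m.\<close>
  have "\<not> inj_on (s m) {..n}"
  proof
    assume "inj_on (s m) {..n}"
    then have "card (s m ` {..n}) = Suc n" by (simp add: card_image)
    moreover have "s m ` {..n} \<subseteq> F m" using N by (auto simp: F_def)
    then have "card (s m ` {..n}) \<le> card (F m)" by (intro card_mono fin)
    moreover have "card (F m) \<le> card (F n)"
      by (rule lift_Suc_mono_le[of "\<lambda>m. card (F m)", OF le less_imp_le[OF m(1)]])
    ultimately show False using Fn by simp
  qed
  then obtain i j where ij: "i < j" "j \<le> n" "s m i = s m j"
    using linorder_inj_onI'[of "{..n}" "s m"] by fastforce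
  define p where "p = j - i"
  have p: "p \<ge> 1" "p \<le> n" "j = i + p" using ij by (auto simp: p_def)
  have tl: "s m (Suc i) = tl (s (Suc m) i)" for i by (simp add: s_def drop_Suc drop_tl tl_take)
  have st: "s m (i + t) = s m (j + t)" if "j + t \<le> Suc (N - n)" for t
    using that
  proof (induction t)
    case (Suc t)
    then have "s (Suc m) (i + t) = s (Suc m) (j + t)" using ij by (intro det) auto
    then show ?case by (simp add: tl)
  qed (use ij in auto)
  have w_per: "w ! (i + t) = w ! (j + t)" if t: "j + t \<le> N - n + m" for t
  proof (cases "j + t \<le> N - n")
    case True
    have *: "s (Suc m) (i + t) = s (Suc m) (j + t)"
      using True ij by (intro det st) auto
    have "s (Suc m) (i + t) ! 0 = w ! (i + t)" "s (Suc m) (j + t) ! 0 = w ! (j + t)"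
      using True ij N n by (auto simp: s_def N_def)
    then show ?thesis using * by simp
  next
    case False
    \<comment> \<open>Beyond the last admissible position, the letters are read off inside the last
      two windows of length m + 1: these start at \<open>i + t0\<close> and
      \<open>j + t0 = N - n\<close>, and \<open>r\<close> is the offset in them.\<close>
    define t0 where "t0 = N - n - j"
    define r where "r = t - t0"
    have r: "t = t0 + r" "j + t0 = N - n" "r \<le> m" using False t ij N m by (auto simp: t0_def r_def)
    have *: "s (Suc m) (i + t0) = s (Suc m) (j + t0)" using r ij by (intro det st) auto
    have nth: "s (Suc m) x ! r = w ! (x + r)" if "x + r < N" for x
      using that r(3) by (simp add: s_def N_def)
    have "j + t0 + r < N" "i + t0 + r < N" using r(2,3) m(1) N n ij(1) by linarith+
    then have "w ! (i + t0 + r) = w ! (j + t0 + r)" using * nth by metis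
    then show ?thesis using r(1) by (simp add: add.assoc)
  qed
  \<comment> \<open>\<open>w_per\<close> covers indices \<open>j + t\<close> up to
    \<open>N - n + m\<close>, so the periodic stretch ends just before \<open>e\<close>, and at most
    n letters follow.\<close>
  define e where "e = N - n + m + 1"
  define y where "y = drop i (take e w)"
  have e: "e \<le> N" "N \<le> e + n" using m N by (auto simp: e_def)
  have len: "length y = e - i" using e by (simp add: y_def N_def)
  have "y ! t = y ! (t + p)" if "t + p < length y" for t
    using that w_per[of t] p e len by (auto simp: y_def e_def N_def add.assoc add.commute add.left_commute)
  then obtain k v where kv: "y = concat (replicate k (take p y)) @ v" "length v < p"
    using periodic_list_decomp[OF p(1)] by blast
  have "take e w = take i w @ y"
  proof -
    have "i \<le> e" using ij N by (simp add: e_def)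
    then show ?thesis
      unfolding y_def using append_take_drop_id[of i "take e w"] by (simp add: min_absorb1)
  qed
  then have "w = take i w @ y @ drop e w"
    using append_take_drop_id[of e w] by simp
  then have "w = take i w @ concat (replicate k (take p y)) @ (v @ drop e w)"
    using kv(1) by (metis append.assoc)
  moreover have "take p y \<noteq> []" using p len e ij N by auto
  moreover have "length (take i w) \<le> 2 * n" using ij by simp
  moreover have "length (take p y) \<le> 2 * n" using p by simp
  moreover have "length (v @ drop e w) \<le> 2 * n" using kv(2) p e by (simp add: N_def)
  ultimately show ?thesis by blast
qed

definition short_words :: "nat \<Rightarrow> nat \<Rightarrow> nat list set"
  where "short_words g M = {w. set w \<subseteq> {..<g} \<and> length w \<le> M}"

lemma finite_short_words: "finite (short_words g M)"
  unfolding short_words_def by (rule finite_lists_length_le) simp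

text \<open>All factors of \<open>w\<close> lie in W, so \<open>w\<close> has at most n factors of
  length n. The bound on \<open>k\<close> is what makes the later count linear in the
  length.\<close>

lemma factor_closed_periodic:
  fixes W :: "nat list set"
  assumes letters: "\<And>w. w \<in> W \<Longrightarrow> set w \<subseteq> {..<g}"
    and factor: "\<And>u v w. u @ v @ w \<in> W \<Longrightarrow> v \<in> W"
    and n: "n \<ge> 1" "card {w \<in> W. length w = n} \<le> n" and w: "w \<in> W"
  shows "\<exists>u p v k. u \<in> short_words g (2 * n) \<and> p \<in> short_words g (2 * n) \<and> v \<in> short_words g (2 * n) \<and>
    k \<le> length w \<and> w = u @ concat (replicate k p) @ v"
proof -
  have fin: "finite {w \<in> W. length w = n}"
    by (rule finite_subset[OF _ finite_short_words[of g n]]) (use letters in \<open>auto simp: short_words_def\<close>)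
  have sub: "{take n (drop i w) | i. i + n \<le> length w} \<subseteq> {w \<in> W. length w = n}"
  proof safe
    fix i assume i: "i + n \<le> length w"
    have "take i w @ take n (drop i w) @ drop (i + n) w = w"
      by (metis append.assoc append_take_drop_id take_add)
    then show "take n (drop i w) \<in> W" using factor w by metis
    show "length (take n (drop i w)) = n" using i by simp
  qed
  have card: "card {take n (drop i w) | i. i + n \<le> length w} \<le> n"
    using card_mono[OF fin sub] n by simp
  from few_factors_imp_periodic[OF n(1) card] obtain u p v k where
    "w = u @ concat (replicate k p) @ v \<and> p \<noteq> [] \<and> length u \<le> 2 * n \<and> length p \<le> 2 * n \<and> length v \<le> 2 * n
      \<or> w = u \<and> length u \<le> 2 * n" by blast
  then show ?thesis
  proof
    assume *: "w = u @ concat (replicate k p) @ v \<and> p \<noteq> [] \<and> length u \<le> 2 * n \<and> length p \<le> 2 * n \<and> length v \<le> 2 * n"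
    have "k \<le> k * length p" using * by (cases p) auto
    moreover have "length w = length u + (k * length p + length v)"
      using * by (simp add: length_concat sum_list_replicate)
    ultimately have k: "k \<le> length w" by linarith
    show ?thesis
    proof (cases "k = 0")
      \<comment> \<open>With k = 0 the word \<open>p\<close> does not occur in \<open>w\<close>, so
        nothing is known about its letters; the empty word replaces it.\<close>
      case True
      then show ?thesis using letters[OF w] *
        by - (rule exI[of _ u], rule exI[of _ "[]"], rule exI[of _ v], rule exI[of _ 0], auto simp: short_words_def)
    next
      case False
      then have "set p \<subseteq> {..<g}" using * letters[OF w] by (cases k) auto
      then show ?thesis using letters[OF w] * k
        by - (rule exI[of _ u], rule exI[of _ p], rule exI[of _ v], rule exI[of _ k], auto simp: short_words_def)
    qed
  next
    assume "w = u \<and> length u \<le> 2 * n"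
    then show ?thesis using letters[OF w]
      by - (rule exI[of _ w], rule exI[of _ "[]"], rule exI[of _ "[]"], rule exI[of _ 0], auto simp: short_words_def)
  qed
qed

text \<open>The words \<open>u\<close>, \<open>p\<close>, \<open>v\<close> range over a fixed finite
  set; only the exponent k, between 0 and N, depends on N.\<close>

lemma factor_closed_linear_growth:
  fixes W :: "nat list set"
  assumes letters: "\<And>w. w \<in> W \<Longrightarrow> set w \<subseteq> {..<g}"
    and factor: "\<And>u v w. u @ v @ w \<in> W \<Longrightarrow> v \<in> W"
    and n: "n \<ge> 1" "card {w \<in> W. length w = n} \<le> n"
  shows "card {w \<in> W. length w \<le> N} \<le> card (short_words g (2 * n)) ^ 3 * (N + 1)"
proof -
  let ?S = "short_words g (2 * n)"
  define f where "f = (\<lambda>(u :: nat list, p, v, k). u @ concat (replicate k p) @ v)"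
  have fin: "finite (?S \<times> ?S \<times> ?S \<times> {..N})" using finite_short_words by auto
  have "{w \<in> W. length w \<le> N} \<subseteq> f ` (?S \<times> ?S \<times> ?S \<times> {..N})"
  proof
    fix w assume w: "w \<in> {w \<in> W. length w \<le> N}"
    then have "w \<in> W" by simp
    have "\<exists>u p v k. u \<in> ?S \<and> p \<in> ?S \<and> v \<in> ?S \<and> k \<le> length w \<and> w = u @ concat (replicate k p) @ v"
      by (rule factor_closed_periodic[OF _ _ n \<open>w \<in> W\<close>]) (fact letters, fact factor)
    then obtain u p v k where *: "u \<in> ?S" "p \<in> ?S" "v \<in> ?S"
      "k \<le> length w" "w = u @ concat (replicate k p) @ v"
      by blast
    then have "w = f (u, p, v, k)" by (simp add: f_def)
    then show "w \<in> f ` (?S \<times> ?S \<times> ?S \<times> {..N})" using * w by (intro image_eqI[of _ f "(u, p, v, k)"]) auto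
  qed
  then have "card {w \<in> W. length w \<le> N} \<le> card (?S \<times> ?S \<times> ?S \<times> {..N})"
    using fin by (meson card_image_le card_mono finite_imageI order_trans)
  also have "\<dots> = card ?S ^ 3 * (N + 1)"
    by (simp add: card_cartesian_product power3_eq_cube algebra_simps)
  finally show ?thesis .
qed

section \<open>Normal words\<close>

context ring
begin

primrec word_prod :: "(nat \<Rightarrow> 'a) \<Rightarrow> nat list \<Rightarrow> 'a"
  where
    "word_prod x [] = \<one>"
  | "word_prod x (i # w) = x i \<otimes> word_prod x w"

lemma word_prod_closed: "(\<And>i. i \<in> set w \<Longrightarrow> x i \<in> carrier R) \<Longrightarrow> word_prod x w \<in> carrier R"
  by (induction w) auto

lemma word_prod_append:
  "(\<And>i. i \<in> set u \<union> set v \<Longrightarrow> x i \<in> carrier R) \<Longrightarrow> word_prod x (u @ v) = word_prod x u \<otimes> word_prod x v"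
  by (induction u) (auto simp: m_assoc word_prod_closed)

lemma word_prod_replicate:
  "(\<And>i. i \<in> set p \<Longrightarrow> x i \<in> carrier R) \<Longrightarrow> word_prod x (concat (replicate k p)) = word_prod x p [^] k"
proof (induction k)
  case (Suc k)
  then have "word_prod x (concat (replicate (Suc k) p)) = word_prod x p \<otimes> word_prod x p [^] k"
    using word_prod_append[of p "concat (replicate k p)" x] by fastforce
  also have "\<dots> = word_prod x p [^] Suc k"
    using Suc.prems word_prod_closed[of p x] by (intro nat_pow_Suc2[symmetric]) auto
  finally show ?case .
qed simp

inductive_set word_span :: "'a set \<Rightarrow> (nat \<Rightarrow> 'a) \<Rightarrow> nat \<Rightarrow> nat \<Rightarrow> 'a set"
  for D x g N where
    zero: "\<zero> \<in> word_span D x g N"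
  | add: "a \<in> word_span D x g N \<Longrightarrow> w \<in> short_words g N \<Longrightarrow> d \<in> D \<Longrightarrow>
      a \<oplus> word_prod x w \<otimes> d \<in> word_span D x g N"

end

text \<open>The length-lexicographic order is compatible with concatenation on both sides, and every
  word has only finitely many predecessors.\<close>

definition smaller_words :: "nat \<Rightarrow> nat list \<Rightarrow> nat list set"
  where "smaller_words g w = {v. set v \<subseteq> {..<g} \<and> (v, w) \<in> lenlex less_than}"

lemma smaller_words_subset: "smaller_words g w \<subseteq> short_words g (length w)"
  by (auto simp: smaller_words_def short_words_def dest: lenlex_length)

lemma finite_smaller_words: "finite (smaller_words g w)"
  using finite_subset[OF smaller_words_subset finite_short_words] .

lemma smaller_words_mono:
  assumes "v \<in> smaller_words g v'" "set u \<subseteq> {..<g}" "set w \<subseteq> {..<g}"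
  shows "u @ v @ w \<in> smaller_words g (u @ v' @ w)"
  using assms by (auto simp: smaller_words_def irrefl_def intro: lenlex_append1)

lemma smaller_words_trans: "u \<in> smaller_words g v \<Longrightarrow> v \<in> smaller_words g w \<Longrightarrow> u \<in> smaller_words g w"
  using lenlex_trans[OF _ _ trans_less_than] by (auto simp: smaller_words_def)

lemma not_smaller_self: "w \<notin> smaller_words g w"
  by (auto simp: smaller_words_def dest: lenlex_irreflexive[THEN notE, rotated])

lemma smaller_words_total:
  "set v \<subseteq> {..<g} \<Longrightarrow> set w \<subseteq> {..<g} \<Longrightarrow> v \<noteq> w \<Longrightarrow> v \<in> smaller_words g w \<or> w \<in> smaller_words g v"
  using total_lenlex[OF total_less_than] by (auto simp: smaller_words_def total_on_def)

text \<open>Embeds the order on words with letters below g into the natural numbers, for inductions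
  and for \<open>indep_of_rank\<close>.\<close>

definition word_rank :: "nat \<Rightarrow> nat list \<Rightarrow> nat"
  where "word_rank g w = card (smaller_words g w)"

lemma word_rank_less:
  assumes "v \<in> smaller_words g w"
  shows "word_rank g v < word_rank g w"
  unfolding word_rank_def
proof (rule psubset_card_mono[OF finite_smaller_words])
  show "smaller_words g v \<subset> smaller_words g w"
    using assms smaller_words_trans not_smaller_self by blast
qed

lemma word_rank_less_iff:
  assumes "set v \<subseteq> {..<g}" "set w \<subseteq> {..<g}"
  shows "word_rank g v < word_rank g w \<longleftrightarrow> v \<in> smaller_words g w"
  using assms smaller_words_total[of v g w] word_rank_less[of v g w] word_rank_less[of w g v]
  by (metis less_irrefl less_asym)

lemma inj_on_word_rank: "inj_on (word_rank g) {w. set w \<subseteq> {..<g}}"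
proof (rule inj_onI)
  fix v w assume "v \<in> {w. set w \<subseteq> {..<g}}" "w \<in> {w. set w \<subseteq> {..<g}}" "word_rank g v = word_rank g w"
  then show "v = w"
    using smaller_words_total[of v g w] word_rank_less[of v g w] word_rank_less[of w g v] by auto
qed

locale central_words = torsion_closed R D I for R (structure) and D I +
  fixes x :: "nat \<Rightarrow> 'a" and g :: nat
  assumes I_ideal: "ideal I R"
    and D_central: "d \<in> D \<Longrightarrow> a \<in> carrier R \<Longrightarrow> d \<otimes> a = a \<otimes> d"
    and x_carrier: "i < g \<Longrightarrow> x i \<in> carrier R"
begin

definition normal :: "nat list \<Rightarrow> bool"
  where "normal w \<longleftrightarrow> set w \<subseteq> {..<g} \<and> word_prod x w \<notin> cl (smaller_words g w) (word_prod x)"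

definition normals :: "nat \<Rightarrow> nat list set"
  where "normals N = {w. normal w \<and> length w \<le> N}"

lemma word_closed [simp]: "set w \<subseteq> {..<g} \<Longrightarrow> word_prod x w \<in> carrier R"
  by (rule word_prod_closed) (auto intro: x_carrier)

lemma word_append: "set u \<subseteq> {..<g} \<Longrightarrow> set v \<subseteq> {..<g} \<Longrightarrow> word_prod x (u @ v) = word_prod x u \<otimes> word_prod x v"
  by (rule word_prod_append) (auto intro: x_carrier)

lemma normal_letters: "normal w \<Longrightarrow> set w \<subseteq> {..<g}"
  by (simp add: normal_def)

lemma normals_subset: "normals N \<subseteq> short_words g N"
  by (auto simp: normals_def short_words_def dest: normal_letters)

lemma finite_normals: "finite (normals N)"
  using finite_subset[OF normals_subset finite_short_words] .

lemma normals_closed: "w \<in> normals N \<Longrightarrow> word_prod x w \<in> carrier R"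
  by (simp add: normals_def normal_letters)

lemma smaller_closed: "v \<in> smaller_words g w \<Longrightarrow> word_prod x v \<in> carrier R"
  by (simp add: smaller_words_def)

lemma cl_two_sided:
  assumes fin: "finite J" "finite B" and b: "\<And>i. i \<in> B \<Longrightarrow> \<beta> i \<in> carrier R"
    and a: "a \<in> carrier R" "c \<in> carrier R"
    and J: "\<And>j. j \<in> J \<Longrightarrow> b j \<in> carrier R" "\<And>j. j \<in> J \<Longrightarrow> a \<otimes> b j \<otimes> c \<in> cl B \<beta>"
    and m: "m \<in> cl J b"
  shows "a \<otimes> m \<otimes> c \<in> cl B \<beta>"
proof -
  interpret I: ideal I R by (rule I_ideal)
  show ?thesis
  proof (rule cl_map_cl[where f = "\<lambda>m. a \<otimes> m \<otimes> c", OF fin(2) b _ _ _ _ J m])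
    show "a \<otimes> (m \<otimes> e) \<otimes> c = a \<otimes> m \<otimes> c \<otimes> e" if "m \<in> carrier R" "e \<in> D" for m e
      using that a D_central[of e c] by (simp add: m_assoc)
    show "a \<otimes> t \<otimes> c \<in> cl B \<beta>" if "t \<in> I" for t
    proof (rule cl_T[OF _ b])
      show "a \<otimes> t \<otimes> c \<in> I" by (intro I.I_r_closed I.I_l_closed that a)
    qed
  qed (use a in \<open>auto simp: r_distr l_distr\<close>)
qed

text \<open>If \<open>v\<close> depends on smaller words y, then u v w depends on the words u y w,
  which are smaller than it. Multiplication on both sides respects closures because D is central and
  I is two-sided.\<close>

lemma normal_factor:
  assumes n: "normal (u @ v @ w)"
  shows "normal v"
proof (rule ccontr)
  have lt: "set u \<subseteq> {..<g}" "set v \<subseteq> {..<g}" "set w \<subseteq> {..<g}" using normal_letters[OF n] by auto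
  assume "\<not> normal v"
  then have v: "word_prod x v \<in> cl (smaller_words g v) (word_prod x)" using lt by (simp add: normal_def)
  have mult: "word_prod x (u @ y @ w) = word_prod x u \<otimes> word_prod x y \<otimes> word_prod x w" if "set y \<subseteq> {..<g}" for y
    using that lt by (simp add: word_append m_assoc)
  have "word_prod x u \<otimes> word_prod x v \<otimes> word_prod x w \<in> cl (smaller_words g (u @ v @ w)) (word_prod x)"
  proof (rule cl_two_sided[OF finite_smaller_words finite_smaller_words _ _ _ _ _ v])
    fix y assume y: "y \<in> smaller_words g v"
    then have "u @ y @ w \<in> smaller_words g (u @ v @ w)" using lt by (intro smaller_words_mono)
    then have "word_prod x (u @ y @ w) \<in> cl (smaller_words g (u @ v @ w)) (word_prod x)"
      by (intro cl_incl finite_smaller_words smaller_closed)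
    then show "word_prod x u \<otimes> word_prod x y \<otimes> word_prod x w \<in> cl (smaller_words g (u @ v @ w)) (word_prod x)"
      using mult[of y] y by (simp add: smaller_words_def)
  qed (use lt in \<open>auto intro: smaller_closed\<close>)
  then show False using n mult lt by (simp add: normal_def)
qed

lemma normal_indep:
  assumes "finite J" "\<And>w. w \<in> J \<Longrightarrow> normal w"
  shows "indep J (word_prod x)"
proof (rule indep_of_rank[where r = "word_rank g"])
  show "inj_on (word_rank g) J"
    using inj_on_subset[OF inj_on_word_rank] assms normal_letters by blast
  fix w assume w: "w \<in> J"
  show "word_prod x w \<notin> cl {v \<in> J. word_rank g v < word_rank g w} (word_prod x)"
  proof
    assume *: "word_prod x w \<in> cl {v \<in> J. word_rank g v < word_rank g w} (word_prod x)"
    have "cl {v \<in> J. word_rank g v < word_rank g w} (word_prod x) \<subseteq> cl (smaller_words g w) (word_prod x)"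
    proof (rule cl_subset[OF finite_smaller_words smaller_closed])
      fix v assume "v \<in> {v \<in> J. word_rank g v < word_rank g w}"
      then have "v \<in> smaller_words g w"
        using word_rank_less_iff[of v g w] assms(2) w by (simp add: normal_letters)
      then show "word_prod x v \<in> cl (smaller_words g w) (word_prod x)"
        by (intro cl_incl finite_smaller_words smaller_closed)
    qed
    then show False using * assms(2)[OF w] by (auto simp: normal_def)
  qed
qed (use assms in \<open>auto simp: normal_letters\<close>)

text \<open>Rewriting: a word that is not normal depends on smaller words. These are not longer, so
  the induction on the rank never leaves length N.\<close>

lemma word_in_cl_normals:
  assumes "w \<in> short_words g N"
  shows "word_prod x w \<in> cl (normals N) (word_prod x)"
  using assms
proof (induction "word_rank g w" arbitrary: w rule: less_induct)
  case less
  show ?case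
  proof (cases "normal w")
    case True
    then have "w \<in> normals N" using less.prems by (simp add: normals_def short_words_def)
    then show ?thesis by (intro cl_incl finite_normals normals_closed)
  next
    case False
    then have w: "word_prod x w \<in> cl (smaller_words g w) (word_prod x)"
      using less.prems by (auto simp: normal_def short_words_def)
    have "cl (smaller_words g w) (word_prod x) \<subseteq> cl (normals N) (word_prod x)"
    proof (rule cl_subset[OF finite_normals normals_closed])
      fix v assume v: "v \<in> smaller_words g w"
      then have "length v \<le> length w" using smaller_words_subset by (auto simp: short_words_def)
      with v have "v \<in> short_words g N" using less.prems by (auto simp: smaller_words_def short_words_def)
      then show "word_prod x v \<in> cl (normals N) (word_prod x)"
        using less.hyps[of v] word_rank_less[OF v] by simp
    qed
    with w show ?thesis by blast
  qed
qed

lemma word_span_subset_cl_normals: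
  assumes "D' \<subseteq> D"
  shows "word_span D' x g N \<subseteq> cl (normals N) (word_prod x)"
proof
  interpret C: additive_subgroup "cl (normals N) (word_prod x)" R
    by (rule cl_subgroup[OF finite_normals normals_closed])
  fix m assume "m \<in> word_span D' x g N"
  then show "m \<in> cl (normals N) (word_prod x)"
  proof induction
    case (add a w d)
    have "word_prod x w \<otimes> d \<in> cl (normals N) (word_prod x)"
      by (rule cl_mult[OF word_in_cl_normals _ finite_normals normals_closed]) (use add assms in auto)
    with add show ?case by auto
  qed auto
qed

text \<open>Turns a growth bound for normal words into a bound on ranks: the normal words of length
  at most N generate, up to closure, everything written in words of length at most N.\<close>

lemma rank_le_card_normals:
  assumes "finite J" "indep J b" "D' \<subseteq> D" "\<And>j. j \<in> J \<Longrightarrow> b j \<in> word_span D' x g N"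
  shows "card J \<le> card (normals N)"
  by (rule exchange[OF assms(1) finite_normals normals_closed assms(2)])
    (use assms word_span_subset_cl_normals in blast)+

lemma normals_linear_growth:
  assumes "n \<ge> 1" "card {w. normal w \<and> length w = n} \<le> n"
  shows "\<exists>C. \<forall>N. card (normals N) \<le> C * (N + 1)"
proof -
  have "card {w \<in> Collect normal. length w \<le> N} \<le> card (short_words g (2 * n)) ^ 3 * (N + 1)" for N
  proof (rule factor_closed_linear_growth)
    show "card {w \<in> Collect normal. length w = n} \<le> n" using assms(2) by simp
  qed (use assms(1) normal_letters normal_factor in auto)
  then show ?thesis by (auto simp: normals_def)
qed

lemma normal_periodic:
  assumes "n \<ge> 1" "card {w. normal w \<and> length w = n} \<le> n" "normal w"
  shows "\<exists>u p v k. u \<in> short_words g (2 * n) \<and> p \<in> short_words g (2 * n) \<and> v \<in> short_words g (2 * n) \<and>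
    k \<le> length w \<and> w = u @ concat (replicate k p) @ v"
proof (rule factor_closed_periodic[where W = "Collect normal"])
  show "card {w \<in> Collect normal. length w = n} \<le> n" using assms(2) by simp
qed (use assms normal_letters normal_factor in auto)

end

section \<open>Adjoining an element to a commuting subring\<close>

context ring
begin

text \<open>Values in R of polynomials of degree below n. An element can have several such
  expressions unless \<open>p\<close> is transcendental.\<close>

primrec polys_below :: "'a set \<Rightarrow> 'a \<Rightarrow> nat \<Rightarrow> 'a set"
  where
    "polys_below D p 0 = {\<zero>}"
  | "polys_below D p (Suc n) = {f \<oplus> p [^] n \<otimes> c | f c. f \<in> polys_below D p n \<and> c \<in> D}"

definition adjoin :: "'a set \<Rightarrow> 'a \<Rightarrow> 'a set"
  where "adjoin D p = (\<Union>n. polys_below D p n)"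

text \<open>The leading coefficient is only required to be nonzero: over a domain D this is
  algebraicity over the fraction field, not integrality.\<close>

definition algebraic_elem :: "'a set \<Rightarrow> 'a \<Rightarrow> bool"
  where "algebraic_elem D p \<longleftrightarrow> (\<exists>n. \<exists>f \<in> polys_below D p n. \<exists>c \<in> D - {\<zero>}. f \<oplus> p [^] n \<otimes> c = \<zero>)"

end

locale simple_ext = ring R for R (structure) +
  fixes D :: "'a set" and p :: 'a
  assumes D_subring: "subring D R" and p_carrier [simp]: "p \<in> carrier R"
    and D_comm: "c \<in> D \<Longrightarrow> d \<in> D \<Longrightarrow> c \<otimes> d = d \<otimes> c"
    and p_comm: "c \<in> D \<Longrightarrow> c \<otimes> p = p \<otimes> c"
begin

lemma D_closed [simp, intro]:
  "c \<in> D \<Longrightarrow> c \<in> carrier R" "\<zero> \<in> D" "\<one> \<in> D" "c \<in> D \<Longrightarrow> d \<in> D \<Longrightarrow> c \<otimes> d \<in> D" "c \<in> D \<Longrightarrow> d \<in> D \<Longrightarrow> c \<oplus> d \<in> D"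
  "c \<in> D \<Longrightarrow> \<ominus> c \<in> D"
  using subringE[OF D_subring] by auto

abbreviation P :: "nat \<Rightarrow> 'a set"
  where "P \<equiv> polys_below D p"

lemma P_SucI: "f \<in> P n \<Longrightarrow> c \<in> D \<Longrightarrow> f \<oplus> p [^] n \<otimes> c \<in> P (Suc n)"
  by auto

lemma P_SucE:
  assumes "h \<in> P (Suc n)"
  obtains f c where "f \<in> P n" "c \<in> D" "h = f \<oplus> p [^] n \<otimes> c"
  using assms by auto

lemma P_closed: "f \<in> P n \<Longrightarrow> f \<in> carrier R"
proof (induction n arbitrary: f)
  case (Suc n)
  from Suc.prems obtain h c where "h \<in> P n" "c \<in> D" "f = h \<oplus> p [^] n \<otimes> c" by (rule P_SucE)
  with Suc.IH[of h] show ?case by simp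
qed simp

lemma P_Suc_mono: "f \<in> P n \<Longrightarrow> f \<in> P (Suc n)"
  using P_SucI[of f n \<zero>] P_closed[of f n] by (simp del: polys_below.simps)

lemma P_mono: "n \<le> m \<Longrightarrow> f \<in> P n \<Longrightarrow> f \<in> P m"
  by (induction rule: dec_induct) (auto intro: P_Suc_mono simp del: polys_below.simps)

lemma P_zero: "\<zero> \<in> P n"
  using P_mono[of 0 n \<zero>] by simp

lemma P_monom: "c \<in> D \<Longrightarrow> p [^] n \<otimes> c \<in> P (Suc n)"
  using P_SucI[OF P_zero, of c n] by (simp del: polys_below.simps)

lemma P_add: "f \<in> P n \<Longrightarrow> h \<in> P n \<Longrightarrow> f \<oplus> h \<in> P n"
proof (induction n arbitrary: f h)
  case (Suc n)
  from Suc.prems(1) obtain f' c where f: "f' \<in> P n" "c \<in> D" "f = f' \<oplus> p [^] n \<otimes> c" by (rule P_SucE)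
  from Suc.prems(2) obtain h' d where h: "h' \<in> P n" "d \<in> D" "h = h' \<oplus> p [^] n \<otimes> d" by (rule P_SucE)
  have "f \<oplus> h = (f' \<oplus> h') \<oplus> p [^] n \<otimes> (c \<oplus> d)"
    using f h P_closed[OF f(1)] P_closed[OF h(1)] by (simp add: r_distr a_ac)
  then show ?case using P_SucI[OF Suc.IH[OF f(1) h(1)], of "c \<oplus> d"] f h by simp
qed simp

lemma P_mult_D: "f \<in> P n \<Longrightarrow> d \<in> D \<Longrightarrow> f \<otimes> d \<in> P n"
proof (induction n arbitrary: f)
  case (Suc n)
  from Suc.prems(1) obtain f' c where f: "f' \<in> P n" "c \<in> D" "f = f' \<oplus> p [^] n \<otimes> c" by (rule P_SucE)
  have "f \<otimes> d = f' \<otimes> d \<oplus> p [^] n \<otimes> (c \<otimes> d)"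
    using f Suc.prems(2) P_closed[OF f(1)] by (simp add: l_distr m_assoc)
  then show ?case using P_SucI[OF Suc.IH[OF f(1) Suc.prems(2)], of "c \<otimes> d"] f Suc.prems by simp
qed simp

lemma P_shift: "f \<in> P n \<Longrightarrow> p [^] m \<otimes> f \<in> P (n + m)"
proof (induction n arbitrary: f)
  case 0
  then show ?case using P_zero by simp
next
  case (Suc n)
  from Suc.prems(1) obtain f' c where f: "f' \<in> P n" "c \<in> D" "f = f' \<oplus> p [^] n \<otimes> c" by (rule P_SucE)
  have "p [^] m \<otimes> f = p [^] m \<otimes> f' \<oplus> p [^] (n + m) \<otimes> c"
    using f P_closed[OF f(1)] by (simp add: r_distr m_assoc[symmetric] nat_pow_mult add.commute)
  then show ?case using P_SucI[OF Suc.IH[OF f(1)] f(2)] by simp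
qed

lemma commutes:
  assumes a: "a \<in> carrier R" "a \<otimes> p = p \<otimes> a" "\<And>d. d \<in> D \<Longrightarrow> a \<otimes> d = d \<otimes> a"
  shows "f \<in> P n \<Longrightarrow> a \<otimes> f = f \<otimes> a"
proof (induction n arbitrary: f)
  case (Suc n)
  from Suc.prems(1) obtain f' c where f: "f' \<in> P n" "c \<in> D" "f = f' \<oplus> p [^] n \<otimes> c" by (rule P_SucE)
  have pn: "a \<otimes> p [^] n = p [^] n \<otimes> a" for n :: nat
  proof (induction n)
    case (Suc n)
    have "a \<otimes> p [^] Suc n = (a \<otimes> p [^] n) \<otimes> p" using a by (simp add: m_assoc)
    also have "\<dots> = p [^] Suc n \<otimes> a" unfolding Suc using a by (simp add: m_assoc)
    finally show ?case .
  qed (use a in simp)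
  have "a \<otimes> (p [^] n \<otimes> c) = (a \<otimes> p [^] n) \<otimes> c" using a f by (simp add: m_assoc)
  also have "\<dots> = p [^] n \<otimes> c \<otimes> a" unfolding pn using a f by (simp add: m_assoc)
  finally show ?case using Suc.IH[OF f(1)] f a P_closed[OF f(1)] by (simp add: r_distr l_distr)
qed (use a in simp)

lemma P_comm_p: "f \<in> P n \<Longrightarrow> p [^] m \<otimes> f = f \<otimes> p [^] (m :: nat)"
proof (rule commutes[of "p [^] m" f n])
  show "p [^] m \<otimes> p = p \<otimes> p [^] m" using nat_pow_Suc2[of p m] by simp
  fix d assume d: "d \<in> D"
  show "p [^] m \<otimes> d = d \<otimes> p [^] m"
  proof (induction m)
    case (Suc m)
    have "p [^] Suc m \<otimes> d = p [^] m \<otimes> d \<otimes> p" using d p_comm[OF d] by (simp add: m_assoc)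
    then show ?case using Suc d by (simp add: m_assoc)
  qed (use d in simp)
qed auto

lemma P_comm_D: "f \<in> P n \<Longrightarrow> d \<in> D \<Longrightarrow> d \<otimes> f = f \<otimes> d"
  by (rule commutes) (auto simp: p_comm D_comm)

lemma P_mult: "f \<in> P n \<Longrightarrow> h \<in> P m \<Longrightarrow> f \<otimes> h \<in> P (n + m)"
proof (induction m arbitrary: h)
  case 0
  then show ?case using P_closed[of f n] P_zero by simp
next
  case (Suc m)
  from Suc.prems(2) obtain h' c where h: "h' \<in> P m" "c \<in> D" "h = h' \<oplus> p [^] m \<otimes> c" by (rule P_SucE)
  have f: "f \<in> carrier R" "f \<otimes> p [^] m = p [^] m \<otimes> f"
    using Suc.prems(1) P_closed P_comm_p by auto
  have "f \<otimes> h = f \<otimes> h' \<oplus> (p [^] m \<otimes> f) \<otimes> c"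
    unfolding f(2)[symmetric] using h f(1) P_closed[OF h(1)] by (simp add: r_distr m_assoc)
  moreover have "f \<otimes> h' \<in> P (n + m)" using Suc.IH[OF Suc.prems(1) h(1)] .
  moreover have "(p [^] m \<otimes> f) \<otimes> c \<in> P (n + m)" using P_mult_D[OF P_shift[OF Suc.prems(1)] h(2)] .
  ultimately have "f \<otimes> h \<in> P (n + m)" using P_add by simp
  then show ?case using P_Suc_mono by (simp del: polys_below.simps)
qed

lemma adjoinI: "f \<in> P n \<Longrightarrow> f \<in> adjoin D p"
  by (auto simp: adjoin_def)

lemma adjoinE:
  assumes "f \<in> adjoin D p"
  obtains n where "f \<in> P n"
  using assms by (auto simp: adjoin_def)

lemma adjoin_closed: "f \<in> adjoin D p \<Longrightarrow> f \<in> carrier R"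
  by (auto simp: adjoin_def P_closed)

lemma D_sub_adjoin: "c \<in> D \<Longrightarrow> c \<in> adjoin D p"
  using P_monom[of c 0] by (auto intro!: adjoinI[of _ "Suc 0"] simp del: polys_below.simps)

lemma p_power_adjoin: "p [^] (n :: nat) \<in> adjoin D p"
  using P_monom[of \<one> n] by (auto intro!: adjoinI[of _ "Suc n"] simp del: polys_below.simps)

lemma p_adjoin: "p \<in> adjoin D p"
  using p_power_adjoin[of "Suc 0"] by simp

lemma adjoin_subring: "subring (adjoin D p) R"
proof (rule subringI)
  show "adjoin D p \<subseteq> carrier R" using adjoin_closed by auto
  show "\<one> \<in> adjoin D p" by (rule D_sub_adjoin) auto
  fix f assume f: "f \<in> adjoin D p"
  then obtain n where n: "f \<in> P n" by (rule adjoinE)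
  have "f \<otimes> (\<ominus> \<one>) = \<ominus> f" using adjoin_closed[OF f] by (simp add: r_minus)
  then show "\<ominus> f \<in> adjoin D p" using P_mult_D[OF n, of "\<ominus> \<one>"] by (auto intro: adjoinI)
  fix h assume h: "h \<in> adjoin D p"
  then obtain m where m: "h \<in> P m" by (rule adjoinE)
  show "f \<otimes> h \<in> adjoin D p" using P_mult[OF n m] by (rule adjoinI)
  show "f \<oplus> h \<in> adjoin D p" using P_add[OF P_mono[OF _ n] P_mono[OF _ m], of "max n m"]
    by (auto intro: adjoinI)
qed

lemma adjoin_commutes:
  assumes "a \<in> carrier R" "a \<otimes> p = p \<otimes> a" "\<And>d. d \<in> D \<Longrightarrow> a \<otimes> d = d \<otimes> a" "f \<in> adjoin D p"
  shows "a \<otimes> f = f \<otimes> a"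
proof -
  from assms(4) obtain n where "f \<in> P n" by (rule adjoinE)
  with assms(1-3) show ?thesis by (rule commutes)
qed

lemma adjoin_comm:
  assumes "e \<in> adjoin D p" "f \<in> adjoin D p"
  shows "e \<otimes> f = f \<otimes> e"
proof (rule adjoin_commutes[OF _ _ _ assms(2)])
  from assms(1) obtain n where n: "e \<in> P n" by (rule adjoinE)
  show "e \<in> carrier R" using n by (rule P_closed)
  show "e \<otimes> p = p \<otimes> e" using P_comm_p[OF n, of 1] by simp
  show "e \<otimes> d = d \<otimes> e" if "d \<in> D" for d using P_comm_D[OF n that] by simp
qed

lemma leading_term:
  assumes "e \<in> adjoin D p" "e \<noteq> \<zero>"
  obtains n f c where "f \<in> P n" "c \<in> D" "c \<noteq> \<zero>" "e = f \<oplus> p [^] n \<otimes> c"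
proof -
  from assms(1) obtain m where "e \<in> P m" by (rule adjoinE)
  then have "\<exists>n. \<exists>f \<in> P n. \<exists>c \<in> D. c \<noteq> \<zero> \<and> e = f \<oplus> p [^] n \<otimes> c"
  proof (induction m)
    case 0
    then show ?case using assms(2) by simp
  next
    case (Suc m)
    from Suc.prems obtain f c where f: "f \<in> P m" "c \<in> D" "e = f \<oplus> p [^] m \<otimes> c" by (rule P_SucE)
    show ?case
    proof (cases "c = \<zero>")
      case True
      then have "e = f" using f P_closed[OF f(1)] by simp
      then show ?thesis using Suc.IH f(1) by simp
    next
      case False
      with f show ?thesis by blast
    qed
  qed
  then show thesis using that by blast
qed

lemma transcendental_leading:
  assumes "\<not> algebraic_elem D p" "f \<in> P n" "c \<in> D" "f \<oplus> p [^] n \<otimes> c = \<zero>"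
  shows "c = \<zero>"
  using assms unfolding algebraic_elem_def by blast

text \<open>The leading term of a product is p^(n + m) c c', so a zero product forces c c' = 0 by
  transcendence.\<close>

lemma adjoin_integral:
  assumes tr: "\<not> algebraic_elem D p" and int: "\<And>c d. c \<in> D \<Longrightarrow> d \<in> D \<Longrightarrow> c \<otimes> d = \<zero> \<Longrightarrow> c = \<zero> \<or> d = \<zero>"
    and e: "e \<in> adjoin D p" "e' \<in> adjoin D p" "e \<otimes> e' = \<zero>"
  shows "e = \<zero> \<or> e' = \<zero>"
proof (rule ccontr)
  assume nz: "\<not> (e = \<zero> \<or> e' = \<zero>)"
  then have nz1: "e \<noteq> \<zero>" and nz2: "e' \<noteq> \<zero>" by auto
  from leading_term[OF e(1) nz1] obtain n f c where
    f: "f \<in> P n" "c \<in> D" "c \<noteq> \<zero>" "e = f \<oplus> p [^] n \<otimes> c" .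
  from leading_term[OF e(2) nz2] obtain m f' c' where
    f': "f' \<in> P m" "c' \<in> D" "c' \<noteq> \<zero>" "e' = f' \<oplus> p [^] m \<otimes> c'" .
  \<comment> \<open>The part of \<open>e \<otimes> e'\<close> of degree below n + m.\<close>
  define h where "h = f \<otimes> f' \<oplus> ((p [^] m \<otimes> f) \<otimes> c' \<oplus> (p [^] n \<otimes> f') \<otimes> c)"
  have h: "h \<in> P (n + m)"
    unfolding h_def using P_mult[OF f(1) f'(1)] P_mult_D[OF P_shift[OF f(1)] f'(2)]
      P_mult_D[OF P_shift[OF f'(1)] f(2), of n] by (intro P_add) (auto simp: add.commute)
  have car: "f \<in> carrier R" "f' \<in> carrier R" using P_closed f(1) f'(1) by auto
  have "e \<otimes> e' = f \<otimes> f' \<oplus> (f \<otimes> p [^] m \<otimes> c' \<oplus> (p [^] n \<otimes> (c \<otimes> f') \<oplus> (p [^] n \<otimes> (c \<otimes> p [^] m)) \<otimes> c'))"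
    unfolding f(4) f'(4) using car f(2) f'(2) by (simp add: l_distr r_distr m_assoc a_ac)
  also have "f \<otimes> p [^] m = p [^] m \<otimes> f" using P_comm_p[OF f(1), of m] by simp
  also have "c \<otimes> f' = f' \<otimes> c" using P_comm_D[OF f'(1) f(2)] .
  also have "c \<otimes> p [^] m = p [^] m \<otimes> c"
    using P_comm_p[of c "Suc 0" m] P_monom[of c 0] f(2) by (simp del: polys_below.simps)
  also have "p [^] n \<otimes> (p [^] m \<otimes> c) = p [^] (n + m) \<otimes> c" using f(2) by (simp add: m_assoc[symmetric] nat_pow_mult)
  finally have "e \<otimes> e' = h \<oplus> p [^] (n + m) \<otimes> (c \<otimes> c')"
    unfolding h_def using car f(2) f'(2) by (simp add: m_assoc a_ac)
  then have "c \<otimes> c' = \<zero>" using transcendental_leading[OF tr h] f f' e(3) by auto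
  then show False using int f f' by blast
qed

lemma powers_indep:
  assumes tr: "\<not> algebraic_elem D p"
  shows "lin_indep D {\<zero>} {..<n} (\<lambda>s. p [^] (s :: nat))"
proof -
  \<comment> \<open>Membership of the partial sum in \<open>P n\<close> is proved along with it: it
    lets \<open>transcendental_leading\<close> act on the next coefficient.\<close>
  have main: "(\<forall>s < n. c s \<in> D) \<Longrightarrow> finsum R (\<lambda>s. p [^] s \<otimes> c s) {..<n} \<in> P n \<and>
    (finsum R (\<lambda>s. p [^] s \<otimes> c s) {..<n} = \<zero> \<longrightarrow> (\<forall>s < n. c s = \<zero>))" for c n
  proof (induction n)
    case (Suc n)
    let ?s = "finsum R (\<lambda>s. p [^] s \<otimes> c s) {..<n}"
    have "\<forall>s < n. c s \<in> D" using Suc.prems by simp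
    note ih = Suc.IH[OF this]
    note IH = conjunct1[OF ih] mp[OF conjunct2[OF ih]]
    have c: "c n \<in> D" using Suc.prems by simp
    have s: "finsum R (\<lambda>s. p [^] s \<otimes> c s) {..<Suc n} = ?s \<oplus> p [^] n \<otimes> c n"
      using Suc.prems c P_closed[OF IH(1)] by (simp add: lessThan_Suc finsum_insert Pi_def a_comm)
    have "\<forall>s < Suc n. c s = \<zero>" if 0: "?s \<oplus> p [^] n \<otimes> c n = \<zero>"
    proof -
      have cn: "c n = \<zero>" using transcendental_leading[OF tr IH(1) c 0] .
      then have "?s = \<zero>" using 0 P_closed[OF IH(1)] by simp
      then show ?thesis using IH(2) cn by (simp add: less_Suc_eq)
    qed
    then show ?case unfolding s using P_SucI[OF IH(1) c] by blast
  qed simp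
  show ?thesis unfolding lin_indep_def
  proof (intro allI impI)
    fix c assume c: "\<forall>j \<in> {..<n}. c j \<in> D" and s: "finsum R (\<lambda>j. p [^] j \<otimes> c j) {..<n} \<in> {\<zero>}"
    have "\<forall>s < n. c s \<in> D" using c by simp
    from main[OF this] s show "\<forall>j \<in> {..<n}. c j = \<zero>" by simp
  qed
qed

end

section \<open>Prime rings and Goldie rings\<close>

context ring
begin

text \<open>J consists of all y with a R y = 0, and I of all x with x R J = 0. These are two-sided
  ideals with product 0, one containing \<open>a\<close> and the other \<open>b\<close>.\<close>

lemma prime_ring_elementwise:
  assumes prime: "prime_ring R" and ab: "a \<in> carrier R" "b \<in> carrier R"
    and zero: "\<And>r. r \<in> carrier R \<Longrightarrow> a \<otimes> r \<otimes> b = \<zero>"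
  shows "a = \<zero> \<or> b = \<zero>"
proof -
  define J where "J = {y \<in> carrier R. \<forall>r \<in> carrier R. a \<otimes> r \<otimes> y = \<zero>}"
  define I where "I = {x \<in> carrier R. \<forall>r \<in> carrier R. \<forall>y \<in> J. x \<otimes> r \<otimes> y = \<zero>}"
  have J: "ideal J R"
  proof (rule idealI[OF ring_axioms])
    show "subgroup J (add_monoid R)"
    proof (rule add.subgroupI)
      show "J \<noteq> {}" using ab by (auto simp: J_def intro!: exI[of _ \<zero>])
    qed (use ab in \<open>auto simp: J_def r_distr r_minus\<close>)
    fix y x assume y: "y \<in> J" and x: "x \<in> carrier R"
    have "a \<otimes> r \<otimes> (x \<otimes> y) = a \<otimes> (r \<otimes> x) \<otimes> y" "a \<otimes> r \<otimes> (y \<otimes> x) = a \<otimes> r \<otimes> y \<otimes> x"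
      if "r \<in> carrier R" for r using that x y ab by (auto simp: m_assoc J_def)
    then show "x \<otimes> y \<in> J" "y \<otimes> x \<in> J" using x y by (auto simp: J_def)
  qed
  have I: "ideal I R"
  proof (rule idealI[OF ring_axioms])
    show "subgroup I (add_monoid R)"
    proof (rule add.subgroupI)
      show "I \<noteq> {}" using ab by (auto simp: I_def J_def intro!: exI[of _ \<zero>])
    qed (use ab in \<open>auto simp: I_def J_def l_distr l_minus\<close>)
    fix y x assume y: "y \<in> I" and x: "x \<in> carrier R"
    have "x \<otimes> y \<otimes> r \<otimes> z = x \<otimes> (y \<otimes> r \<otimes> z)" "y \<otimes> x \<otimes> r \<otimes> z = y \<otimes> (x \<otimes> r) \<otimes> z"
      if "r \<in> carrier R" "z \<in> J" for r z using that x y by (auto simp: m_assoc I_def J_def)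
    then show "x \<otimes> y \<in> I" "y \<otimes> x \<in> I" using x y by (auto simp: I_def)
  qed
  have "s = \<zero>" if "s \<in> ideal_prod R I J" for s
    using that
  proof induction
    case (prod i j)
    then have "i \<otimes> \<one> \<otimes> j = \<zero>" unfolding I_def by blast
    then show ?case using prod by (auto simp: I_def)
  qed auto
  moreover have "\<zero> \<in> ideal_prod R I J"
    using additive_subgroup.zero_closed[OF ideal.axioms(1)[OF ideal_prod_is_ideal[OF I J]]] .
  ultimately have "ideal_prod R I J = {\<zero>}" by blast
  then have "I = {\<zero>} \<or> J = {\<zero>}" using prime I J by (auto simp: prime_ring_def)
  moreover have "a \<in> I" using ab by (auto simp: I_def J_def)
  moreover have "b \<in> J" using ab zero by (auto simp: J_def)
  ultimately show ?thesis by auto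
qed

text \<open>If m d = 0 with d central, then m r d = m d r = 0 for every r.\<close>

lemma prime_ring_central_regular:
  assumes prime: "prime_ring R" and d: "d \<in> ring_center R" "d \<noteq> \<zero>" and m: "m \<in> carrier R" "m \<otimes> d = \<zero>"
  shows "m = \<zero>"
proof -
  have dc: "d \<in> carrier R" "\<And>r. r \<in> carrier R \<Longrightarrow> d \<otimes> r = r \<otimes> d" using d by (auto simp: ring_center_def)
  have "m \<otimes> r \<otimes> d = \<zero>" if "r \<in> carrier R" for r
    using that m dc(1) dc(2)[OF that, symmetric] by (simp add: m_assoc m_assoc[of m d r, symmetric])
  then show ?thesis using prime_ring_elementwise[OF prime m(1) dc(1)] d by blast
qed

lemma acc_maximal:
  assumes acc: "acc_left_annihilators R" and ne: "\<A> \<noteq> {}"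
    and ann: "\<And>A. A \<in> \<A> \<Longrightarrow> \<exists>S \<subseteq> carrier R. A = left_annihilator R S"
  shows "\<exists>A \<in> \<A>. \<forall>B \<in> \<A>. A \<subseteq> B \<longrightarrow> B = A"
proof (rule ccontr)
  assume "\<not> ?thesis"
  then have step: "\<exists>B. B \<in> \<A> \<and> A \<subset> B" if "A \<in> \<A>" for A using that by blast
  have "\<exists>f :: nat \<Rightarrow> 'a set. \<forall>n. f n \<in> \<A> \<and> f n \<subset> f (Suc n)"
    by (rule dependent_nat_choice) (use ne step in auto)
  then obtain f :: "nat \<Rightarrow> 'a set" where f: "\<And>n. f n \<in> \<A>" "\<And>n. f n \<subset> f (Suc n)" by blast
  have 1: "\<forall>n. \<exists>S \<subseteq> carrier R. f n = left_annihilator R S" by (intro allI ann f)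
  have 2: "\<forall>n. f n \<subseteq> f (Suc n)" by (intro allI psubset_imp_subset f)
  from mp[OF mp[OF spec[OF acc[unfolded acc_left_annihilators_def], of f] 1] 2]
  have "\<exists>N. \<forall>n \<ge> N. f n = f N" .
  then obtain N where "\<forall>n \<ge> N. f n = f N" by (elim exE)
  then have "f (Suc N) = f N" by (meson le_SucI order_refl)
  with f(2)[of N] show False by simp
qed

abbreviation lann :: "'a \<Rightarrow> 'a set"
  where "lann b \<equiv> left_annihilator R {b}"

lemma lann_iff: "m \<in> lann b \<longleftrightarrow> m \<in> carrier R \<and> m \<otimes> b = \<zero>"
  by (auto simp: left_annihilator_def)

lemma lann_mult: "b \<in> carrier R \<Longrightarrow> c \<in> carrier R \<Longrightarrow> lann b \<subseteq> lann (b \<otimes> c)"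
proof
  fix m assume "b \<in> carrier R" "c \<in> carrier R" "m \<in> lann b"
  then show "m \<in> lann (b \<otimes> c)" using m_assoc[of m b c] by (auto simp: lann_iff)
qed

text \<open>Transfers nilpotence from c a to a c.\<close>

lemma pow_rotate:
  "a \<in> carrier R \<Longrightarrow> c \<in> carrier R \<Longrightarrow> (a \<otimes> c) [^] Suc n = a \<otimes> (c \<otimes> a) [^] n \<otimes> c"
proof (induction n)
  case (Suc n)
  have "(a \<otimes> c) [^] Suc (Suc n) = (a \<otimes> c) [^] Suc n \<otimes> (a \<otimes> c)" by simp
  also have "\<dots> = a \<otimes> (c \<otimes> a) [^] n \<otimes> c \<otimes> (a \<otimes> c)" unfolding Suc.IH[OF Suc.prems] ..
  finally show ?case using Suc.prems by (simp add: m_assoc)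
qed simp

text \<open>Utumi's argument: if \<open>aR\<close> is nil, a nonzero \<open>b \<in> aR\<close> with maximal left annihilator
  satisfies \<open>bRb = 0\<close>.\<close>

lemma prime_acc_not_nil:
  assumes prime: "prime_ring R" and acc: "acc_left_annihilators R" and a: "a \<in> carrier R" "a \<noteq> \<zero>"
  shows "\<exists>r \<in> carrier R. \<forall>n. (r \<otimes> a) [^] (n :: nat) \<noteq> \<zero>"
proof (rule ccontr)
  assume "\<not> ?thesis"
  then have nil: "\<exists>n. (r \<otimes> a) [^] (n :: nat) = \<zero>" if "r \<in> carrier R" for r using that by blast
  have nil': "\<exists>n. (a \<otimes> r) [^] (n :: nat) = \<zero>" if r: "r \<in> carrier R" for r
  proof -
    obtain n where "(r \<otimes> a) [^] (n :: nat) = \<zero>" using nil[OF r] by blast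
    then have "(a \<otimes> r) [^] Suc n = \<zero>" using pow_rotate[OF a(1) r, of n] a r by simp
    then show ?thesis by blast
  qed
  let ?\<A> = "{lann (a \<otimes> c) | c. c \<in> carrier R \<and> a \<otimes> c \<noteq> \<zero>}"
  have "\<exists>A \<in> ?\<A>. \<forall>B \<in> ?\<A>. A \<subseteq> B \<longrightarrow> B = A"
  proof (rule acc_maximal[OF acc])
    have "\<one> \<in> carrier R \<and> a \<otimes> \<one> \<noteq> \<zero>" using a by simp
    then show "?\<A> \<noteq> {}" by blast
    fix A assume "A \<in> ?\<A>"
    then obtain c where "c \<in> carrier R" "A = lann (a \<otimes> c)" by blast
    then show "\<exists>S \<subseteq> carrier R. A = left_annihilator R S" using a by (intro exI[of _ "{a \<otimes> c}"]) simp
  qed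
  then obtain A where A: "A \<in> ?\<A>" "\<forall>B \<in> ?\<A>. A \<subseteq> B \<longrightarrow> B = A" by (elim bexE)
  from A(1) obtain c where c: "A = lann (a \<otimes> c)" "c \<in> carrier R" "a \<otimes> c \<noteq> \<zero>" by (elim CollectE exE conjE)
  have max: "lann (a \<otimes> c') = lann (a \<otimes> c)"
    if "c' \<in> carrier R" "a \<otimes> c' \<noteq> \<zero>" "lann (a \<otimes> c) \<subseteq> lann (a \<otimes> c')" for c'
  proof -
    have "lann (a \<otimes> c') \<in> ?\<A>" using that(1,2) by blast
    from A(2)[rule_format, OF this] that(3) c(1) show ?thesis by simp
  qed
  note c = c(2,3)
  define b where "b = a \<otimes> c"
  have b: "b \<in> carrier R" "b \<noteq> \<zero>" using a c by (auto simp: b_def)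
  have "b \<otimes> y \<otimes> b = \<zero>" if y: "y \<in> carrier R" for y
  proof (cases "b \<otimes> y = \<zero>")
    case True
    then show ?thesis using b by simp
  next
    case False
    have "b \<otimes> y = a \<otimes> (c \<otimes> y)" using a c y by (simp add: b_def m_assoc)
    then have ex: "\<exists>n. (b \<otimes> y) [^] (n :: nat) = \<zero>" using nil'[of "c \<otimes> y"] c y by simp
    define k where "k = (LEAST n. (b \<otimes> y) [^] (n :: nat) = \<zero>)"
    have k: "(b \<otimes> y) [^] k = \<zero>" unfolding k_def by (rule LeastI_ex[OF ex])
    have min: "(b \<otimes> y) [^] n \<noteq> \<zero>" if "n < k" for n using not_less_Least that unfolding k_def by blast
    have by1: "(b \<otimes> y) [^] (1 :: nat) = b \<otimes> y" using b y by simp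
    have "k \<noteq> 0"
    proof
      assume "k = 0"
      then have "\<one> = \<zero>" using k by simp
      then have "carrier R = {\<zero>}" by (metis carrier_one_zero)
      then show False using a by auto
    qed
    moreover have "k \<noteq> 1" using k by1 False by metis
    ultimately obtain j where j: "k = Suc (Suc j)" by (metis One_nat_def not0_implies_Suc)
    \<comment> \<open>The last nonzero power of \<open>b \<otimes> y\<close>. By maximality it has
      the same left annihilator as \<open>b\<close>; since it is killed by
      \<open>b \<otimes> y\<close> from the left, so is \<open>b\<close>.\<close>
    define b' where "b' = (b \<otimes> y) [^] Suc j"
    have "b' = b \<otimes> (y \<otimes> (b \<otimes> y) [^] j)" unfolding b'_def
      using b y nat_pow_Suc2[of "b \<otimes> y" j] by (simp add: m_assoc)
    then have b': "b' = a \<otimes> (c \<otimes> (y \<otimes> (b \<otimes> y) [^] j))" "lann b \<subseteq> lann b'"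
      using a c y b lann_mult[of b "y \<otimes> (b \<otimes> y) [^] j"] by (auto simp: b_def m_assoc)
    have "b' \<noteq> \<zero>" unfolding b'_def using min[of "Suc j"] j by blast
    then have "lann b' = lann b" using max[of "c \<otimes> (y \<otimes> (b \<otimes> y) [^] j)"] b' a c y b by (simp add: b_def)
    moreover have "(b \<otimes> y) \<otimes> b' = \<zero>" unfolding b'_def
      using k j b y nat_pow_Suc2[of "b \<otimes> y" "Suc j"] by simp
    ultimately have "b \<otimes> y \<in> lann b" using b y by (auto simp: lann_iff)
    then show ?thesis by (simp add: lann_iff)
  qed
  then show False using prime_ring_elementwise[OF prime b(1) b(1)] b(2) by blast
qed

text \<open>Multiplying a relation \<open>\<Sum> r\<^sub>i f\<^sub>i = 0\<close> by \<open>f\<^sub>0\<close> leaves only the term \<open>r\<^sub>0 f\<^sub>0\<^sup>2\<close>.\<close>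

lemma triangular_direct:
  fixes n :: nat
  assumes f: "\<And>i. i < n \<Longrightarrow> f i \<in> carrier R" and r: "\<And>i. i < n \<Longrightarrow> r i \<in> carrier R"
    and orth: "\<And>i j. i < j \<Longrightarrow> j < n \<Longrightarrow> f j \<otimes> f i = \<zero>"
    and sq: "\<And>i m. i < n \<Longrightarrow> m \<in> carrier R \<Longrightarrow> m \<otimes> f i \<otimes> f i = \<zero> \<Longrightarrow> m \<otimes> f i = \<zero>"
    and sum: "finsum R (\<lambda>i. r i \<otimes> f i) {..<n} = \<zero>"
  shows "i < n \<Longrightarrow> r i \<otimes> f i = \<zero>"
proof (induction i rule: less_induct)
  case (less i)
  have "finsum R (\<lambda>j. r j \<otimes> f j) {..<n} \<otimes> f i = finsum R (\<lambda>j. r j \<otimes> f j \<otimes> f i) {..<n}"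
    using f r less.prems by (intro finsum_ldistr) auto
  also have "\<dots> = finsum R (\<lambda>j. if j = i then r i \<otimes> f i \<otimes> f i else \<zero>) {..<n}"
  proof (rule finsum_cong'[OF refl])
    fix j assume j: "j \<in> {..<n}"
    consider "j < i" | "j = i" | "i < j" by linarith
    then show "r j \<otimes> f j \<otimes> f i = (if j = i then r i \<otimes> f i \<otimes> f i else \<zero>)"
    proof cases
      case 1
      then show ?thesis using less.IH[of j] less.prems f j by simp
    next
      case 3
      then show ?thesis using orth[of i j] f[of j] f[of i] r[of j] j by (simp add: m_assoc)
    qed simp
  qed (use f r less.prems in auto)
  also have "\<dots> = r i \<otimes> f i \<otimes> f i" using less.prems f r by (intro finsum_delta) auto
  finally have "r i \<otimes> f i \<otimes> f i = \<zero>" using sum f less.prems by simp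
  then show ?case using sq[of i "r i"] less.prems r by blast
qed

lemma principal_left_ideal: "a \<in> carrier R \<Longrightarrow> left_ideal ((\<lambda>r. r \<otimes> a) ` carrier R) R"
  unfolding left_ideal_def
proof (intro conjI ballI)
  assume a: "a \<in> carrier R"
  show "additive_subgroup ((\<lambda>r. r \<otimes> a) ` carrier R) R"
  proof (rule additive_subgroup.intro, rule add.subgroupI)
    show "(\<lambda>r. r \<otimes> a) ` carrier R \<subseteq> carrier R" using a by auto
    show "(\<lambda>r. r \<otimes> a) ` carrier R \<noteq> {}" by auto
    fix y assume "y \<in> (\<lambda>r. r \<otimes> a) ` carrier R"
    then obtain r where r: "r \<in> carrier R" "y = r \<otimes> a" by blast
    then show "\<ominus> y \<in> (\<lambda>r. r \<otimes> a) ` carrier R" using a by (intro image_eqI[of _ _ "\<ominus> r"]) (auto simp: l_minus)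
    fix z assume "z \<in> (\<lambda>r. r \<otimes> a) ` carrier R"
    then obtain s where s: "s \<in> carrier R" "z = s \<otimes> a" by blast
    then show "y \<oplus> z \<in> (\<lambda>r. r \<otimes> a) ` carrier R" using a r by (intro image_eqI[of _ _ "r \<oplus> s"]) (auto simp: l_distr)
  qed
  fix s y assume s: "s \<in> carrier R" "y \<in> (\<lambda>r. r \<otimes> a) ` carrier R"
  then obtain r where r: "r \<in> carrier R" "y = r \<otimes> a" by blast
  then show "s \<otimes> y \<in> (\<lambda>r. r \<otimes> a) ` carrier R" using a s by (intro image_eqI[of _ _ "s \<otimes> r"]) (auto simp: m_assoc)
qed

text \<open>If every element of I had a nonzero left annihilator, there would be f 0, f 1, ... in I
  with f j f i = 0 for i < j, each having the same left annihilator as its square. By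
  \<open>triangular_direct\<close> the left ideals R f n would then form an infinite direct
  sum.\<close>

lemma prime_goldie_ideal_regular:
  assumes prime: "prime_ring R" and goldie: "left_goldie R" and I: "ideal I R" "I \<noteq> {\<zero>}"
  shows "\<exists>x \<in> I. \<forall>m \<in> carrier R. m \<otimes> x = \<zero> \<longrightarrow> m = \<zero>"
proof (rule ccontr)
  assume neg: "\<not> ?thesis"
  interpret I: ideal I R by (rule I(1))
  have acc: "acc_left_annihilators R" using goldie by (simp add: left_goldie_def)
  obtain v where v: "v \<in> I" "v \<noteq> \<zero>" using I(2) I.zero_closed by blast
  define good where "good A c \<longleftrightarrow> c \<in> I \<and> c \<noteq> \<zero> \<and> (\<forall>a \<in> A. c \<otimes> a = \<zero>) \<and>
    (\<forall>m \<in> carrier R. m \<otimes> c \<otimes> c = \<zero> \<longrightarrow> m \<otimes> c = \<zero>)" for A c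
  \<comment> \<open>Some multiple r y is not nilpotent, by \<open>prime_acc_not_nil\<close>. Among
    its powers one has a maximal left annihilator, and squaring that power cannot enlarge
    it.\<close>
  have extend: "\<exists>c. good A c" if A: "A \<subseteq> carrier R" and y: "y \<in> I" "y \<noteq> \<zero>" "\<And>a. a \<in> A \<Longrightarrow> y \<otimes> a = \<zero>" for A y
  proof -
    have yc: "y \<in> carrier R" using y by simp
    obtain r where r: "r \<in> carrier R" "\<And>n. (r \<otimes> y) [^] (n :: nat) \<noteq> \<zero>"
      using prime_acc_not_nil[OF prime acc yc y(2)] by blast
    \<comment> \<open>Exponents start at 1, so each power retains a right factor \<open>y\<close>;
      hence it lies in I and annihilates A.\<close>
    let ?c = "\<lambda>n :: nat. (r \<otimes> y) [^] Suc n"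
    have cc: "?c n \<in> carrier R" for n using r yc by simp
    have "\<exists>A \<in> range (\<lambda>n. lann (?c n)). \<forall>B \<in> range (\<lambda>n. lann (?c n)). A \<subseteq> B \<longrightarrow> B = A"
    proof (rule acc_maximal[OF acc])
      fix A assume "A \<in> range (\<lambda>n. lann (?c n))"
      then obtain n where "A = lann (?c n)" by blast
      then show "\<exists>S \<subseteq> carrier R. A = left_annihilator R S" using cc by (intro exI[of _ "{?c n}"]) simp
    qed simp
    then obtain L where L: "L \<in> range (\<lambda>n. lann (?c n))" "\<forall>B \<in> range (\<lambda>n. lann (?c n)). L \<subseteq> B \<longrightarrow> B = L"
      by (elim bexE)
    from L(1) obtain n where n: "L = lann (?c n)" by (elim rangeE)
    have max: "lann (?c m) = lann (?c n)" if "lann (?c n) \<subseteq> lann (?c m)" for m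
      using L(2)[rule_format, of "lann (?c m)"] that n by simp
    define c where "c = ?c n"
    have "c \<otimes> c = (r \<otimes> y) [^] (Suc n + Suc n)" unfolding c_def using r yc nat_pow_mult by blast
    then have "c \<otimes> c = ?c (n + Suc n)" by simp
    then have lc: "lann (c \<otimes> c) = lann c" using max[of "n + Suc n"] lann_mult[of c c] cc by (simp add: c_def)
    have "m \<otimes> c = \<zero>" if "m \<in> carrier R" "m \<otimes> c \<otimes> c = \<zero>" for m
    proof -
      have "m \<in> lann (c \<otimes> c)" using that cc[of n] by (simp add: lann_iff c_def m_assoc del: nat_pow_Suc)
      then show ?thesis unfolding lc by (simp add: lann_iff)
    qed
    moreover have "c \<in> I" unfolding c_def using r yc y(1) by (simp add: I.I_l_closed)
    moreover have "c \<noteq> \<zero>" unfolding c_def by (rule r(2))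
    moreover have "c \<otimes> a = \<zero>" if "a \<in> A" for a
    proof -
      have "a \<in> carrier R" using that A by auto
      then have "c \<otimes> a = (r \<otimes> y) [^] n \<otimes> r \<otimes> (y \<otimes> a)" unfolding c_def using r yc by (simp add: m_assoc)
      then show ?thesis using y(3)[OF that] r yc by simp
    qed
    ultimately show ?thesis unfolding good_def by blast
  qed
  have "\<exists>f. \<forall>n :: nat. good (f ` {..<n}) (f n)"
  proof (rule dependent_wellorder_choice[where P = "\<lambda>f (n :: nat) r. good (f ` {..<n}) r"])
    fix r :: 'a and f g :: "nat \<Rightarrow> 'a" and n assume "\<And>y. y < n \<Longrightarrow> f y = g y"
    then have "f ` {..<n} = g ` {..<n}" by (intro image_cong) auto
    then show "good (f ` {..<n}) r = good (g ` {..<n}) r" by simp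
  next
    fix n :: nat and f assume ih: "\<And>y. y < n \<Longrightarrow> good (f ` {..<y}) (f y)"
    have f: "f i \<in> I" "f i \<in> carrier R" if "i < n" for i using ih[OF that] by (auto simp: good_def)
    \<comment> \<open>An element annihilating the sum of the \<open>f i\<close> from the left
      annihilates each of them, by \<open>triangular_direct\<close>.\<close>
    define x where "x = finsum R f {..<n}"
    have x: "x \<in> I" unfolding x_def using f
      by (intro finsum_mem_additive_subgroup[OF I.additive_subgroup_axioms]) auto
    then obtain m where m: "m \<in> carrier R" "m \<otimes> x = \<zero>" "m \<noteq> \<zero>" using neg by blast
    have vc: "v \<in> carrier R" using v by simp
    \<comment> \<open>Primeness moves the annihilator \<open>m\<close> into I: the product
      \<open>v \<otimes> s \<otimes> m\<close> lies in I because \<open>v\<close> does, is nonzero,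
      and still kills \<open>x\<close>.\<close>
    obtain s where s: "s \<in> carrier R" "v \<otimes> s \<otimes> m \<noteq> \<zero>"
      using prime_ring_elementwise[OF prime vc m(1)] v(2) m(3) by blast
    define y where "y = v \<otimes> s \<otimes> m"
    have y: "y \<in> I" "y \<noteq> \<zero>" "y \<in> carrier R" using s v m by (auto simp: y_def I.I_r_closed)
    have yx: "y \<otimes> x = \<zero>" using s vc m x by (simp add: y_def m_assoc)
    have "finsum R (\<lambda>i. y \<otimes> f i) {..<n} = y \<otimes> x" unfolding x_def
      using f y by (intro finsum_rdistr[symmetric]) auto
    then have sum: "finsum R (\<lambda>i. y \<otimes> f i) {..<n} = \<zero>" using yx by simp
    have "y \<otimes> f i = \<zero>" if "i < n" for i
    proof (rule triangular_direct[where f = f and n = n and r = "\<lambda>_. y", OF _ _ _ _ sum that])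
      fix i j assume ij: "i < j" "j < n"
      then have "f i \<in> f ` {..<j}" by auto
      with ih[OF ij(2)] show "f j \<otimes> f i = \<zero>" unfolding good_def by blast
    next
      fix i m assume "i < n" "m \<in> carrier R" "m \<otimes> f i \<otimes> f i = \<zero>"
      with ih[of i] show "m \<otimes> f i = \<zero>" unfolding good_def by blast
    qed (use f y in auto)
    then show "\<exists>r. good (f ` {..<n}) r" using f y by (intro extend[of _ y]) auto
  qed
  then obtain f :: "nat \<Rightarrow> 'a" where g: "\<And>n. good (f ` {..<n}) (f n)" by blast
  have f: "f n \<in> carrier R" "f n \<noteq> \<zero>" for n using g[of n] by (auto simp: good_def)
  have orth: "f j \<otimes> f i = \<zero>" if "i < j" for i j
  proof -
    have "f i \<in> f ` {..<j}" using that by auto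
    with g[of j] show ?thesis unfolding good_def by blast
  qed
  have sq: "m \<otimes> f i = \<zero>" if "m \<in> carrier R" "m \<otimes> f i \<otimes> f i = \<zero>" for m i
    using g[of i] that unfolding good_def by blast
  let ?L = "\<lambda>n. (\<lambda>r. r \<otimes> f n) ` carrier R"
  have "direct_left_ideals R ?L"
    unfolding direct_left_ideals_def
  proof (intro conjI allI impI)
    show "left_ideal (?L n) R" for n using f by (intro principal_left_ideal)
    fix n :: nat and x i assume x: "\<forall>i < n. x i \<in> ?L i" and s: "finsum R x {..<n} = \<zero>" and i: "i < n"
    have "\<forall>i. \<exists>s. i < n \<longrightarrow> s \<in> carrier R \<and> x i = s \<otimes> f i" using x by blast
    then obtain r where r: "\<forall>i < n. r i \<in> carrier R \<and> x i = r i \<otimes> f i" by (elim choice[THEN exE]) blast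
    have "finsum R x {..<n} = finsum R (\<lambda>i. r i \<otimes> f i) {..<n}"
      using r f by (intro finsum_cong') auto
    then have sum: "finsum R (\<lambda>i. r i \<otimes> f i) {..<n} = \<zero>" using s by simp
    have "r i \<otimes> f i = \<zero>"
      by (rule triangular_direct[where f = f and n = n, OF f(1) _ orth sq sum i]) (use r in simp_all)
    then show "x i = \<zero>" using r i by simp
  qed
  moreover have "?L n \<noteq> {\<zero>}" for n
  proof -
    have "\<one> \<otimes> f n \<in> ?L n" by blast
    then show ?thesis using f[of n] by auto
  qed
  ultimately show False using goldie unfolding left_goldie_def by blast
qed

end

section \<open>The standard identity\<close>

context torsion_closed
begin

lemma common_denominator:
  assumes B: "finite B" "\<And>j. j \<in> B \<Longrightarrow> \<beta> j \<in> carrier R" and M: "finite M" "\<And>m. m \<in> M \<Longrightarrow> f m \<in> cl B \<beta>"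
  shows "\<exists>q \<in> E - {\<zero>}. \<forall>m \<in> M. \<exists>c t. (\<forall>j \<in> B. c j \<in> E) \<and> t \<in> T \<and>
    f m \<otimes> q = finsum R (\<lambda>j. \<beta> j \<otimes> c j) B \<oplus> t"
  using M
proof (induction M rule: finite_induct)
  case empty
  then show ?case using one_not_zero' by (intro bexI[of _ \<one>]) auto
next
  case (insert x F)
  have "\<exists>q \<in> E - {\<zero>}. \<forall>m \<in> F. \<exists>c t. (\<forall>j \<in> B. c j \<in> E) \<and> t \<in> T \<and>
    f m \<otimes> q = finsum R (\<lambda>j. \<beta> j \<otimes> c j) B \<oplus> t"
    by (rule insert.IH) (rule insert.prems, simp)
  then obtain q where q: "q \<in> E" "q \<noteq> \<zero>"
    and IH: "\<forall>m \<in> F. \<exists>c t. (\<forall>j \<in> B. c j \<in> E) \<and> t \<in> T \<and> f m \<otimes> q = finsum R (\<lambda>j. \<beta> j \<otimes> c j) B \<oplus> t"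
    by blast
  have "f x \<in> cl B \<beta>" by (rule insert.prems) simp
  then obtain e c t where x: "f x \<in> carrier R" "e \<in> E" "e \<noteq> \<zero>" "\<forall>j \<in> B. c j \<in> E" "t \<in> T"
    "f x \<otimes> e = finsum R (\<lambda>j. \<beta> j \<otimes> c j) B \<oplus> t" by (rule clE)
  have scale: "\<exists>c t. (\<forall>j \<in> B. c j \<in> E) \<and> t \<in> T \<and> m \<otimes> (u \<otimes> v) = finsum R (\<lambda>j. \<beta> j \<otimes> c j) B \<oplus> t"
    if m: "m \<in> carrier R" "u \<in> E" "v \<in> E" "\<forall>j \<in> B. c j \<in> E" "t \<in> T" "m \<otimes> u = finsum R (\<lambda>j. \<beta> j \<otimes> c j) B \<oplus> t"
    for m u v c t
  proof -
    have "m \<otimes> (u \<otimes> v) = (m \<otimes> u) \<otimes> v" using m(1-3) by (simp add: m_assoc)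
    also have "\<dots> = finsum R (\<lambda>j. \<beta> j \<otimes> (c j \<otimes> v)) B \<oplus> t \<otimes> v"
      unfolding m(6) using m(1-5) B by (simp add: l_distr sum_carrier mult_right_sum)
    finally show ?thesis using m(2-5)
      by (intro exI[of _ "\<lambda>j. c j \<otimes> v"] exI[of _ "t \<otimes> v"]) (auto intro: T_mult)
  qed
  show ?case
  proof (intro bexI[of _ "q \<otimes> e"] ballI)
    show "q \<otimes> e \<in> E - {\<zero>}" using q x E_integral[of q e] by auto
    fix m assume m: "m \<in> insert x F"
    show "\<exists>c t. (\<forall>j \<in> B. c j \<in> E) \<and> t \<in> T \<and> f m \<otimes> (q \<otimes> e) = finsum R (\<lambda>j. \<beta> j \<otimes> c j) B \<oplus> t"
    proof (cases "m = x")
      case True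
      have "q \<otimes> e = e \<otimes> q" using E_comm q x by blast
      then show ?thesis using scale[OF x(1,2) q(1) x(4-6)] True by simp
    next
      case False
      then have "m \<in> F" using m by simp
      then obtain c t where "\<forall>j \<in> B. c j \<in> E" "t \<in> T" "f m \<otimes> q = finsum R (\<lambda>j. \<beta> j \<otimes> c j) B \<oplus> t"
        using IH by blast
      moreover have "f m \<in> carrier R" using insert.prems[of m] \<open>m \<in> F\<close> cl_carrier[of B \<beta>] by blast
      ultimately show ?thesis using scale q(1) x(2) by blast
    qed
  qed
qed

text \<open>Left multiplications act on R/T by square matrices of size card B over the fraction
  field of E, and more than (card B)^2 of these are dependent. As the coefficients stand to the
  right of \<open>m\<close>, this is a relation between operators and not between the
  \<open>a i\<close> in R.\<close>

lemma operators_dependent: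
  assumes left: "\<And>a t. a \<in> carrier R \<Longrightarrow> t \<in> T \<Longrightarrow> a \<otimes> t \<in> T"
    and B: "finite B" "B \<subseteq> carrier R" "cl B id = carrier R"
    and J: "finite J" "card B * card B < card J" and a: "\<And>i. i \<in> J \<Longrightarrow> a i \<in> carrier R"
  shows "\<exists>e. (\<forall>i \<in> J. e i \<in> E) \<and> (\<exists>i \<in> J. e i \<noteq> \<zero>) \<and>
    (\<forall>m \<in> carrier R. finsum R (\<lambda>i. a i \<otimes> m \<otimes> e i) J \<in> T)"
proof -
  have id: "id j \<in> carrier R" if "j \<in> B" for j using that B by auto
  have "\<forall>i \<in> J. \<exists>q. q \<in> E - {\<zero>} \<and> (\<forall>j \<in> B. \<exists>c t. (\<forall>l \<in> B. c l \<in> E) \<and> t \<in> T \<and>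
      (a i \<otimes> j) \<otimes> q = finsum R (\<lambda>l. id l \<otimes> c l) B \<oplus> t)"
  proof
    fix i assume i: "i \<in> J"
    have "\<exists>q \<in> E - {\<zero>}. \<forall>j \<in> B. \<exists>c t. (\<forall>l \<in> B. c l \<in> E) \<and> t \<in> T \<and>
      (a i \<otimes> j) \<otimes> q = finsum R (\<lambda>l. id l \<otimes> c l) B \<oplus> t"
    proof (rule common_denominator[OF B(1) id B(1)])
      fix j assume "j \<in> B"
      then show "a i \<otimes> j \<in> cl B id" using a[OF i] B(2,3) by auto
    qed
    then show "\<exists>q. q \<in> E - {\<zero>} \<and> (\<forall>j \<in> B. \<exists>c t. (\<forall>l \<in> B. c l \<in> E) \<and> t \<in> T \<and>
      (a i \<otimes> j) \<otimes> q = finsum R (\<lambda>l. id l \<otimes> c l) B \<oplus> t)" by (simp only: Bex_def)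
  qed
  then have "\<exists>q. \<forall>i \<in> J. q i \<in> E - {\<zero>} \<and> (\<forall>j \<in> B. \<exists>c t. (\<forall>l \<in> B. c l \<in> E) \<and> t \<in> T \<and>
      (a i \<otimes> j) \<otimes> q i = finsum R (\<lambda>l. id l \<otimes> c l) B \<oplus> t)" by (rule bchoice)
  then obtain q where q: "\<forall>i \<in> J. q i \<in> E - {\<zero>}" and ex: "\<forall>i \<in> J. \<forall>j \<in> B. \<exists>c t. (\<forall>l \<in> B. c l \<in> E) \<and> t \<in> T \<and>
      (a i \<otimes> j) \<otimes> q i = finsum R (\<lambda>l. id l \<otimes> c l) B \<oplus> t" by blast
  from ex have "\<exists>c t. \<forall>i \<in> J. \<forall>j \<in> B. (\<forall>l \<in> B. c i j l \<in> E) \<and> t i j \<in> T \<and>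
      (a i \<otimes> j) \<otimes> q i = finsum R (\<lambda>l. id l \<otimes> c i j l) B \<oplus> t i j" unfolding bchoice_iff .
  then obtain c t where ct: "\<forall>i \<in> J. \<forall>j \<in> B. (\<forall>l \<in> B. c i j l \<in> E) \<and> t i j \<in> T \<and>
      (a i \<otimes> j) \<otimes> q i = finsum R (\<lambda>l. id l \<otimes> c i j l) B \<oplus> t i j" by (elim exE)
  have c: "c i j l \<in> E" if "i \<in> J" "j \<in> B" "l \<in> B" for i j l using ct that by blast
  have t: "t i j \<in> T" if "i \<in> J" "j \<in> B" for i j using ct that by blast
  have eq: "(a i \<otimes> j) \<otimes> q i = finsum R (\<lambda>l. l \<otimes> c i j l) B \<oplus> t i j" if "i \<in> J" "j \<in> B" for i j
    using ct that by simp
  have qE: "q i \<in> E" "q i \<noteq> \<zero>" if "i \<in> J" for i using q that by auto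
  \<comment> \<open>One equation for each matrix entry.\<close>
  have "card (B \<times> B) < card J" using J by (simp add: card_cartesian_product)
  then have "\<exists>e. (\<forall>i \<in> J. e i \<in> E) \<and> (\<exists>i \<in> J. e i \<noteq> \<zero>) \<and>
      (\<forall>p \<in> B \<times> B. finsum R (\<lambda>i. c i (fst p) (snd p) \<otimes> e i) J = \<zero>)"
    by (intro homogeneous_system) (use B J c in auto)
  then obtain e where e: "\<forall>i \<in> J. e i \<in> E" "\<exists>i \<in> J. e i \<noteq> \<zero>"
    "\<forall>p \<in> B \<times> B. finsum R (\<lambda>i. c i (fst p) (snd p) \<otimes> e i) J = \<zero>" by (elim exE conjE)
  have e0: "finsum R (\<lambda>i. c i j l \<otimes> e i) J = \<zero>" if "j \<in> B" "l \<in> B" for j l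
    using e(3)[rule_format, of "(j, l)"] that by simp
  have eE: "e i \<in> E" if "i \<in> J" for i using e(1) that by blast
  have Bc: "j \<in> carrier R" if "j \<in> B" for j using that B by auto
  \<comment> \<open>The system was solved for the matrix of each \<open>a i\<close> multiplied by
    its denominator \<open>q i\<close>, so the operator \<open>a i\<close> itself gets the
    coefficient \<open>q i \<otimes> e i\<close>.\<close>
  define L where "L m = finsum R (\<lambda>i. a i \<otimes> m \<otimes> (q i \<otimes> e i)) J" for m
  have LB: "L j \<in> T" if j: "j \<in> B" for j
  proof -
    have "L j = finsum R (\<lambda>i. finsum R (\<lambda>l. l \<otimes> (c i j l \<otimes> e i)) B \<oplus> t i j \<otimes> e i) J"
      unfolding L_def
    proof (rule finsum_cong'[OF refl])
      fix i assume i: "i \<in> J"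
      have "a i \<otimes> j \<otimes> (q i \<otimes> e i) = (a i \<otimes> j \<otimes> q i) \<otimes> e i"
        using a[OF i] Bc[OF j] qE[OF i] eE[OF i] by (simp add: m_assoc)
      also have "\<dots> = finsum R (\<lambda>l. l \<otimes> (c i j l \<otimes> e i)) B \<oplus> t i j \<otimes> e i"
        unfolding eq[OF i j] using c[OF i j] t[OF i j] eE[OF i] Bc B(1)
        by (simp add: l_distr sum_carrier mult_right_sum)
      finally show "a i \<otimes> j \<otimes> (q i \<otimes> e i) = finsum R (\<lambda>l. l \<otimes> (c i j l \<otimes> e i)) B \<oplus> t i j \<otimes> e i" .
    qed (use c t eE Bc j in \<open>auto intro!: sum_carrier a_closed\<close>)
    also have "\<dots> = finsum R (\<lambda>i. finsum R (\<lambda>l. l \<otimes> (c i j l \<otimes> e i)) B) J \<oplus> finsum R (\<lambda>i. t i j \<otimes> e i) J"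
      using c t eE Bc j by (intro finsum_addf) (auto intro!: sum_carrier)
    also have "finsum R (\<lambda>i. finsum R (\<lambda>l. l \<otimes> (c i j l \<otimes> e i)) B) J
        = finsum R (\<lambda>l. finsum R (\<lambda>i. l \<otimes> (c i j l \<otimes> e i)) J) B"
      using B(1) J(1) c eE Bc j by (intro finsum_swap) auto
    also have "\<dots> = finsum R (\<lambda>l. \<zero>) B"
    proof (rule finsum_cong'[OF refl])
      fix l assume l: "l \<in> B"
      have "finsum R (\<lambda>i. l \<otimes> (c i j l \<otimes> e i)) J = l \<otimes> finsum R (\<lambda>i. c i j l \<otimes> e i) J"
        using l j J(1) c eE Bc by (intro finsum_rdistr[symmetric]) auto
      then show "finsum R (\<lambda>i. l \<otimes> (c i j l \<otimes> e i)) J = \<zero>" using e0[OF j l] Bc[OF l] by simp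
    qed auto
    also have "finsum R (\<lambda>l. \<zero>) B \<oplus> finsum R (\<lambda>i. t i j \<otimes> e i) J \<in> T"
      using t[OF _ j] eE by (auto intro!: finsum_mem_additive_subgroup[OF T_subgroup] T_mult)
    finally show ?thesis .
  qed
  have Lc: "L m \<in> carrier R" if "m \<in> carrier R" for m
    unfolding L_def using that a qE eE by (intro finsum_closed) auto
  have Ladd: "L (m \<oplus> n) = L m \<oplus> L n" if "m \<in> carrier R" "n \<in> carrier R" for m n
  proof -
    have "L (m \<oplus> n) = finsum R (\<lambda>i. a i \<otimes> m \<otimes> (q i \<otimes> e i) \<oplus> a i \<otimes> n \<otimes> (q i \<otimes> e i)) J"
      unfolding L_def using that a qE eE by (intro finsum_cong') (auto simp: r_distr l_distr)
    also have "\<dots> = L m \<oplus> L n" unfolding L_def using that a qE eE by (intro finsum_addf) auto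
    finally show ?thesis .
  qed
  have Lmult: "L (m \<otimes> f) = L m \<otimes> f" if "m \<in> carrier R" "f \<in> E" for m f
  proof -
    have "L m \<otimes> f = finsum R (\<lambda>i. a i \<otimes> m \<otimes> (q i \<otimes> e i) \<otimes> f) J"
      unfolding L_def using that a qE eE J(1) by (intro finsum_ldistr) auto
    also have "\<dots> = L (m \<otimes> f)"
      unfolding L_def
    proof (rule finsum_cong'[OF refl])
      fix i assume i: "i \<in> J"
      have "(q i \<otimes> e i) \<otimes> f = f \<otimes> (q i \<otimes> e i)" using E_comm qE[OF i] eE[OF i] that by auto
      then show "a i \<otimes> m \<otimes> (q i \<otimes> e i) \<otimes> f = a i \<otimes> (m \<otimes> f) \<otimes> (q i \<otimes> e i)"
        using that a[OF i] qE[OF i] eE[OF i] by (simp add: m_assoc)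
    qed (use that a qE eE in auto)
    finally show ?thesis ..
  qed
  have all: "L m \<in> T" if "m \<in> carrier R" for m
  proof (rule cl_map[where f = L and J = B and b = id, OF T_subgroup T_mult T_torsion_free Lc Ladd Lmult])
    fix s assume s: "s \<in> T"
    show "L s \<in> T" unfolding L_def
    proof (rule finsum_mem_additive_subgroup[OF T_subgroup])
      fix i assume i: "i \<in> J"
      show "a i \<otimes> s \<otimes> (q i \<otimes> e i) \<in> T"
        using T_mult[OF left[OF a[OF i] s]] qE[OF i] eE[OF i] by simp
    qed
  qed (use LB Bc B(3) that in simp_all)
  obtain i where i: "i \<in> J" "e i \<noteq> \<zero>" using e(2) by blast
  then have nz: "q i \<otimes> e i \<noteq> \<zero>" using E_integral[of "q i" "e i"] qE[OF i(1)] eE[OF i(1)] by blast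
  show ?thesis
  proof (intro exI[of _ "\<lambda>i. q i \<otimes> e i"] conjI ballI)
    show "\<exists>i \<in> J. q i \<otimes> e i \<noteq> \<zero>" using i nz by blast
  qed (use qE eE all in \<open>auto simp: L_def\<close>)
qed

end

context ring
begin

definition standard_poly :: "nat \<Rightarrow> (nat \<Rightarrow> 'a) \<Rightarrow> 'a"
  where "standard_poly N a = finsum R (\<lambda>\<sigma>. if evenperm \<sigma> then word_prod (a \<circ> \<sigma>) [0..<N]
    else \<ominus> word_prod (a \<circ> \<sigma>) [0..<N]) {\<sigma>. \<sigma> permutes {..<N}}"

lemma word_prod_cong: "(\<And>i. i \<in> set w \<Longrightarrow> x i = y i) \<Longrightarrow> word_prod x w = word_prod y w"
  by (induction w) auto

text \<open>Composing with the transposition of i and j changes the sign of a permutation but not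
  its monomial, so the sums over even and odd permutations agree and cancel. No division by 2
  occurs.\<close>

lemma standard_poly_alternating:
  assumes a: "\<And>i. i < N \<Longrightarrow> a i \<in> carrier R" and ij: "i < N" "j < N" "i \<noteq> j" "a i = a j"
  shows "standard_poly N a = \<zero>"
proof -
  let ?P = "{\<sigma>. \<sigma> permutes {..<N}}"
  define Pe where "Pe = {\<sigma> \<in> ?P. evenperm \<sigma>}"
  define Po where "Po = {\<sigma> \<in> ?P. \<not> evenperm \<sigma>}"
  define \<tau> where "\<tau> = transpose i j"
  define w where "w \<sigma> = word_prod (a \<circ> \<sigma>) [0..<N]" for \<sigma>
  have fin: "finite ?P" by (rule finite_permutations) simp
  have \<tau>: "\<tau> permutes {..<N}" unfolding \<tau>_def using ij by (intro permutes_swap_id) auto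
  have \<tau>\<tau>: "\<tau> \<circ> \<tau> = id" by (simp add: \<tau>_def)
  have odd: "\<not> evenperm \<tau>" using ij by (simp add: \<tau>_def evenperm_swap)
  have ev: "evenperm (\<tau> \<circ> \<sigma>) \<longleftrightarrow> \<not> evenperm \<sigma>" if "\<sigma> \<in> ?P" for \<sigma>
    using evenperm_comp[of \<tau> \<sigma>] odd \<tau> that permutation_permutes finite_lessThan by blast
  have wc: "w \<sigma> \<in> carrier R" if "\<sigma> \<in> ?P" for \<sigma>
    unfolding w_def
  proof (rule word_prod_closed)
    fix l assume "l \<in> set [0..<N]"
    then have "\<sigma> l < N" using that permutes_in_image[of \<sigma> "{..<N}" l] by auto
    then show "(a \<circ> \<sigma>) l \<in> carrier R" using a by simp
  qed
  have w\<tau>: "w (\<tau> \<circ> \<sigma>) = w \<sigma>" for \<sigma>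
  proof -
    have "a \<circ> (\<tau> \<circ> \<sigma>) = a \<circ> \<sigma>" using ij by (auto simp: fun_eq_iff \<tau>_def transpose_def)
    then show ?thesis by (simp add: w_def)
  qed
  have Po: "Po = (\<lambda>\<sigma>. \<tau> \<circ> \<sigma>) ` Pe"
  proof (intro equalityI subsetI)
    fix \<sigma> assume s: "\<sigma> \<in> Po"
    then have "\<tau> \<circ> \<sigma> \<in> Pe" using \<tau> ev by (auto simp: Po_def Pe_def intro: permutes_compose)
    moreover have "\<sigma> = \<tau> \<circ> (\<tau> \<circ> \<sigma>)" by (simp add: comp_assoc[symmetric] \<tau>\<tau>)
    ultimately show "\<sigma> \<in> (\<lambda>\<sigma>. \<tau> \<circ> \<sigma>) ` Pe" by blast
  qed (use \<tau> ev in \<open>auto simp: Po_def Pe_def intro: permutes_compose\<close>)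
  have inj: "inj_on (\<lambda>\<sigma>. \<tau> \<circ> \<sigma>) Pe"
  proof (rule inj_onI)
    fix \<sigma> \<rho> assume "\<tau> \<circ> \<sigma> = \<tau> \<circ> \<rho>"
    then have "\<tau> \<circ> (\<tau> \<circ> \<sigma>) = \<tau> \<circ> (\<tau> \<circ> \<rho>)" by simp
    then show "\<sigma> = \<rho>" by (simp add: comp_assoc[symmetric] \<tau>\<tau>)
  qed
  have un: "?P = Pe \<union> Po" "Pe \<inter> Po = {}" "finite Pe" "finite Po" using fin by (auto simp: Pe_def Po_def)
  have sub: "Pe \<subseteq> ?P" "Po \<subseteq> ?P" by (auto simp: Pe_def Po_def)
  have "standard_poly N a = finsum R (\<lambda>\<sigma>. if evenperm \<sigma> then w \<sigma> else \<ominus> w \<sigma>) (Pe \<union> Po)"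
    unfolding standard_poly_def w_def un(1) ..
  also have "\<dots> = finsum R (\<lambda>\<sigma>. if evenperm \<sigma> then w \<sigma> else \<ominus> w \<sigma>) Pe
      \<oplus> finsum R (\<lambda>\<sigma>. if evenperm \<sigma> then w \<sigma> else \<ominus> w \<sigma>) Po"
    using un sub wc by (intro finsum_Un_disjoint) auto
  also have "finsum R (\<lambda>\<sigma>. if evenperm \<sigma> then w \<sigma> else \<ominus> w \<sigma>) Pe = finsum R w Pe"
    using sub wc by (intro finsum_cong') (auto simp: Pe_def)
  also have "finsum R (\<lambda>\<sigma>. if evenperm \<sigma> then w \<sigma> else \<ominus> w \<sigma>) Po = finsum R (\<lambda>\<sigma>. \<ominus> w \<sigma>) Po"
    using sub wc by (intro finsum_cong') (auto simp: Po_def)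
  also have "\<dots> = \<ominus> finsum R w Po" using sub wc by (intro finsum_a_inv) auto
  also have "finsum R w Po = finsum R (\<lambda>\<sigma>. w (\<tau> \<circ> \<sigma>)) Pe"
    unfolding Po using inj Po sub wc by (intro finsum_reindex) auto
  also have "\<dots> = finsum R w Pe" by (simp add: w\<tau>)
  also have "finsum R w Pe \<oplus> \<ominus> finsum R w Pe = \<zero>"
    using sub wc by (intro r_neg finsum_closed) auto
  finally show ?thesis .
qed

lemma word_prod_linear_in_variable:
  assumes "distinct w" "i \<in> set w" "\<And>j. j \<in> set w \<Longrightarrow> j \<noteq> i \<Longrightarrow> x j \<in> carrier R"
  shows "\<exists>A \<in> carrier R. \<exists>B \<in> carrier R. \<forall>y \<in> carrier R. word_prod (x(i := y)) w = A \<otimes> y \<otimes> B"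
proof -
  obtain u v where w: "w = u @ i # v" using split_list assms(2) by metis
  have nin: "i \<notin> set u" "i \<notin> set v" using assms(1) w by auto
  have AB: "word_prod x u \<in> carrier R" "word_prod x v \<in> carrier R"
    using nin assms(3) w by (auto intro!: word_prod_closed)
  have "word_prod (x(i := y)) w = word_prod x u \<otimes> y \<otimes> word_prod x v" if y: "y \<in> carrier R" for y
  proof -
    have u: "word_prod (x(i := y)) u = word_prod x u" using nin by (intro word_prod_cong) auto
    have v: "word_prod (x(i := y)) v = word_prod x v" using nin by (intro word_prod_cong) auto
    have "word_prod (x(i := y)) w = word_prod (x(i := y)) u \<otimes> word_prod (x(i := y)) (i # v)"
      unfolding w using assms(3) y w by (intro word_prod_append) auto
    also have "\<dots> = word_prod x u \<otimes> (y \<otimes> word_prod x v)" by (simp add: u v del: fun_upd_apply) simp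
    finally show ?thesis using AB y by (simp add: m_assoc)
  qed
  with AB show ?thesis by blast
qed

end

context torsion_closed
begin

text \<open>Start from a relation: the sum of a i m e i lies in T for all m, with e i0 nonzero.
  Replace a i0 by a i in the standard polynomial, multiply by m e i on the right and sum over i.
  Each monomial has the form A a i B, so the sum lies in T by the relation at B m. The terms with i
  different from i0 vanish because an argument is repeated; in the remaining one, e i0 cancels
  modulo T.\<close>

lemma standard_poly_vanishes:
  assumes left: "\<And>a t. a \<in> carrier R \<Longrightarrow> t \<in> T \<Longrightarrow> a \<otimes> t \<in> T"
    and faithful: "\<And>a. a \<in> carrier R \<Longrightarrow> (\<And>m. m \<in> carrier R \<Longrightarrow> a \<otimes> m \<in> T) \<Longrightarrow> a = \<zero>"
    and B: "finite B" "B \<subseteq> carrier R" "cl B id = carrier R"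
    and N: "card B * card B < N" and a: "\<And>i. i < N \<Longrightarrow> a i \<in> carrier R"
  shows "standard_poly N a = \<zero>"
proof -
  let ?P = "{\<sigma>. \<sigma> permutes {..<N}}"
  have finP: "finite ?P" by (rule finite_permutations) simp
  have "\<exists>e. (\<forall>i \<in> {..<N}. e i \<in> E) \<and> (\<exists>i \<in> {..<N}. e i \<noteq> \<zero>) \<and>
    (\<forall>m \<in> carrier R. finsum R (\<lambda>i. a i \<otimes> m \<otimes> e i) {..<N} \<in> T)"
    by (rule operators_dependent[OF left B]) (use N a in auto)
  then obtain e where e: "\<forall>i \<in> {..<N}. e i \<in> E" "\<exists>i \<in> {..<N}. e i \<noteq> \<zero>"
    "\<forall>m \<in> carrier R. finsum R (\<lambda>i. a i \<otimes> m \<otimes> e i) {..<N} \<in> T" by (elim exE conjE)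
  obtain i0 where i0: "i0 < N" "e i0 \<noteq> \<zero>" using e(2) by blast
  have eE: "e i \<in> E" if "i < N" for i using e(1) that by blast
  define sg where "sg \<sigma> y = (if evenperm \<sigma> then y else \<ominus> y)" for \<sigma> :: "nat \<Rightarrow> nat" and y
  have sg_closed: "sg \<sigma> y \<in> carrier R" if "y \<in> carrier R" for \<sigma> y using that by (simp add: sg_def)
  have sg_T: "sg \<sigma> y \<in> T" if "y \<in> T" for \<sigma> y using that T.a_inv_closed by (simp add: sg_def)
  define W where "W \<sigma> i = word_prod (a(i0 := a i) \<circ> \<sigma>) [0..<N]" for \<sigma> i
  have lin: "\<exists>A \<in> carrier R. \<exists>B \<in> carrier R. \<forall>i < N. W \<sigma> i = A \<otimes> a i \<otimes> B" if s: "\<sigma> \<in> ?P" for \<sigma>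
  proof -
    have perm: "\<sigma> permutes {..<N}" using s by simp
    obtain l where l0: "\<sigma> l = i0" using permutes_surj[OF perm] by (metis surjD)
    then have l: "\<sigma> l = i0" "l < N" using permutes_in_image[OF perm, of l] i0 by auto
    have upd: "a(i0 := y) \<circ> \<sigma> = (a \<circ> \<sigma>)(l := y)" for y
      using l permutes_inj[OF perm] by (auto simp: fun_eq_iff dest: injD)
    have "\<exists>A \<in> carrier R. \<exists>B \<in> carrier R. \<forall>y \<in> carrier R. word_prod ((a \<circ> \<sigma>)(l := y)) [0..<N] = A \<otimes> y \<otimes> B"
    proof (rule word_prod_linear_in_variable)
      fix j assume "j \<in> set [0..<N]"
      then have "\<sigma> j < N" using permutes_in_image[OF perm, of j] by auto
      then show "(a \<circ> \<sigma>) j \<in> carrier R" using a by simp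
    qed (use l in auto)
    then obtain A B where AB: "A \<in> carrier R" "B \<in> carrier R"
      "\<forall>y \<in> carrier R. word_prod ((a \<circ> \<sigma>)(l := y)) [0..<N] = A \<otimes> y \<otimes> B" by blast
    have "W \<sigma> i = A \<otimes> a i \<otimes> B" if "i < N" for i
      unfolding W_def upd using AB(3) a[OF that] by blast
    with AB(1,2) show ?thesis by blast
  qed
  have Wc: "W \<sigma> i \<in> carrier R" if s: "\<sigma> \<in> ?P" and i: "i < N" for \<sigma> i
  proof -
    obtain A B where "A \<in> carrier R" "B \<in> carrier R" "\<forall>i < N. W \<sigma> i = A \<otimes> a i \<otimes> B" using lin[OF s] by blast
    then show ?thesis using a[OF i] i by simp
  qed
  have std: "standard_poly N (a(i0 := a i)) = finsum R (\<lambda>\<sigma>. sg \<sigma> (W \<sigma> i)) ?P" for i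
    by (simp add: standard_poly_def W_def sg_def)
  have stdc: "standard_poly N (a(i0 := a i)) \<in> carrier R" if "i < N" for i
    unfolding std using that Wc sg_closed by (intro finsum_closed) auto
  have "standard_poly N a \<otimes> m \<in> T" if m: "m \<in> carrier R" for m
  proof -
    have 1: "finsum R (\<lambda>i. W \<sigma> i \<otimes> m \<otimes> e i) {..<N} \<in> T" if s: "\<sigma> \<in> ?P" for \<sigma>
    proof -
      obtain A B where AB: "A \<in> carrier R" "B \<in> carrier R" "\<forall>i < N. W \<sigma> i = A \<otimes> a i \<otimes> B" using lin[OF s] by blast
      have "A \<otimes> finsum R (\<lambda>i. a i \<otimes> (B \<otimes> m) \<otimes> e i) {..<N} = finsum R (\<lambda>i. A \<otimes> (a i \<otimes> (B \<otimes> m) \<otimes> e i)) {..<N}"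
        using AB(1,2) a eE m by (intro finsum_rdistr) auto
      also have "\<dots> = finsum R (\<lambda>i. W \<sigma> i \<otimes> m \<otimes> e i) {..<N}"
        using AB a eE m by (intro finsum_cong') (auto simp: m_assoc)
      finally have "finsum R (\<lambda>i. W \<sigma> i \<otimes> m \<otimes> e i) {..<N} = A \<otimes> finsum R (\<lambda>i. a i \<otimes> (B \<otimes> m) \<otimes> e i) {..<N}" ..
      moreover have "finsum R (\<lambda>i. a i \<otimes> (B \<otimes> m) \<otimes> e i) {..<N} \<in> T" using e(3) AB(2) m by blast
      ultimately show ?thesis using left AB(1) by simp
    qed
    have sgW: "sg \<sigma> (W \<sigma> i) \<otimes> m \<otimes> e i = sg \<sigma> (W \<sigma> i \<otimes> m \<otimes> e i)" if "\<sigma> \<in> ?P" "i < N" for \<sigma> i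
      using Wc[OF that] m eE[OF that(2)] by (simp add: sg_def l_minus)
    have "finsum R (\<lambda>i. standard_poly N (a(i0 := a i)) \<otimes> m \<otimes> e i) {..<N}
        = finsum R (\<lambda>i. finsum R (\<lambda>\<sigma>. sg \<sigma> (W \<sigma> i \<otimes> m \<otimes> e i)) ?P) {..<N}"
    proof (rule finsum_cong'[OF refl])
      fix i assume "i \<in> {..<N}"
      then have i: "i < N" by simp
      have "standard_poly N (a(i0 := a i)) \<otimes> m \<otimes> e i = finsum R (\<lambda>\<sigma>. sg \<sigma> (W \<sigma> i)) ?P \<otimes> (m \<otimes> e i)"
        using stdc[OF i] m eE[OF i] by (simp add: m_assoc std)
      also have "\<dots> = finsum R (\<lambda>\<sigma>. sg \<sigma> (W \<sigma> i) \<otimes> (m \<otimes> e i)) ?P"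
        using finP Wc i m eE[OF i] sg_closed by (intro finsum_ldistr) auto
      also have "\<dots> = finsum R (\<lambda>\<sigma>. sg \<sigma> (W \<sigma> i \<otimes> m \<otimes> e i)) ?P"
      proof (rule finsum_cong'[OF refl])
        fix \<sigma> assume s: "\<sigma> \<in> ?P"
        then show "sg \<sigma> (W \<sigma> i) \<otimes> (m \<otimes> e i) = sg \<sigma> (W \<sigma> i \<otimes> m \<otimes> e i)"
          using sgW[OF s i] sg_closed[OF Wc[OF s i]] m eE[OF i] by (simp add: m_assoc)
      qed (use Wc i m eE sg_closed in auto)
      finally show "standard_poly N (a(i0 := a i)) \<otimes> m \<otimes> e i = finsum R (\<lambda>\<sigma>. sg \<sigma> (W \<sigma> i \<otimes> m \<otimes> e i)) ?P" .
    qed (use Wc m eE sg_closed in \<open>auto intro!: finsum_closed\<close>)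
    also have "\<dots> = finsum R (\<lambda>\<sigma>. finsum R (\<lambda>i. sg \<sigma> (W \<sigma> i \<otimes> m \<otimes> e i)) {..<N}) ?P"
      using finP Wc m eE sg_closed by (intro finsum_swap) auto
    also have "\<dots> = finsum R (\<lambda>\<sigma>. sg \<sigma> (finsum R (\<lambda>i. W \<sigma> i \<otimes> m \<otimes> e i) {..<N})) ?P"
    proof (rule finsum_cong'[OF refl])
      fix \<sigma> assume s: "\<sigma> \<in> ?P"
      have "(\<lambda>i. W \<sigma> i \<otimes> m \<otimes> e i) \<in> {..<N} \<rightarrow> carrier R" using Wc[OF s] m eE by auto
      from finsum_a_inv[OF this]
      show "finsum R (\<lambda>i. sg \<sigma> (W \<sigma> i \<otimes> m \<otimes> e i)) {..<N} = sg \<sigma> (finsum R (\<lambda>i. W \<sigma> i \<otimes> m \<otimes> e i) {..<N})"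
        by (simp add: sg_def)
    qed (use Wc m eE in \<open>auto intro!: sg_closed finsum_closed\<close>)
    also have "\<dots> \<in> T"
      by (rule finsum_mem_additive_subgroup[OF T_subgroup]) (intro sg_T 1)
    finally have inT: "finsum R (\<lambda>i. standard_poly N (a(i0 := a i)) \<otimes> m \<otimes> e i) {..<N} \<in> T" .
    have "finsum R (\<lambda>i. standard_poly N (a(i0 := a i)) \<otimes> m \<otimes> e i) {..<N}
        = finsum R (\<lambda>i. if i = i0 then standard_poly N a \<otimes> m \<otimes> e i0 else \<zero>) {..<N}"
    proof (rule finsum_cong'[OF refl])
      fix i assume "i \<in> {..<N}"
      then have i: "i < N" by simp
      show "standard_poly N (a(i0 := a i)) \<otimes> m \<otimes> e i = (if i = i0 then standard_poly N a \<otimes> m \<otimes> e i0 else \<zero>)"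
      proof (cases "i = i0")
        case False
        have "standard_poly N (a(i0 := a i)) = \<zero>"
          using False i i0(1) a by (intro standard_poly_alternating[of N _ i0 i]) auto
        then show ?thesis using False m eE[OF i] by simp
      qed simp
    qed (use stdc[OF i0(1)] m eE i0 in auto)
    also have "\<dots> = standard_poly N a \<otimes> m \<otimes> e i0"
      using stdc[OF i0(1)] m eE[OF i0(1)] i0 by (intro finsum_delta) auto
    finally have *: "standard_poly N a \<otimes> m \<otimes> e i0 \<in> T" using inT by simp
    have "standard_poly N a \<otimes> m \<in> carrier R" using stdc[OF i0(1)] m by simp
    from T_torsion_free[OF this eE[OF i0(1)] i0(2) *] show ?thesis .
  qed
  moreover have "standard_poly N a \<in> carrier R" using stdc[OF i0(1)] by simp
  ultimately show ?thesis by (rule faithful[rotated])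
qed

end

context field_algebra
begin

lemma eval_word_map: "eval_word x (map s w) = word_prod (x \<circ> s) w"
  by (induction w) (auto simp: eval_word_def)

text \<open>The standard polynomial has coefficients 1 and -1 on words that determine their
  permutations, so it is nonzero in the free algebra in every characteristic.\<close>

lemma PI_algebraI:
  assumes nz: "carrier R \<noteq> {\<zero>}" and van: "\<And>a. (\<And>i. a i \<in> carrier R) \<Longrightarrow> standard_poly N a = \<zero>"
  shows "PI_algebra"
proof -
  interpret h: ring_hom_ring K R \<eta>
    by (intro ring_hom_ringI2 structure_map_hom K.ring_axioms ring_axioms)
  let ?P = "{\<sigma>. \<sigma> permutes {..<N}}"
  have finP: "finite ?P" by (rule finite_permutations) simp
  define h where "h \<sigma> = map \<sigma> [0..<N]" for \<sigma> :: "nat \<Rightarrow> nat"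
  define c where "c \<sigma> = (if evenperm \<sigma> then \<one>\<^bsub>K\<^esub> else \<ominus>\<^bsub>K\<^esub> \<one>\<^bsub>K\<^esub>)" for \<sigma> :: "nat \<Rightarrow> nat"
  have cK: "c \<sigma> \<in> carrier K" for \<sigma> by (simp add: c_def)
  have c0: "c \<sigma> \<noteq> \<zero>\<^bsub>K\<^esub>" for \<sigma> by (simp add: c_def)
  have inj: "inj_on h ?P"
  proof (rule inj_onI)
    fix \<sigma> \<rho> assume s: "\<sigma> \<in> ?P" "\<rho> \<in> ?P" "h \<sigma> = h \<rho>"
    have "\<sigma> i = \<rho> i" for i
    proof (cases "i < N")
      case True
      then show ?thesis using s(3) by (auto simp: h_def)
    next
      case False
      then show ?thesis using s(1,2) by (simp add: permutes_def)
    qed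
    then show "\<sigma> = \<rho>" ..
  qed
  define f where "f w = (if w \<in> h ` ?P then c (inv_into ?P h w) else \<zero>\<^bsub>K\<^esub>)" for w
  have f: "f (h \<sigma>) = c \<sigma>" if "\<sigma> \<in> ?P" for \<sigma> using that by (simp add: f_def inv_into_f_f[OF inj])
  have supp: "{w. f w \<noteq> \<zero>\<^bsub>K\<^esub>} = h ` ?P" using c0 by (auto simp: f_def)
  have "f \<in> free_algebra"
    unfolding free_algebra_def using supp finP cK by (auto simp: f_def)
  moreover have "eval_free x f = \<zero>" if x: "\<forall>i. x i \<in> carrier R" for x
  proof -
    have wc: "word_prod (x \<circ> \<sigma>) [0..<N] \<in> carrier R" for \<sigma> using x by (intro word_prod_closed) auto
    have "eval_free x f = finsum R (\<lambda>w. \<eta> (f w) \<otimes> eval_word x w) (h ` ?P)"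
      by (simp add: eval_free_def supp)
    also have "\<dots> = finsum R (\<lambda>\<sigma>. \<eta> (f (h \<sigma>)) \<otimes> eval_word x (h \<sigma>)) ?P"
      using inj wc f cK by (intro finsum_reindex) (auto simp: h_def eval_word_map)
    also have "\<dots> = standard_poly N x"
      unfolding standard_poly_def
    proof (rule finsum_cong'[OF refl])
      fix \<sigma> assume "\<sigma> \<in> ?P"
      then show "\<eta> (f (h \<sigma>)) \<otimes> eval_word x (h \<sigma>) = (if evenperm \<sigma> then word_prod (x \<circ> \<sigma>) [0..<N]
          else \<ominus> word_prod (x \<circ> \<sigma>) [0..<N])"
        using wc by (simp add: f) (simp add: c_def h_def eval_word_map l_minus)
    qed (use wc in auto)
    also have "\<dots> = \<zero>" using van x by blast
    finally show ?thesis .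
  qed
  ultimately have "polynomial_identity f" by (simp add: polynomial_identity_def)
  moreover have "f (h id) \<noteq> \<zero>\<^bsub>K\<^esub>" using f[of id] c0 by (simp add: permutes_id)
  ultimately show ?thesis unfolding PI_algebra_def by blast
qed

end

section \<open>Growth\<close>

locale nonzero_algebra = field_algebra K R \<eta>
  for K :: "('k, 'n) ring_scheme" and R :: "('a, 'm) ring_scheme" (structure) and \<eta> :: "'k \<Rightarrow> 'a" +
  assumes nonzero: "carrier R \<noteq> {\<zero>}"
begin

lemma scalars_subfield: "subfield scalars R"
proof -
  interpret h: ring_hom_ring K R \<eta>
    by (intro ring_hom_ringI2 structure_map_hom K.ring_axioms ring_axioms)
  have "\<one> \<noteq> \<zero>" using nonzero carrier_one_zero by blast
  then show ?thesis unfolding scalars_def by (rule h.img_is_subfield(2)[OF K.carrier_is_subfield])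
qed

lemma scalars_comm: "d \<in> scalars \<Longrightarrow> a \<in> carrier R \<Longrightarrow> d \<otimes> a = a \<otimes> d"
  using structure_map_central by (auto simp: scalars_def ring_center_def)

lemma scalars_sub_center: "scalars \<subseteq> ring_center R"
  using structure_map_central by (simp add: scalars_def)

lemma scalars_carrier [simp]: "d \<in> scalars \<Longrightarrow> d \<in> carrier R"
  using subfieldE(3)[OF scalars_subfield] by auto

lemma scalars_torsion_closed:
  assumes I: "ideal I R" "I \<noteq> carrier R"
  shows "torsion_closed R scalars I"
proof (intro torsion_closed.intro ring_axioms torsion_closed_axioms.intro)
  interpret I: ideal I R by (rule I(1))
  show "subring scalars R" using subfieldE(1)[OF scalars_subfield] .
  show "e \<otimes> f = f \<otimes> e" if "e \<in> scalars" "f \<in> scalars" for e f using that scalars_comm by simp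
  show "additive_subgroup I R" ..
  show "t \<otimes> e \<in> I" if "t \<in> I" "e \<in> scalars" for t e using that by (simp add: I.I_r_closed)
  show "m \<in> I" if m: "m \<in> carrier R" "e \<in> scalars" "e \<noteq> \<zero>" "m \<otimes> e \<in> I" for m e
  proof -
    have e: "inv e \<in> scalars" "e \<otimes> inv e = \<one>" using subfield_m_inv[OF scalars_subfield, of e] m by auto
    have "m \<otimes> e \<otimes> inv e \<in> I" by (rule I.I_r_closed[OF m(4)]) (use e(1) in simp)
    moreover have "m \<otimes> e \<otimes> inv e = m" using m(1,2) e by (simp add: m_assoc)
    ultimately show ?thesis by simp
  qed
qed (rule I(2))

sublocale k: torsion_closed R scalars "{\<zero>}"
  using scalars_torsion_closed[OF zeroideal] nonzero by blast

text \<open>Finite-dimensional subspaces presented by a spanning list, the form in which products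
  can be computed.\<close>

definition finite_span :: "'a set \<Rightarrow> bool"
  where "finite_span U \<longleftrightarrow> (\<exists>Us. set Us \<subseteq> carrier R \<and> U = Span scalars Us)"

lemma finite_span_finite_dimension: "finite_span U \<Longrightarrow> finite_dimension scalars U"
  using Span_finite_dimension[OF scalars_subfield] by (auto simp: finite_span_def simp del: Span.simps)

lemma finite_span_scalars: "finite_span scalars"
  unfolding finite_span_def
proof (intro exI[of _ "[\<one>]"] conjI)
  show "scalars = Span scalars [\<one>]"
    using line_extension_mem_iff[of _ scalars \<one> "{\<zero>}"] by (auto simp: rev_subsetD)
qed auto

lemma Span_least:
  assumes "set Us \<subseteq> carrier R" "additive_subgroup S R"
    and "\<And>u c. u \<in> set Us \<Longrightarrow> c \<in> scalars \<Longrightarrow> c \<otimes> u \<in> S"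
  shows "Span scalars Us \<subseteq> S"
proof (rule Span_min[OF scalars_subfield assms(1)])
  show "subgroup S (add_monoid R)" using assms(2) by (simp add: additive_subgroup_def)
  show "scalars <#> set Us \<subseteq> S" using assms(3) by (auto simp: set_mult_def)
qed

lemma Span_additive: "set Us \<subseteq> carrier R \<Longrightarrow> additive_subgroup (Span scalars Us) R"
  using Span_is_add_subgroup[OF scalars_subfield, of Us] by (simp add: additive_subgroup_def)

text \<open>Bilinearity is used in one factor at a time; scalars pass through the left factor
  because they are central.\<close>

lemma ideal_prod_Span:
  assumes A: "set As \<subseteq> carrier R" and B: "set Bs \<subseteq> carrier R"
  shows "ideal_prod R (Span scalars As) (Span scalars Bs) = Span scalars (concat (map (\<lambda>a. map (\<lambda>b. a \<otimes> b) Bs) As))"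
    (is "?P = Span scalars ?Cs")
proof
  have set: "set ?Cs = (\<lambda>(a, b). a \<otimes> b) ` (set As \<times> set Bs)" by auto
  have C: "set ?Cs \<subseteq> carrier R" unfolding set using A B by auto
  interpret S: additive_subgroup "Span scalars ?Cs" R by (rule Span_additive[OF C])
  have Ac: "Span scalars As \<subseteq> carrier R" and Bc: "Span scalars Bs \<subseteq> carrier R"
    using Span_subgroup_props(1)[OF scalars_subfield] A B by blast+
  have smult: "c \<otimes> v \<in> Span scalars ?Cs" if "c \<in> scalars" "v \<in> Span scalars ?Cs" for c v
    using Span_smult_closed[OF scalars_subfield C] that by blast
  have base: "a \<otimes> b \<in> Span scalars ?Cs" if "a \<in> set As" "b \<in> set Bs" for a b
    using Span_base_incl[OF scalars_subfield C] that set by blast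
  have 1: "a \<otimes> b \<in> Span scalars ?Cs" if a: "a \<in> Span scalars As" and b: "b \<in> set Bs" for a b
  proof -
    have bc: "b \<in> carrier R" using b B by auto
    have "Span scalars As \<subseteq> {a \<in> carrier R. a \<otimes> b \<in> Span scalars ?Cs}"
    proof (rule Span_least[OF A])
      show "additive_subgroup {a \<in> carrier R. a \<otimes> b \<in> Span scalars ?Cs} R"
        by (rule additive_subgroup_preimage[OF S.additive_subgroup_axioms]) (use bc in \<open>auto simp: l_distr\<close>)
      fix a c assume ac: "a \<in> set As" "c \<in> scalars"
      then have "c \<otimes> a \<otimes> b = c \<otimes> (a \<otimes> b)" using A bc by (auto intro!: m_assoc)
      then show "c \<otimes> a \<in> {a \<in> carrier R. a \<otimes> b \<in> Span scalars ?Cs}"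
        using smult[OF ac(2) base[OF ac(1) b]] ac A by (auto simp del: Span.simps)
    qed
    with a show ?thesis by blast
  qed
  have 2: "a \<otimes> b \<in> Span scalars ?Cs" if a: "a \<in> Span scalars As" and b: "b \<in> Span scalars Bs" for a b
  proof -
    have ac: "a \<in> carrier R" using a Ac by auto
    have "Span scalars Bs \<subseteq> {b \<in> carrier R. a \<otimes> b \<in> Span scalars ?Cs}"
    proof (rule Span_least[OF B])
      show "additive_subgroup {b \<in> carrier R. a \<otimes> b \<in> Span scalars ?Cs} R"
        by (rule additive_subgroup_preimage[OF S.additive_subgroup_axioms]) (use ac in \<open>auto simp: r_distr\<close>)
      fix b c assume bc: "b \<in> set Bs" "c \<in> scalars"
      then have b: "b \<in> carrier R" using B by auto
      have "a \<otimes> (c \<otimes> b) = c \<otimes> (a \<otimes> b)"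
        using ac bc b scalars_comm[of c a] by (simp add: m_assoc[symmetric])
      then show "c \<otimes> b \<in> {b \<in> carrier R. a \<otimes> b \<in> Span scalars ?Cs}"
        using smult[OF bc(2) 1[OF a bc(1)]] bc b by (auto simp del: Span.simps)
    qed
    with b show ?thesis by blast
  qed
  show "?P \<subseteq> Span scalars ?Cs"
  proof
    fix s assume "s \<in> ?P"
    then show "s \<in> Span scalars ?Cs"
    proof induction
      case (prod i j)
      then show ?case by (rule 2)
    next
      case (sum s1 s2)
      then show ?case using S.a_closed by blast
    qed
  qed
  have Pc: "?P \<subseteq> carrier R"
  proof
    fix s assume "s \<in> ?P"
    then show "s \<in> carrier R" by induction (use Ac Bc in \<open>auto simp del: Span.simps\<close>)
  qed
  have Asm: "c \<otimes> a \<in> Span scalars As" if "c \<in> scalars" "a \<in> Span scalars As" for c a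
    using Span_smult_closed[OF scalars_subfield A] that by blast
  have Psm: "c \<otimes> s \<in> ?P" if c: "c \<in> scalars" and s: "s \<in> ?P" for c s
    using s
  proof induction
    case (prod i j)
    have "c \<otimes> (i \<otimes> j) = (c \<otimes> i) \<otimes> j" using prod c Ac Bc by (intro m_assoc[symmetric]) auto
    then show ?case using ideal_prod.prod[OF Asm[OF c prod(1)] prod(2), of R] by simp
  next
    case (sum s1 s2)
    have "c \<otimes> (s1 \<oplus> s2) = c \<otimes> s1 \<oplus> c \<otimes> s2" using sum.hyps c Pc by (intro r_distr) auto
    then show ?case using ideal_prod.sum[OF sum.IH] by simp
  qed
  show "Span scalars ?Cs \<subseteq> ?P"
  proof (rule Span_least[OF C])
    show "additive_subgroup ?P R"
    proof (rule additive_subgroup.intro, rule add.subgroupI)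
      have "\<zero> \<otimes> \<zero> \<in> ?P"
        by (rule ideal_prod.prod) (use Span_subgroup_props(2)[OF scalars_subfield] A B in blast)+
      then show "?P \<noteq> {}" by blast
      fix s assume s: "s \<in> ?P"
      then have "(\<ominus> \<one>) \<otimes> s = \<ominus> s" using Pc by (auto simp: l_minus)
      then show "\<ominus> s \<in> ?P" using Psm[OF _ s, of "\<ominus> \<one>"] by auto
    next
      fix s s' assume "s \<in> ?P" "s' \<in> ?P"
      then show "s \<oplus> s' \<in> ?P" by (rule ideal_prod.sum)
    qed (rule Pc)
    fix u c assume u: "u \<in> set ?Cs" "c \<in> scalars"
    then obtain a b where ab: "a \<in> set As" "b \<in> set Bs" "u = a \<otimes> b" by auto
    then have "a \<otimes> b \<in> ?P" using Span_base_incl[OF scalars_subfield] A B by (intro ideal_prod.prod) blast+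
    then show "c \<otimes> u \<in> ?P" using Psm u ab by blast
  qed
qed

lemma finite_span_prod: "finite_span U \<Longrightarrow> finite_span V \<Longrightarrow> finite_span (ideal_prod R U V)"
proof -
  assume "finite_span U" "finite_span V"
  then obtain As Bs where AB: "set As \<subseteq> carrier R" "U = Span scalars As" "set Bs \<subseteq> carrier R" "V = Span scalars Bs"
    unfolding finite_span_def by blast
  have "set (concat (map (\<lambda>a. map (\<lambda>b. a \<otimes> b) Bs) As)) \<subseteq> carrier R" using AB(1,3) by auto
  then show ?thesis unfolding finite_span_def AB(2,4) ideal_prod_Span[OF AB(1,3)] by blast
qed

lemma finite_span_sum: "finite_span U \<Longrightarrow> finite_span V \<Longrightarrow> finite_span (U <+> V)"
proof -
  assume "finite_span U" "finite_span V"
  then obtain As Bs where AB: "set As \<subseteq> carrier R" "U = Span scalars As" "set Bs \<subseteq> carrier R" "V = Span scalars Bs"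
    unfolding finite_span_def by blast
  have "set (As @ Bs) \<subseteq> carrier R" using AB(1,3) by auto
  then show ?thesis unfolding finite_span_def AB(2,4)
    using Span_append_eq_set_add[OF scalars_subfield AB(1,3)] by metis
qed

lemma finite_span_zero: "finite_span U \<Longrightarrow> \<zero> \<in> U" and finite_span_carrier: "finite_span U \<Longrightarrow> U \<subseteq> carrier R"
  using Span_subgroup_props(1,2)[OF scalars_subfield] unfolding finite_span_def by blast+

lemma finite_span_subspace_power: "finite_span V \<Longrightarrow> finite_span (subspace_power V n)"
  by (induction n) (auto intro: finite_span_scalars finite_span_prod)

lemma finite_span_growth_space: "finite_span V \<Longrightarrow> finite_span (growth_space V n)"
  by (induction n) (auto intro: finite_span_scalars finite_span_prod finite_span_sum
      finite_span_subspace_power simp del: subspace_power.simps)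

lemma set_add_left: "\<zero> \<in> V \<Longrightarrow> u \<in> U \<Longrightarrow> U \<subseteq> carrier R \<Longrightarrow> u \<in> U <+> V"
  unfolding set_add_def' by auto (metis r_zero subset_iff)

lemma set_add_right: "\<zero> \<in> U \<Longrightarrow> v \<in> V \<Longrightarrow> V \<subseteq> carrier R \<Longrightarrow> v \<in> U <+> V"
  unfolding set_add_def' by auto (metis l_zero subset_iff)

lemma growth_space_mono:
  assumes V: "finite_span V" and "m \<le> n"
  shows "growth_space V m \<subseteq> growth_space V n"
  using assms(2)
proof (induction rule: dec_induct)
  case (step n)
  have "growth_space V n \<subseteq> growth_space V (Suc n)"
    using set_add_left[OF finite_span_zero[OF finite_span_subspace_power[OF V, of "Suc n"]] _
        finite_span_carrier[OF finite_span_growth_space[OF V, of n]]]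
    by (auto simp del: subspace_power.simps)
  with step show ?case by blast
qed simp

lemma subspace_power_subset_growth_space:
  assumes V: "finite_span V" and "m \<le> n"
  shows "subspace_power V m \<subseteq> growth_space V n"
proof -
  have "subspace_power V m \<subseteq> growth_space V m"
  proof (cases m)
    case (Suc l)
    then show ?thesis
      using set_add_right[OF finite_span_zero[OF finite_span_growth_space[OF V, of l]] _
          finite_span_carrier[OF finite_span_subspace_power[OF V, of m]]]
      by (auto simp del: subspace_power.simps)
  qed simp
  then show ?thesis using growth_space_mono[OF assms] by blast
qed

lemma word_prod_subspace_power:
  assumes V: "finite_span V" and x: "\<And>i. i \<in> set w \<Longrightarrow> x i \<in> V"
  shows "word_prod x w \<in> subspace_power V (length w)"
  using x
proof (induction w rule: rev_induct)
  case (snoc i w)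
  have c: "x j \<in> carrier R" if "j \<in> set w \<union> set [i]" for j using that snoc.prems finite_span_carrier[OF V] by auto
  have "word_prod x (w @ [i]) = word_prod x w \<otimes> word_prod x [i]" by (rule word_prod_append) (rule c)
  then have "word_prod x (w @ [i]) = word_prod x w \<otimes> x i" using c[of i] by simp
  then show ?case using snoc by (auto intro!: ideal_prod.prod)
qed (use subfieldE(1)[OF scalars_subfield] in \<open>auto dest: subringE(3)\<close>)

text \<open>Links \<open>lin_indep\<close> with \<open>dim\<close>: a basis of U generates U up to
  closure, and \<open>exchange\<close> compares sizes.\<close>

lemma card_indep_le_dim:
  assumes U: "finite_span U" and J: "finite J" "lin_indep scalars {\<zero>} J b" "\<And>j. j \<in> J \<Longrightarrow> b j \<in> U"
  shows "card J \<le> (dim over scalars) U"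
proof -
  have "dimension ((dim over scalars) U) scalars U"
    by (rule finite_dimensionE[OF scalars_subfield finite_span_finite_dimension[OF U]])
  from exists_base[OF scalars_subfield this] obtain Us where
    Us: "set Us \<subseteq> carrier R" "length Us = (dim over scalars) U" "Span scalars Us = U" by blast
  have id: "id u \<in> carrier R" if "u \<in> set Us" for u using that Us by auto
  have "Span scalars Us \<subseteq> k.cl (set Us) id"
  proof (rule Span_least[OF Us(1) k.cl_subgroup[OF finite_set id]])
    fix u c assume u: "u \<in> set Us" "c \<in> scalars"
    have "id u \<otimes> c \<in> k.cl (set Us) id"
      by (rule k.cl_mult[OF k.cl_incl[OF finite_set id u(1)] u(2) finite_set id])
    then show "c \<otimes> u \<in> k.cl (set Us) id" using scalars_comm[OF u(2), of u] Us(1) u(1) by auto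
  qed
  then have "card J \<le> card (set Us)"
    by (intro k.exchange[OF J(1) finite_set id J(2)]) (use J(3) Us(3) in blast)+
  also have "\<dots> \<le> length Us" by (rule card_length)
  finally show ?thesis using Us(2) by simp
qed

text \<open>The exponent is chosen strictly between the limsup and 3, and the bound on logarithms is
  exponentiated.\<close>

lemma GKdim_growth_bound:
  assumes GK: "GKdim < 3" and V: "finite_span V"
  obtains c where "c < 3" "\<forall>\<^sub>F n in sequentially. real ((dim over scalars) (growth_space V n)) \<le> real n powr c"
proof -
  define d where "d n = real ((dim over scalars) (growth_space V n))" for n
  have "limsup (\<lambda>n. ereal (ln (d n) / ln (real n))) \<le> GKdim"
    unfolding GKdim_def d_def using finite_span_finite_dimension[OF V] by (intro SUP_upper) auto
  then have "limsup (\<lambda>n. ereal (ln (d n) / ln (real n))) < ereal 3" using GK by simp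
  then obtain c where c: "limsup (\<lambda>n. ereal (ln (d n) / ln (real n))) < ereal c" "ereal c < ereal 3"
    using ereal_dense2 by blast
  have "\<forall>\<^sub>F n in sequentially. ereal (ln (d n) / ln (real n)) < ereal c" using c(1) by (rule Limsup_lessD)
  then have "\<forall>\<^sub>F n in sequentially. d n \<le> real n powr c"
    using eventually_gt_at_top[of 1]
  proof eventually_elim
    case (elim n)
    then have ln: "ln (real n) > 0" by simp
    show ?case
    proof (cases "d n > 0")
      case True
      have "ln (d n) < c * ln (real n)" using elim ln by (simp add: divide_less_eq)
      then have "exp (ln (d n)) \<le> exp (c * ln (real n))" by simp
      then show ?thesis using True elim by (simp add: powr_def)
    next
      \<comment> \<open>The value of \<open>ln\<close> at 0 carries no information, but a dimension
        0 satisfies the bound anyway.\<close>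
      case False
      then have "d n = 0" by (simp add: d_def)
      then show ?thesis by simp
    qed
  qed
  then show thesis using that[of c] c(2) by (simp add: d_def)
qed

text \<open>At least n^3 / 2 independent elements contradict a bound n^c with c < 3. The length 2 n
  is that of a normal word of length n followed by fewer than n copies of one more letter.\<close>

lemma no_cubic_growth:
  assumes GK: "GKdim < 3" and x: "\<And>i. i < g \<Longrightarrow> x i \<in> carrier R"
    and ex: "\<And>n. \<exists>(J :: (nat list \<times> nat) set) b. finite J \<and> lin_indep scalars {\<zero>} J b \<and>
      b ` J \<subseteq> word_prod x ` short_words g (2 * n) \<and> n ^ 3 \<le> 2 * card J"
  shows False
proof -
  define V where "V = Span scalars (map x [0..<g])"
  have set: "set (map x [0..<g]) \<subseteq> carrier R" using x by auto
  then have V: "finite_span V" unfolding finite_span_def V_def by blast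
  have xV: "x i \<in> V" if "i < g" for i using Span_base_incl[OF scalars_subfield set] that by (auto simp: V_def simp del: Span.simps)
  obtain c where c: "c < 3" "\<forall>\<^sub>F n in sequentially. real ((dim over scalars) (growth_space V n)) \<le> real n powr c"
    using GKdim_growth_bound[OF GK V] .
  have bound: "n ^ 3 \<le> 2 * (dim over scalars) (growth_space V (2 * n))" for n
  proof -
    obtain J :: "(nat list \<times> nat) set" and b where J: "finite J" "lin_indep scalars {\<zero>} J b"
      "b ` J \<subseteq> word_prod x ` short_words g (2 * n)" "n ^ 3 \<le> 2 * card J" using ex[of n] by (elim exE conjE)
    have "card J \<le> (dim over scalars) (growth_space V (2 * n))"
    proof (rule card_indep_le_dim[OF finite_span_growth_space[OF V] J(1,2)])
      fix j assume "j \<in> J"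
      then obtain w where w: "w \<in> short_words g (2 * n)" "b j = word_prod x w" using J(3) by blast
      have "word_prod x w \<in> subspace_power V (length w)"
        using w(1) xV by (intro word_prod_subspace_power[OF V]) (auto simp: short_words_def)
      moreover have "length w \<le> 2 * n" using w(1) by (simp add: short_words_def)
      ultimately show "b j \<in> growth_space V (2 * n)"
        using subspace_power_subset_growth_space[OF V] w(2) by auto
    qed
    with J(4) show ?thesis by linarith
  qed
  from c(2) obtain n0 where n0: "\<And>n. n \<ge> n0 \<Longrightarrow> real ((dim over scalars) (growth_space V n)) \<le> real n powr c"
    by (auto simp: eventually_sequentially)
  \<comment> \<open>The growth bound at 2 n would give n^3 <= a n^c, which fails as soon as n
    exceeds a^(1 / (3 - c)).\<close>
  define a where "a = 2 * 2 powr c"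
  have a: "a > 0" by (simp add: a_def)
  obtain n :: nat where n: "real n > a powr (1 / (3 - c)) + real n0" using reals_Archimedean2 by blast
  then have npos: "real n > a powr (1 / (3 - c))" "real n > 0" "n \<ge> n0"
    using powr_ge_zero[of a "1 / (3 - c)"] by linarith+
  have "a = (a powr (1 / (3 - c))) powr (3 - c)" using a c(1) by (simp add: powr_powr)
  also have "\<dots> < real n powr (3 - c)" using npos c(1) by (intro powr_less_mono2) auto
  finally have "a * real n powr c < real n powr (3 - c) * real n powr c" using npos by simp
  also have "\<dots> = real n ^ 3" using npos by (simp add: powr_add[symmetric])
  finally have less: "2 * real (2 * n) powr c < real n ^ 3" by (simp add: a_def powr_mult)
  have "real (n ^ 3) \<le> real (2 * (dim over scalars) (growth_space V (2 * n)))" using bound[of n] by (simp only: of_nat_le_iff)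
  also have "\<dots> \<le> 2 * real (2 * n) powr c" using n0[of "2 * n"] npos(3) by simp
  finally show False using less by simp
qed

text \<open>The span of finitely many elements is not all of Z, and over the field of scalars the
  closure is contained in the span, so a further element can always be added.\<close>

lemma infinite_dimension_indep:
  assumes Z: "additive_subgroup Z R" "\<And>z c. z \<in> Z \<Longrightarrow> c \<in> scalars \<Longrightarrow> c \<otimes> z \<in> Z"
    and inf: "infinite_dimension scalars Z"
  shows "\<exists>J. finite J \<and> J \<subseteq> Z \<and> card J = n \<and> lin_indep scalars {\<zero>} J id"
proof (induction n)
  case 0
  show ?case by (intro exI[of _ "{}"]) (auto simp: lin_indep_def)
next
  case (Suc n)
  interpret Z: additive_subgroup Z R by (rule Z(1))
  from Suc obtain J where J: "finite J" "J \<subseteq> Z" "card J = n" "lin_indep scalars {\<zero>} J id" by blast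
  obtain Us where Us: "set Us = J" using finite_list[OF J(1)] by blast
  have Jc: "J \<subseteq> carrier R" using J(2) Z.a_subset by blast
  have "Span scalars Us \<subseteq> Z"
    by (rule Span_least) (use Jc Us J(2) Z in auto)
  moreover have "Span scalars Us \<noteq> Z"
    using inf Span_finite_dimension[OF scalars_subfield, of Us] Us Jc by blast
  ultimately obtain u where u: "u \<in> Z" "u \<notin> Span scalars Us" by blast
  have Usc: "set Us \<subseteq> carrier R" using Us Jc by simp
  have "k.cl J id \<subseteq> Span scalars Us"
  proof (rule k.cl_min[OF Span_additive[OF Usc]])
    fix m e assume m: "m \<in> Span scalars Us" and e: "e \<in> scalars"
    have "m \<in> carrier R" using m Span_subgroup_props(1)[OF scalars_subfield Usc] by blast
    then show "m \<otimes> e \<in> Span scalars Us"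
      using Span_smult_closed[OF scalars_subfield Usc e m] scalars_comm[OF e] by simp
  next
    fix m e assume m: "m \<in> carrier R" "e \<in> scalars" "e \<noteq> \<zero>" "m \<otimes> e \<in> Span scalars Us"
    have "e \<otimes> m \<in> Span scalars Us" using m(4) scalars_comm[OF m(2,1)] by (simp del: Span.simps)
    then show "m \<in> Span scalars Us"
      using Span_m_inv_simprule[OF scalars_subfield Usc, of e m] m by blast
  next
    show "{\<zero>} \<subseteq> Span scalars Us" using Span_subgroup_props(2)[OF scalars_subfield Usc] by blast
    show "id j \<in> Span scalars Us" if "j \<in> J" for j
      using Span_base_incl[OF scalars_subfield Usc] that Us by auto
  qed
  then have ucl: "u \<notin> k.cl J id" using u(2) by blast
  have "u \<notin> J" using u(2) Span_base_incl[OF scalars_subfield Usc] Us by blast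
  moreover have "lin_indep scalars {\<zero>} (insert u J) id"
    by (rule k.indep_insert) (use J Jc ucl u Z.a_subset in auto)
  moreover have "card (insert u J) = Suc n" "insert u J \<subseteq> Z" "finite (insert u J)"
    using J u calculation(1) by auto
  ultimately show ?case by blast
qed

lemma word_span_carrier:
  assumes "\<And>i. i < g \<Longrightarrow> x i \<in> carrier R" "a \<in> word_span scalars x g N"
  shows "a \<in> carrier R"
  using assms(2)
proof induction
  case (add a w d)
  have "word_prod x w \<in> carrier R" using add assms(1) by (intro word_prod_closed) (auto simp: short_words_def)
  with add show ?case by simp
qed simp

lemma word_span_mono: "a \<in> word_span D x g N \<Longrightarrow> N \<le> N' \<Longrightarrow> a \<in> word_span D x g N'"
proof (induction rule: word_span.induct)
  case (add a w d)
  then show ?case by (intro word_span.add) (auto simp: short_words_def)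
qed (rule word_span.zero)

lemma word_span_add:
  assumes x: "\<And>i. i < g \<Longrightarrow> x i \<in> carrier R" and a: "a \<in> word_span scalars x g N" and b: "b \<in> word_span scalars x g N"
  shows "a \<oplus> b \<in> word_span scalars x g N"
  using b
proof induction
  case zero
  then show ?case using a word_span_carrier[OF x a] by simp
next
  case (add b w d)
  have "word_prod x w \<in> carrier R" using add x by (intro word_prod_closed) (auto simp: short_words_def)
  then have "a \<oplus> (b \<oplus> word_prod x w \<otimes> d) = (a \<oplus> b) \<oplus> word_prod x w \<otimes> d"
    using word_span_carrier[OF x a] word_span_carrier[OF x add.hyps(1)] add.hyps(3) by (simp add: a_assoc)
  then show ?case using word_span.add[OF add.IH add.hyps(2,3)] by simp
qed

lemma word_span_mult:
  assumes x: "\<And>i. i < g \<Longrightarrow> x i \<in> carrier R" and a: "a \<in> word_span scalars x g N" and b: "b \<in> word_span scalars x g M"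
  shows "a \<otimes> b \<in> word_span scalars x g (N + M)"
  using b
proof induction
  case zero
  then show ?case using word_span_carrier[OF x a] by (simp add: word_span.zero)
next
  case (add b w d)
  have wc: "word_prod x w \<in> carrier R" if "w \<in> short_words g L" for w L
    using that x by (intro word_prod_closed) (auto simp: short_words_def)
  have "a \<otimes> (word_prod x w \<otimes> d) \<in> word_span scalars x g (N + M)"
    using a
  proof induction
    case zero
    then show ?case using wc[OF add.hyps(2)] add.hyps(3) by (simp add: word_span.zero)
  next
    case (add a v c)
    note w = \<open>w \<in> short_words g M\<close> and d = \<open>d \<in> scalars\<close>
    have vw: "v @ w \<in> short_words g (N + M)" using w add.hyps(2) by (auto simp: short_words_def)
    have "word_prod x (v @ w) = word_prod x v \<otimes> word_prod x w"
      using w add.hyps(2) x by (intro word_prod_append) (auto simp: short_words_def)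
    then have "word_prod x v \<otimes> c \<otimes> (word_prod x w \<otimes> d) = word_prod x (v @ w) \<otimes> (c \<otimes> d)"
      using wc[OF w] wc[OF add.hyps(2)] add.hyps(3) d scalars_comm[OF add.hyps(3), of "word_prod x w"]
      by (simp add: m_assoc) (simp add: m_assoc[symmetric])
    then have "(a \<oplus> word_prod x v \<otimes> c) \<otimes> (word_prod x w \<otimes> d) = a \<otimes> (word_prod x w \<otimes> d) \<oplus> word_prod x (v @ w) \<otimes> (c \<otimes> d)"
      using wc[OF w] wc[OF add.hyps(2)] add.hyps(3) d word_span_carrier[OF x add.hyps(1)] by (simp add: l_distr)
    then show ?case using word_span.add[OF add.IH vw, of "c \<otimes> d"] add.hyps(3) d by auto
  qed
  from word_span_add[OF x add.IH this]
  show ?case using word_span_carrier[OF x a] word_span_carrier[OF x add.hyps(1)] wc[OF add.hyps(2)] add.hyps(3)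
    by (simp add: r_distr)
qed

lemma scalar_word: "d \<in> scalars \<Longrightarrow> w \<in> short_words g N \<Longrightarrow> word_prod x w \<otimes> d \<in> carrier R \<Longrightarrow> word_prod x w \<otimes> d \<in> word_span scalars x g N"
  using word_span.add[OF word_span.zero, of w g N d scalars x] by simp

lemma affine_words:
  assumes affine
  obtains x g where "\<And>i. x i \<in> carrier R" "\<And>m. m \<in> carrier R \<Longrightarrow> \<exists>N. m \<in> word_span scalars x g N"
proof -
  from assms obtain S where S: "finite S" "S \<subseteq> carrier R" "generate_ring R (scalars \<union> S) = carrier R"
    unfolding affine_def by blast
  obtain ss where ss: "set ss = S" using finite_list[OF S(1)] by blast
  define g where "g = length ss"
  \<comment> \<open>The default value 0 beyond the generators keeps every \<open>x i\<close> in the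
    carrier.\<close>
  define x where "x i = (if i < g then ss ! i else \<zero>)" for i
  have x: "x i \<in> carrier R" for i using S(2) ss nth_mem[of i ss] by (auto simp: x_def g_def)
  have one: "\<one> \<in> scalars" by blast
  have "\<exists>N. m \<in> word_span scalars x g N" if "m \<in> generate_ring R (scalars \<union> S)" for m
    using that
  proof induction
    case one
    show ?case using scalar_word[of \<one> "[]" g 0 x] by (auto simp: short_words_def)
  next
    case (incl h)
    then consider "h \<in> scalars" | "h \<in> S" by blast
    then show ?case
    proof cases
      case 1
      then show ?thesis using scalar_word[of h "[]" g 0 x] by (auto simp: short_words_def)
    next
      case 2
      then obtain i where i: "i < g" "h = x i" using ss by (auto simp: in_set_conv_nth x_def g_def)
      then show ?thesis using scalar_word[of \<one> "[i]" g 1 x] x by (auto simp: short_words_def)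
    qed
  next
    case (a_inv h)
    then obtain N where N: "h \<in> word_span scalars x g N" by blast
    have h: "h \<in> carrier R" by (rule word_span_carrier[OF x N])
    have "\<ominus> \<one> \<in> word_span scalars x g 0" using scalar_word[of "\<ominus> \<one>" "[]" g 0 x] by (auto simp: short_words_def)
    from word_span_mult[OF x N this] show ?case using h by (auto simp: r_minus)
  next
    case (eng_add h1 h2)
    then obtain N M where N: "h1 \<in> word_span scalars x g N" "h2 \<in> word_span scalars x g M" by blast
    have "h1 \<in> word_span scalars x g (N + M)" "h2 \<in> word_span scalars x g (N + M)"
      using word_span_mono[OF N(1)] word_span_mono[OF N(2)] by auto
    from word_span_add[of g x h1 "N + M" h2, OF x this] show ?case by blast
  next
    case (eng_mult h1 h2)
    then obtain N M where N: "h1 \<in> word_span scalars x g N" "h2 \<in> word_span scalars x g M" by blast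
    from word_span_mult[of g x h1 N h2 M, OF x N] show ?case by blast
  qed
  then show thesis using that[of x g] x S(3) by blast
qed

end

section \<open>The case of a transcendental central element\<close>

context ring
begin

lemma center_carrier: "z \<in> ring_center R \<Longrightarrow> z \<in> carrier R"
  and center_comm: "z \<in> ring_center R \<Longrightarrow> a \<in> carrier R \<Longrightarrow> z \<otimes> a = a \<otimes> z"
  by (auto simp: ring_center_def)

lemma center_subring: "subring (ring_center R) R"
proof (rule subringI)
  fix y z assume yz: "y \<in> ring_center R" "z \<in> ring_center R"
  have c: "y \<in> carrier R" "z \<in> carrier R" using yz center_carrier by auto
  show "y \<otimes> z \<in> ring_center R"
    unfolding ring_center_def
  proof (intro CollectI conjI ballI)
    fix a assume a: "a \<in> carrier R"
    have "y \<otimes> z \<otimes> a = y \<otimes> (a \<otimes> z)" using c a center_comm[OF yz(2) a] by (simp add: m_assoc)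
    also have "\<dots> = (y \<otimes> a) \<otimes> z" using c a by (simp add: m_assoc)
    also have "\<dots> = a \<otimes> (y \<otimes> z)" unfolding center_comm[OF yz(1) a] using c a by (simp add: m_assoc)
    finally show "y \<otimes> z \<otimes> a = a \<otimes> (y \<otimes> z)" .
  qed (use c in simp)
  show "y \<oplus> z \<in> ring_center R"
    using yz by (simp add: ring_center_def l_distr r_distr)
next
  fix y assume y: "y \<in> ring_center R"
  then show "\<ominus> y \<in> ring_center R"
    by (simp add: ring_center_def l_minus r_minus)
qed (auto simp: ring_center_def)

lemma prime_central_torsion_closed:
  assumes prime: "prime_ring R" and D: "subring D R" "D \<subseteq> ring_center R"
  shows "torsion_closed R D {\<zero>}"
proof (intro torsion_closed.intro ring_axioms torsion_closed_axioms.intro D(1))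
  have Dc: "d \<in> ring_center R" "d \<in> carrier R" if "d \<in> D" for d using that D(2) center_carrier by auto
  show "e \<otimes> f = f \<otimes> e" if "e \<in> D" "f \<in> D" for e f using center_comm Dc that by blast
  show "additive_subgroup {\<zero>} R" using zeroideal by (rule ideal.axioms(1))
  show "t \<otimes> e \<in> {\<zero>}" if "t \<in> {\<zero>}" "e \<in> D" for t e using that Dc by auto
  show "m \<in> {\<zero>}" if "m \<in> carrier R" "e \<in> D" "e \<noteq> \<zero>" "m \<otimes> e \<in> {\<zero>}" for m e
    using prime_ring_central_regular[OF prime Dc(1)[OF that(2)] that(3) that(1)] that(4) by blast
  show "{\<zero>} \<noteq> carrier R" using prime by (auto simp: prime_ring_def)
qed

lemma simple_ext_of_center:
  assumes "subring D R" "D \<subseteq> ring_center R" "p \<in> carrier R"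
  shows "simple_ext R D p"
proof (intro simple_ext.intro ring_axioms simple_ext_axioms.intro assms(1,3))
  show "c \<otimes> d = d \<otimes> c" if "c \<in> D" "d \<in> D" for c d using center_comm center_carrier assms(2) that by blast
  show "c \<otimes> p = p \<otimes> c" if "c \<in> D" for c using center_comm assms(2,3) that by blast
qed

lemma adjoin_sub_center:
  assumes "subring D R" "D \<subseteq> ring_center R" "z \<in> ring_center R"
  shows "adjoin D z \<subseteq> ring_center R"
proof
  interpret S: simple_ext R D z using assms center_carrier by (intro simple_ext_of_center)
  fix f assume f: "f \<in> adjoin D z"
  have "a \<otimes> f = f \<otimes> a" if a: "a \<in> carrier R" for a
  proof (rule S.adjoin_commutes[OF a _ _ f])
    show "a \<otimes> z = z \<otimes> a" using center_comm[OF assms(3) a] by simp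
    show "a \<otimes> d = d \<otimes> a" if "d \<in> D" for d using center_comm[of d a] that assms(2) a by auto
  qed
  then show "f \<in> ring_center R" using S.adjoin_closed[OF f] by (auto simp: ring_center_def)
qed

lemma adjoin_subset_subring:
  assumes "subring F R" "D \<subseteq> F" "z \<in> F"
  shows "adjoin D z \<subseteq> F"
proof -
  have pw: "z [^] n \<in> F" for n :: nat
    by (induction n) (use subringE[OF assms(1)] assms(3) in auto)
  have "polys_below D z n \<subseteq> F" for n
  proof (induction n)
    case (Suc n)
    then show ?case using pw[of n] assms(2)
      by (auto intro!: subringE(7)[OF assms(1)] subringE(6)[OF assms(1)])
  qed (use subringE(2)[OF assms(1)] in auto)
  then show ?thesis by (auto simp: adjoin_def)
qed

lemma lin_indep_mono: "lin_indep E T J b \<Longrightarrow> T' \<subseteq> T \<Longrightarrow> lin_indep E T' J b"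
  unfolding lin_indep_def by blast

text \<open>Treats y as a new letter with index g, so that a word times a power of y is again a
  word.\<close>

lemma word_prod_power_letter:
  assumes "set w \<subseteq> {..<g}" "\<And>i. i < g \<Longrightarrow> x i \<in> carrier R" "y \<in> carrier R"
  shows "word_prod (x(g := y)) (w @ replicate s g) = word_prod x w \<otimes> y [^] s"
proof -
  have "word_prod (x(g := y)) (w @ replicate s g) = word_prod (x(g := y)) w \<otimes> word_prod (x(g := y)) (replicate s g)"
    using assms by (intro word_prod_append) auto
  also have "word_prod (x(g := y)) w = word_prod x w"
    using assms(1) by (intro word_prod_cong) auto
  also have "word_prod (x(g := y)) (replicate s g) = y [^] s"
    using word_prod_replicate[of "[g]" "x(g := y)" s] assms(3) by simp
  finally show ?thesis .
qed

end

context central_words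
begin

text \<open>Add up the m + 1 or more normal words of each length m between 1 and n.\<close>

lemma normals_quadratic:
  assumes "\<And>m. m \<ge> 1 \<Longrightarrow> m < card {w. normal w \<and> length w = m}"
  shows "n ^ 2 \<le> 2 * card (normals n)"
proof (induction n)
  case (Suc n)
  have fin: "finite {w. normal w \<and> length w = Suc n}"
    by (rule finite_subset[OF _ finite_normals[of "Suc n"]]) (auto simp: normals_def)
  have "normals (Suc n) = normals n \<union> {w. normal w \<and> length w = Suc n}" by (auto simp: normals_def)
  moreover have "normals n \<inter> {w. normal w \<and> length w = Suc n} = {}" by (auto simp: normals_def)
  ultimately have "card (normals (Suc n)) = card (normals n) + card {w. normal w \<and> length w = Suc n}"
    using card_Un_disjoint[OF finite_normals fin] by simp
  moreover have "Suc n < card {w. normal w \<and> length w = Suc n}" using assms by simp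
  ultimately show ?case using Suc by (simp add: power2_eq_square)
qed simp

text \<open>A relation of degree n puts the n-th power of \<open>p\<close> into the closure of lower
  powers, which are shorter words because \<open>p\<close> is nonempty.\<close>

lemma algebraic_power_not_normal:
  assumes p: "set p \<subseteq> {..<g}" "p \<noteq> []" and alg: "algebraic_elem D (word_prod x p)"
  shows "\<exists>e. \<not> normal (concat (replicate e p))"
proof -
  let ?P = "word_prod x p"
  from alg obtain n f c where f: "f \<in> polys_below D ?P n" "c \<in> D" "c \<noteq> \<zero>" "f \<oplus> ?P [^] n \<otimes> c = \<zero>"
    unfolding algebraic_elem_def by blast
  let ?w = "\<lambda>i. concat (replicate i p)"
  have letters: "set (?w i) \<subseteq> {..<g}" for i using p by auto
  have word: "word_prod x (?w i) = ?P [^] i" for i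
    using p x_carrier by (intro word_prod_replicate) auto
  let ?C = "cl (smaller_words g (?w n)) (word_prod x)"
  interpret C: additive_subgroup ?C R by (rule cl_subgroup[OF finite_smaller_words smaller_closed])
  have smaller: "?w i \<in> smaller_words g (?w n)" if "i < n" for i
  proof -
    have "length (?w i) < length (?w n)" using that p by (simp add: length_concat sum_list_replicate)
    then show ?thesis using letters[of i] by (auto simp: smaller_words_def lenlex_conv)
  qed
  have inC: "m \<le> n \<Longrightarrow> h \<in> polys_below D ?P m \<Longrightarrow> h \<in> ?C" for m h
  proof (induction m arbitrary: h)
    case (Suc m)
    from Suc.prems(2) obtain h' d where h: "h' \<in> polys_below D ?P m" "d \<in> D" "h = h' \<oplus> ?P [^] m \<otimes> d" by auto
    have "word_prod x (?w m) \<in> ?C"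
      by (rule cl_incl[OF finite_smaller_words smaller_closed]) (use smaller Suc.prems(1) in auto)
    then have "?P [^] m \<otimes> d \<in> ?C" unfolding word
      by (rule cl_mult[OF _ h(2) finite_smaller_words smaller_closed])
    then show ?case using Suc.IH[OF _ h(1)] Suc.prems(1) h(3) by simp
  qed simp
  have fc: "f \<in> ?C" by (rule inC[OF order_refl f(1)])
  have Pc: "?P [^] n \<in> carrier R" using p by simp
  have "?P [^] n \<otimes> c = \<ominus> f"
    using f(2,4) fc Pc minus_equality[of "?P [^] n \<otimes> c" f] C.a_subset a_comm[of f "?P [^] n \<otimes> c"] by auto
  then have "?P [^] n \<otimes> c \<in> ?C" using C.a_inv_closed[OF fc] by simp
  then have "?P [^] n \<in> ?C" by (rule cl_torsion_free[OF _ Pc f(2,3)])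
  then have "\<not> normal (?w n)" unfolding normal_def word[symmetric] by simp
  then show ?thesis by blast
qed

lemma word_span_common:
  assumes span: "\<And>m. m \<in> carrier R \<Longrightarrow> \<exists>N. m \<in> word_span D' x g N" and J: "finite J" "J \<subseteq> carrier R"
    and mono: "\<And>a N N'. a \<in> word_span D' x g N \<Longrightarrow> N \<le> N' \<Longrightarrow> a \<in> word_span D' x g N'"
  shows "\<exists>l. \<forall>j \<in> J. j \<in> word_span D' x g l"
  using J
proof (induction J rule: finite_induct)
  case (insert y F)
  then obtain l where l: "\<forall>j \<in> F. j \<in> word_span D' x g l" by auto
  obtain N where N: "y \<in> word_span D' x g N" using span insert.prems by auto
  show ?case by (rule exI[of _ "max l N"]) (use l N mono in \<open>auto intro: max.cobounded1 max.cobounded2\<close>)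
qed simp

end

context nonzero_algebra
begin

text \<open>Otherwise at least n^2 / 2 normal words of length at most n, times n powers of y, would
  give n^3 / 2 independent elements. Independence is over k and modulo 0, whatever D and I define
  the normal words.\<close>

lemma gap_exists:
  assumes cw: "central_words R D I x g" and GK: "GKdim < 3" and y: "y \<in> carrier R"
    and ind: "\<And>n. lin_indep scalars {\<zero>} (central_words.normals R D I x g n \<times> {..<n})
      (\<lambda>(w, s). word_prod x w \<otimes> y [^] (s :: nat))"
  shows "\<exists>n \<ge> 1. card {w. central_words.normal R D I x g w \<and> length w = n} \<le> n"
proof (rule ccontr)
  interpret W: central_words R D I x g by (rule cw)
  assume "\<not> ?thesis"
  then have many: "m < card {w. W.normal w \<and> length w = m}" if "m \<ge> 1" for m
    using that by (meson not_le)
  show False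
  proof (rule no_cubic_growth[OF GK, of "Suc g" "x(g := y)"])
    show "(x(g := y)) i \<in> carrier R" if "i < Suc g" for i
      using that y W.x_carrier by (auto simp: less_Suc_eq)
    fix n :: nat
    let ?J = "W.normals n \<times> {..<n}" and ?b = "\<lambda>(w, s). word_prod x w \<otimes> y [^] (s :: nat)"
    show "\<exists>(J :: (nat list \<times> nat) set) b. finite J \<and> lin_indep scalars {\<zero>} J b \<and>
      b ` J \<subseteq> word_prod (x(g := y)) ` short_words (Suc g) (2 * n) \<and> n ^ 3 \<le> 2 * card J"
    proof (intro exI conjI)
      show "finite ?J" using W.finite_normals by simp
      show "lin_indep scalars {\<zero>} ?J ?b" by (rule ind)
      show "?b ` ?J \<subseteq> word_prod (x(g := y)) ` short_words (Suc g) (2 * n)"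
      proof safe
        fix w :: "nat list" and s assume w: "w \<in> W.normals n" and s: "s < n"
        have lw: "set w \<subseteq> {..<g}" "length w \<le> n" using W.normals_subset w by (auto simp: short_words_def)
        have "word_prod x w \<otimes> y [^] s = word_prod (x(g := y)) (w @ replicate s g)"
          using word_prod_power_letter[OF lw(1) W.x_carrier y] by simp
        moreover have "w @ replicate s g \<in> short_words (Suc g) (2 * n)"
          using lw s by (auto simp: short_words_def)
        ultimately show "word_prod x w \<otimes> y [^] s \<in> word_prod (x(g := y)) ` short_words (Suc g) (2 * n)" by blast
      qed
      have "n ^ 3 = n ^ 2 * n" by (simp add: power3_eq_cube power2_eq_square)
      also have "\<dots> \<le> 2 * card (W.normals n) * n" using W.normals_quadratic[OF many] by simp
      finally show "n ^ 3 \<le> 2 * card ?J" by (simp add: card_cartesian_product)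
    qed
  qed
qed

text \<open>A relation has the form Y 0 + Q y = 0 with y in I. Modulo I the coefficients in Y 0
  vanish; then Q y = 0, y cancels, and Q = 0 is a relation with fewer powers.\<close>

lemma regular_powers_indep:
  assumes tc: "torsion_closed R scalars I" and I: "ideal I R" and J: "finite J" "\<And>j. j \<in> J \<Longrightarrow> b j \<in> carrier R"
    and ind: "lin_indep scalars I J b"
    and y: "y \<in> I" "\<And>m. m \<in> carrier R \<Longrightarrow> m \<otimes> y = \<zero> \<Longrightarrow> m = \<zero>"
  shows "lin_indep scalars {\<zero>} (J \<times> {..<n}) (\<lambda>(j, s). b j \<otimes> y [^] (s :: nat))"
proof -
  interpret T: torsion_closed R scalars I by (rule tc)
  interpret I: ideal I R by (rule I)
  have yc: "y \<in> carrier R" using y(1) by simp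
  have main: "(\<forall>j \<in> J. \<forall>s < n. c (j, s) \<in> scalars) \<Longrightarrow>
    finsum R (\<lambda>s. finsum R (\<lambda>j. b j \<otimes> c (j, s)) J \<otimes> y [^] s) {..<n} = \<zero> \<Longrightarrow> \<forall>j \<in> J. \<forall>s < n. c (j, s) = \<zero>" for c
  proof (induction n arbitrary: c)
    case (Suc n)
    define Y where "Y s = finsum R (\<lambda>j. b j \<otimes> c (j, s)) J" for s
    have cK: "c (j, s) \<in> scalars" if "j \<in> J" "s < Suc n" for j s using Suc.prems(1) that by blast
    have Y: "Y s \<in> carrier R" if "s < Suc n" for s unfolding Y_def using J cK that by (intro finsum_closed) auto
    define Q where "Q = finsum R (\<lambda>s. Y (Suc s) \<otimes> y [^] s) {..<n}"
    have Qc: "Q \<in> carrier R" unfolding Q_def using Y yc by (intro finsum_closed) auto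
    have "finsum R (\<lambda>s. Y s \<otimes> y [^] s) {..<Suc n} = finsum R (\<lambda>s. Y s \<otimes> y [^] s) (insert 0 (Suc ` {..<n}))"
      by (simp add: lessThan_Suc_eq_insert_0)
    also have "\<dots> = Y 0 \<otimes> y [^] (0 :: nat) \<oplus> finsum R (\<lambda>s. Y s \<otimes> y [^] s) (Suc ` {..<n})"
      using Y yc by (intro finsum_insert) auto
    also have "finsum R (\<lambda>s. Y s \<otimes> y [^] s) (Suc ` {..<n}) = finsum R (\<lambda>s. Y (Suc s) \<otimes> y [^] Suc s) {..<n}"
      using Y yc by (intro finsum_reindex) auto
    also have "\<dots> = finsum R (\<lambda>s. Y (Suc s) \<otimes> y [^] s \<otimes> y) {..<n}"
      using Y yc by (intro finsum_cong') (auto simp: m_assoc)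
    also have "\<dots> = Q \<otimes> y" unfolding Q_def using Y yc by (intro finsum_ldistr[symmetric]) auto
    finally have sum: "finsum R (\<lambda>s. Y s \<otimes> y [^] s) {..<Suc n} = Y 0 \<oplus> Q \<otimes> y" using Y[of 0] by simp
    have "finsum R (\<lambda>s. Y s \<otimes> y [^] s) {..<Suc n} = \<zero>" unfolding Y_def by (rule Suc.prems(2))
    then have zero: "Y 0 \<oplus> Q \<otimes> y = \<zero>" unfolding sum .
    then have "Y 0 = \<ominus> (Q \<otimes> y)" using Y[of 0] Qc yc by (metis m_closed minus_equality zero_less_Suc)
    moreover have "Q \<otimes> y \<in> I" by (rule I.I_l_closed[OF y(1) Qc])
    ultimately have "Y 0 \<in> I" by simp
    then have Y0: "finsum R (\<lambda>j. b j \<otimes> c (j, 0)) J \<in> I" by (simp add: Y_def)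
    have c0: "c (j, 0) = \<zero>" if j: "j \<in> J" for j
      by (rule T.indepD[OF ind _ Y0 j]) (use cK in blast)
    have "Y 0 = finsum R (\<lambda>j. \<zero>) J" unfolding Y_def using c0 J by (intro finsum_cong') auto
    then have "Q \<otimes> y = \<zero>" using zero Qc yc by simp
    then have Q0: "Q = \<zero>" by (rule y(2)[OF Qc])
    have IH: "\<forall>j \<in> J. \<forall>s < n. (\<lambda>(j, s). c (j, Suc s)) (j, s) = \<zero>"
    proof (rule Suc.IH)
      show "\<forall>j \<in> J. \<forall>s < n. (\<lambda>(j, s). c (j, Suc s)) (j, s) \<in> scalars" using cK by auto
      show "finsum R (\<lambda>s. finsum R (\<lambda>j. b j \<otimes> (\<lambda>(j, s). c (j, Suc s)) (j, s)) J \<otimes> y [^] s) {..<n} = \<zero>"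
        using Q0 by (simp add: Q_def Y_def)
    qed
    show ?case
    proof (intro ballI allI impI)
      fix j s assume "j \<in> J" "s < Suc n"
      then show "c (j, s) = \<zero>" using c0 IH by (cases s) auto
    qed
  qed simp
  show ?thesis
    unfolding lin_indep_def
  proof (intro allI impI)
    fix c assume c: "\<forall>p \<in> J \<times> {..<n}. c p \<in> scalars"
      and s: "finsum R (\<lambda>p. (case p of (j, s) \<Rightarrow> b j \<otimes> y [^] s) \<otimes> c p) (J \<times> {..<n}) \<in> {\<zero>}"
    have cK: "c (j, s) \<in> scalars" if "j \<in> J" "s < n" for j s using c that by auto
    have eq: "b j \<otimes> y [^] s \<otimes> c (j, s) = b j \<otimes> c (j, s) \<otimes> y [^] s" if "j \<in> J" "s < n" for j s
      using scalars_comm[OF cK[OF that], of "y [^] s"] cK[OF that] J(2)[OF that(1)] yc by (simp add: m_assoc)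
    have "finsum R (\<lambda>p. (case p of (j, s) \<Rightarrow> b j \<otimes> y [^] s) \<otimes> c p) (J \<times> {..<n})
        = finsum R (\<lambda>(j, s). b j \<otimes> c (j, s) \<otimes> y [^] s) (J \<times> {..<n})"
      using eq J(2) cK yc by (intro finsum_cong') auto
    also have "\<dots> = finsum R (\<lambda>j. finsum R (\<lambda>s. b j \<otimes> c (j, s) \<otimes> y [^] s) {..<n}) J"
      using J cK yc by (intro finsum_Sigma) auto
    also have "\<dots> = finsum R (\<lambda>s. finsum R (\<lambda>j. b j \<otimes> c (j, s) \<otimes> y [^] s) J) {..<n}"
      using J cK yc by (intro finsum_swap) auto
    also have "\<dots> = finsum R (\<lambda>s. finsum R (\<lambda>j. b j \<otimes> c (j, s)) J \<otimes> y [^] s) {..<n}"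
    proof (rule finsum_cong'[OF refl])
      fix s assume "s \<in> {..<n}"
      then show "finsum R (\<lambda>j. b j \<otimes> c (j, s) \<otimes> y [^] s) J = finsum R (\<lambda>j. b j \<otimes> c (j, s)) J \<otimes> y [^] s"
        using J cK yc by (intro finsum_ldistr[symmetric]) auto
    qed (use J cK yc in \<open>auto intro!: finsum_closed\<close>)
    finally have "finsum R (\<lambda>s. finsum R (\<lambda>j. b j \<otimes> c (j, s)) J \<otimes> y [^] s) {..<n} = \<zero>" using s by simp
    from main[OF _ this] cK show "\<forall>p \<in> J \<times> {..<n}. c p = \<zero>" by auto
  qed
qed

lemma PI_of_finite_rank:
  assumes tc: "torsion_closed R E T"
    and left: "\<And>a t. a \<in> carrier R \<Longrightarrow> t \<in> T \<Longrightarrow> a \<otimes> t \<in> T"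
    and faithful: "\<And>a. a \<in> carrier R \<Longrightarrow> (\<And>m. m \<in> carrier R \<Longrightarrow> a \<otimes> m \<in> T) \<Longrightarrow> a = \<zero>"
    and bound: "\<And>J. finite J \<Longrightarrow> J \<subseteq> carrier R \<Longrightarrow> lin_indep E T J id \<Longrightarrow> card J \<le> r"
  shows "PI_algebra"
proof -
  interpret T: torsion_closed R E T by (rule tc)
  have "\<exists>B. finite B \<and> B \<subseteq> carrier R \<and> T.cl B id = carrier R"
    by (rule T.finite_basis) (rule bound)
  then obtain B where B: "finite B" "B \<subseteq> carrier R" "T.cl B id = carrier R" by (elim exE conjE)
  show ?thesis
  proof (rule PI_algebraI[OF nonzero])
    fix a assume a: "\<And>i :: nat. a i \<in> carrier R"
    show "standard_poly (Suc (card B * card B)) a = \<zero>"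
    proof (rule T.standard_poly_vanishes[OF _ _ B])
      show "card B * card B < Suc (card B * card B)" by (rule lessI)
    qed ((fact left faithful)+, rule a)
  qed
qed

text \<open>In a relation of least degree the constant term is nonzero, since otherwise the regular
  element z could be cancelled. As \<open>h\<close> lies in k[z], inverses are available in every
  subring containing k and z.\<close>

lemma algebraic_central_inverse:
  assumes prime: "prime_ring R" and z: "z \<in> ring_center R" "z \<noteq> \<zero>" and alg: "algebraic_elem scalars z"
  shows "\<exists>h \<in> adjoin scalars z. \<exists>a \<in> scalars - {\<zero>}. z \<otimes> h = a"
proof -
  interpret S: simple_ext R scalars z
    by (rule simple_ext_of_center[OF subfieldE(1)[OF scalars_subfield] scalars_sub_center center_carrier[OF z(1)]])
  have zc: "z \<in> carrier R" using center_carrier z by blast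
  have zs: "z [^] Suc n \<otimes> c = z \<otimes> (z [^] n \<otimes> c)" if "c \<in> scalars" for n c
    unfolding nat_pow_Suc2[OF zc] using that zc by (simp add: m_assoc)
  \<comment> \<open>Splits off the constant term: \<open>S.P (Suc n)\<close> means degree at most n,
    so the cofactor of z has degree below n.\<close>
  have horner: "f \<in> S.P (Suc n) \<Longrightarrow> \<exists>a \<in> scalars. \<exists>h \<in> S.P n. f = a \<oplus> z \<otimes> h" for n f
  proof (induction n arbitrary: f)
    case 0
    then show ?case using zc by auto
  next
    case (Suc n)
    from Suc.prems obtain f' c where f: "f' \<in> S.P (Suc n)" "c \<in> scalars" "f = f' \<oplus> z [^] Suc n \<otimes> c" by (rule S.P_SucE)
    from Suc.IH[OF f(1)] obtain a h where ah: "a \<in> scalars" "h \<in> S.P n" "f' = a \<oplus> z \<otimes> h" by blast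
    have "f = a \<oplus> z \<otimes> (h \<oplus> z [^] n \<otimes> c)"
      using f(2) ah(1) zc S.P_closed[OF ah(2)] unfolding f(3) ah(3) zs[OF f(2)]
      by (simp add: r_distr a_assoc)
    moreover have "h \<oplus> z [^] n \<otimes> c \<in> S.P (Suc n)" by (rule S.P_SucI[OF ah(2) f(2)])
    ultimately show ?case using ah(1) by blast
  qed
  define Q where "Q n \<longleftrightarrow> (\<exists>f \<in> S.P n. \<exists>c \<in> scalars - {\<zero>}. f \<oplus> z [^] n \<otimes> c = \<zero>)" for n
  have exQ: "\<exists>n. Q n" using alg unfolding algebraic_elem_def Q_def .
  define n where "n = (LEAST n. Q n)"
  have Qn: "Q n" unfolding n_def by (rule LeastI_ex[OF exQ])
  have min: "\<not> Q m" if "m < n" for m using that not_less_Least unfolding n_def by blast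
  from Qn obtain f c where f: "f \<in> S.P n" "c \<in> scalars" "c \<noteq> \<zero>" "f \<oplus> z [^] n \<otimes> c = \<zero>" unfolding Q_def by blast
  have "n \<noteq> 0"
  proof
    assume "n = 0"
    then show False using f by simp
  qed
  then obtain m where m: "n = Suc m" using not0_implies_Suc by blast
  from horner[of f m] f(1) m obtain a h where ah: "a \<in> scalars" "h \<in> S.P m" "f = a \<oplus> z \<otimes> h" by blast
  define q where "q = h \<oplus> z [^] m \<otimes> c"
  have q: "q \<in> S.P (Suc m)" unfolding q_def by (rule S.P_SucI[OF ah(2) f(2)])
  have qc: "q \<in> carrier R" by (rule S.P_closed[OF q])
  have "f \<oplus> z [^] n \<otimes> c = a \<oplus> z \<otimes> q"
    unfolding q_def m ah(3) zs[OF f(2)] using f(2) ah(1) zc S.P_closed[OF ah(2)]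
    by (simp add: r_distr a_assoc)
  then have rel: "a \<oplus> z \<otimes> q = \<zero>" using f(4) by simp
  have "a \<noteq> \<zero>"
  proof
    assume "a = \<zero>"
    then have "z \<otimes> q = \<zero>" using rel zc qc by simp
    then have "q \<otimes> z = \<zero>" using center_comm[OF z(1) qc] by simp
    then have "q = \<zero>" by (rule prime_ring_central_regular[OF prime z qc])
    then have "Q m" unfolding Q_def q_def using ah(2) f(2,3) by blast
    then show False using min[of m] m by simp
  qed
  moreover have "z \<otimes> (\<ominus> q) = a"
    using rel zc qc ah(1) by (metis minus_equality minus_minus m_closed r_minus scalars_carrier)
  moreover have "\<ominus> q \<in> adjoin scalars z"
    using subringE(5)[OF S.adjoin_subring] S.adjoinI[OF q] by blast
  ultimately show ?thesis using ah(1) by blast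
qed

end

context nonzero_algebra
begin

lemma central_words_of_center:
  assumes tc: "torsion_closed R D I" and D: "D \<subseteq> ring_center R" and I: "ideal I R"
    and x: "\<And>i. x i \<in> carrier R"
  shows "central_words R D I x g"
proof (intro central_words.intro tc central_words_axioms.intro I x)
  show "d \<otimes> a = a \<otimes> d" if "d \<in> D" "a \<in> carrier R" for d a
    using center_comm[of d a] D that by blast
qed

text \<open>Compares the slopes in n of the two sides.\<close>

lemma rank_bound_arith:
  fixes c C l a :: nat
  assumes "\<And>n. c * n \<le> C * (l + a * n + 1)"
  shows "c \<le> C * a"
proof (rule ccontr)
  assume "\<not> c \<le> C * a"
  then have "Suc (C * a) \<le> c" by simp
  \<comment> \<open>One more than the constant term of the right-hand side, so a larger slope on the
    left already wins here.\<close>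
  let ?n = "C * (l + 1) + 1"
  have "Suc (C * a) * ?n \<le> c * ?n" using \<open>Suc (C * a) \<le> c\<close> by (intro mult_right_mono) auto
  also have "\<dots> \<le> C * (l + a * ?n + 1)" by (rule assms)
  also have "\<dots> = C * (l + 1) + (C * a) * ?n" by (simp add: algebra_simps)
  finally show False by simp
qed

text \<open>The powers of one word transcendental over D already account for the whole linear order
  of growth, which leaves only a finite rank, at most C M, over D[p].\<close>

lemma PI_of_transcendental_word:
  assumes cw: "central_words R D {\<zero>} x g" and prime: "prime_ring R" and acc: "acc_left_annihilators R"
    and span: "\<And>m. m \<in> carrier R \<Longrightarrow> \<exists>N. m \<in> word_span scalars x g N"
    and DZ: "D \<subseteq> ring_center R" and kD: "scalars \<subseteq> D"
    and growth: "\<And>N. card (central_words.normals R D {\<zero>} x g N) \<le> C * (N + 1)"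
    and x: "\<And>i. x i \<in> carrier R"
    and p: "p \<in> short_words g M" and tr: "\<not> algebraic_elem D (word_prod x p)"
  shows "PI_algebra"
proof -
  interpret W: central_words R D "{\<zero>}" x g by (rule cw)
  define P where "P = word_prod x p"
  have plet: "set p \<subseteq> {..<g}" "length p \<le> M" using p by (auto simp: short_words_def)
  have Pc: "P \<in> carrier R" using plet by (simp add: P_def)
  interpret S: simple_ext R D P by (rule simple_ext_of_center[OF W.E_subring DZ Pc])
  have tr: "\<not> algebraic_elem D P" using tr by (simp add: P_def)
  define E where "E = adjoin D P"
  have Ec: "e \<in> carrier R" if "e \<in> E" for e using S.adjoin_closed that by (simp add: E_def)
  have Eint: "e = \<zero> \<or> f = \<zero>" if "e \<in> E" "f \<in> E" "e \<otimes> f = \<zero>" for e f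
    using S.adjoin_integral[OF tr W.E_integral] that unfolding E_def by blast
  have Emult: "e \<otimes> f \<in> E" if "e \<in> E" "f \<in> E" for e f
    using subringE(6)[OF S.adjoin_subring] that unfolding E_def by blast
  have Ecomm: "e \<otimes> f = f \<otimes> e" if "e \<in> E" "f \<in> E" for e f
    using S.adjoin_comm that unfolding E_def by blast
  have one: "\<one> \<in> E" "\<one> \<noteq> \<zero>" using subringE(3)[OF S.adjoin_subring] W.one_not_zero' by (auto simp: E_def)
  \<comment> \<open>the torsion submodule is the annihilator of a single denominator, by the chain condition\<close>
  have "\<exists>A \<in> {lann e | e. e \<in> E - {\<zero>}}. \<forall>B \<in> {lann e | e. e \<in> E - {\<zero>}}. A \<subseteq> B \<longrightarrow> B = A"
  proof (rule acc_maximal[OF acc])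
    show "{lann e | e. e \<in> E - {\<zero>}} \<noteq> {}" using one by blast
    fix A assume "A \<in> {lann e | e. e \<in> E - {\<zero>}}"
    then obtain e where "A = lann e" "e \<in> E" by blast
    then show "\<exists>S \<subseteq> carrier R. A = left_annihilator R S" using Ec by (intro exI[of _ "{e}"]) simp
  qed
  then obtain A where A: "A \<in> {lann e | e. e \<in> E - {\<zero>}}"
    "\<forall>B \<in> {lann e | e. e \<in> E - {\<zero>}}. A \<subseteq> B \<longrightarrow> B = A" by (elim bexE)
  from A(1) obtain e0 where e0: "e0 \<in> E" "e0 \<noteq> \<zero>" "A = lann e0" by blast
  \<comment> \<open>If m e = 0, then m is killed by e e0 = e0 e, whose left annihilator is that of
    e0 by maximality.\<close>
  have max: "m \<otimes> e0 = \<zero>" if m: "m \<in> carrier R" "e \<in> E" "e \<noteq> \<zero>" "m \<otimes> e = \<zero>" for m e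
  proof -
    have "e0 \<otimes> e \<in> E - {\<zero>}" using Emult Eint e0 m by blast
    then have "lann (e0 \<otimes> e) \<in> {lann e | e. e \<in> E - {\<zero>}}" by blast
    moreover have "A \<subseteq> lann (e0 \<otimes> e)" unfolding e0(3) by (rule lann_mult) (use Ec e0 m in auto)
    ultimately have "lann (e0 \<otimes> e) = lann e0" using A(2) e0(3) by blast
    moreover have "m \<in> lann (e \<otimes> e0)" using m Ec e0(1) by (simp add: lann_iff m_assoc[symmetric])
    ultimately have "m \<in> lann e0" using Ecomm[OF m(2) e0(1)] by simp
    then show ?thesis by (simp add: lann_iff)
  qed
  define T where "T = lann e0"
  have T: "m \<in> T \<longleftrightarrow> m \<in> carrier R \<and> m \<otimes> e0 = \<zero>" for m by (simp add: T_def lann_iff)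
  have e0c: "e0 \<in> carrier R" using Ec e0 by blast
  have tc: "torsion_closed R E T"
  proof (intro torsion_closed.intro ring_axioms torsion_closed_axioms.intro)
    show "subring E R" unfolding E_def by (rule S.adjoin_subring)
    show "e \<otimes> f = f \<otimes> e" if "e \<in> E" "f \<in> E" for e f using Ecomm that .
    show "additive_subgroup T R"
    proof (rule additive_subgroup.intro, rule add.subgroupI)
      have "\<zero> \<in> T" using e0c by (simp add: T)
      then show "T \<noteq> {}" by blast
    qed (use e0c in \<open>auto simp: T l_distr l_minus\<close>)
    show "t \<otimes> e \<in> T" if t: "t \<in> T" "e \<in> E" for t e
    proof -
      have tc: "t \<in> carrier R" "t \<otimes> e0 = \<zero>" using t(1) by (auto simp: T)
      have "t \<otimes> e \<otimes> e0 = t \<otimes> e0 \<otimes> e" using tc(1) Ec t(2) e0(1) Ecomm[OF t(2) e0(1)] by (simp add: m_assoc)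
      then show ?thesis using tc Ec t(2) by (simp add: T)
    qed
    show "m \<in> T" if m: "m \<in> carrier R" "e \<in> E" "e \<noteq> \<zero>" "m \<otimes> e \<in> T" for m e
    proof -
      have "m \<otimes> (e \<otimes> e0) = \<zero>" using m Ec e0c by (simp add: T m_assoc)
      moreover have "e \<otimes> e0 \<in> E" "e \<otimes> e0 \<noteq> \<zero>" using Emult Eint e0 m by blast+
      ultimately have "m \<otimes> e0 = \<zero>" using max[OF m(1)] by blast
      then show ?thesis using m(1) by (simp add: T)
    qed
    have "\<one> \<notin> T" using e0 e0c by (simp add: T)
    then show "T \<noteq> carrier R" by blast
  qed
  interpret T: torsion_closed R E T by (rule tc)
  show ?thesis
  proof (rule PI_of_finite_rank[OF tc])
    show "a \<otimes> t \<in> T" if "a \<in> carrier R" "t \<in> T" for a t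
      using that e0c by (simp add: T m_assoc)
    show "a = \<zero>" if a: "a \<in> carrier R" "\<And>m. m \<in> carrier R \<Longrightarrow> a \<otimes> m \<in> T" for a
    proof -
      have "a \<otimes> m \<otimes> e0 = \<zero>" if "m \<in> carrier R" for m using a(2)[OF that] by (simp add: T)
      then have "a = \<zero> \<or> e0 = \<zero>" by (rule prime_ring_elementwise[OF prime a(1) e0c])
      then show ?thesis using e0(2) by blast
    qed
    fix J assume J: "finite J" "J \<subseteq> carrier R" "lin_indep E T J id"
    have "\<exists>l. \<forall>j \<in> J. j \<in> word_span scalars x g l"
      by (rule W.word_span_common[OF _ J(1,2)]) (fact span, rule word_span_mono)
    then obtain l where l: "\<forall>j \<in> J. j \<in> word_span scalars x g l" by blast
    show "card J \<le> C * M"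
    proof (rule rank_bound_arith[where l = l])
      fix n :: nat
      let ?K = "J \<times> {..<n}" and ?b = "\<lambda>(j, s). id j \<otimes> P [^] (s :: nat)"
      have idc: "id j \<in> carrier R" if "j \<in> J" for j using that J(2) by auto
      have "lin_indep D T ?K ?b"
      proof (rule T.tower[OF _ W.E_subring J(1) idc finite_lessThan _ S.powers_indep[OF tr] J(3)])
        show "D \<subseteq> E" using S.D_sub_adjoin by (auto simp: E_def)
        show "P [^] s \<in> E" for s :: nat using S.p_power_adjoin by (simp add: E_def)
      qed
      \<comment> \<open>Independence modulo T is the stronger property, whereas the normal words
        bound ranks modulo 0.\<close>
      then have ind: "lin_indep D {\<zero>} ?K ?b"
        by (rule lin_indep_mono) (use T.T.zero_closed in blast)
      have "card ?K \<le> card (W.normals (l + M * n))"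
      proof (rule W.rank_le_card_normals[OF _ ind kD])
        show "finite ?K" using J(1) by simp
        fix q assume "q \<in> ?K"
        then obtain j s where q: "q = (j, s)" "j \<in> J" "s < n" by blast
        let ?w = "concat (replicate s p)"
        have "?w \<in> short_words g (s * length p)" using plet(1) by (auto simp: short_words_def length_concat sum_list_replicate)
        moreover have wp: "word_prod x ?w = P [^] s" unfolding P_def by (rule word_prod_replicate) (rule x)
        ultimately have "P [^] s \<otimes> \<one> \<in> word_span scalars x g (s * length p)"
          using scalar_word[of \<one> ?w g "s * length p" x] Pc by auto
        then have "P [^] s \<in> word_span scalars x g (s * length p)" using Pc by simp
        then have "j \<otimes> P [^] s \<in> word_span scalars x g (l + s * length p)"
          using l q(2) x by (intro word_span_mult) auto
        moreover have "s * length p \<le> M * n" using q(3) plet(2) by (simp add: mult.commute[of M] mult_mono)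
        ultimately have "j \<otimes> P [^] s \<in> word_span scalars x g (l + M * n)"
          by (rule word_span_mono[OF _ add_left_mono])
        then show "?b q \<in> word_span scalars x g (l + M * n)" using q(1) by simp
      qed
      also have "\<dots> \<le> C * (l + M * n + 1)" by (rule growth)
      finally show "card J * n \<le> C * (l + M * n + 1)" by (simp add: card_cartesian_product)
    qed
  qed
qed

text \<open>When all short words are algebraic over D, their high powers are not normal. This bounds
  the exponent in u p^k v, so only finitely many words are normal and R has finite rank over
  D.\<close>

lemma PI_of_transcendental_center:
  assumes prime: "prime_ring R" and acc: "acc_left_annihilators R" and GK: "GKdim < 3" and aff: "affine"
    and z: "z \<in> ring_center R" and tr: "\<not> algebraic_elem scalars z"
  shows "PI_algebra"
proof -
  obtain x g where x: "\<And>i. x i \<in> carrier R" and span: "\<And>m. m \<in> carrier R \<Longrightarrow> \<exists>N. m \<in> word_span scalars x g N"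
    by (rule affine_words[OF aff]) (rule that)
  have k: "subring scalars R" using subfieldE(1)[OF scalars_subfield] .
  have zc: "z \<in> carrier R" using center_carrier z by blast
  interpret S: simple_ext R scalars z by (rule simple_ext_of_center[OF k scalars_sub_center zc])
  define D where "D = adjoin scalars z"
  have D: "subring D R" "D \<subseteq> ring_center R" "scalars \<subseteq> D"
    using S.adjoin_subring adjoin_sub_center[OF k scalars_sub_center z] S.D_sub_adjoin by (auto simp: D_def)
  have cw: "central_words R D {\<zero>} x g"
    by (rule central_words_of_center[OF prime_central_torsion_closed[OF prime D(1,2)] D(2) zeroideal x])
  interpret W: central_words R D "{\<zero>}" x g by (rule cw)
  have "\<exists>n \<ge> 1. card {w. W.normal w \<and> length w = n} \<le> n"
  proof (rule gap_exists[OF cw GK zc])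
    fix n :: nat
    show "lin_indep scalars {\<zero>} (W.normals n \<times> {..<n}) (\<lambda>(w, s). word_prod x w \<otimes> z [^] (s :: nat))"
    proof (rule W.tower[OF D(3) k W.finite_normals W.normals_closed finite_lessThan _ S.powers_indep[OF tr]])
      show "z [^] s \<in> D" for s :: nat using S.p_power_adjoin by (simp add: D_def)
      show "W.indep (W.normals n) (word_prod x)"
        by (rule W.normal_indep[OF W.finite_normals]) (simp add: W.normals_def)
    qed
  qed
  then obtain n where n: "n \<ge> 1" "card {w. W.normal w \<and> length w = n} \<le> n" by blast
  from W.normals_linear_growth[OF n] obtain C where C: "\<And>N. card (W.normals N) \<le> C * (N + 1)" by blast
  show ?thesis
  proof (cases "\<exists>p \<in> short_words g (2 * n). \<not> algebraic_elem D (word_prod x p)")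
    case True
    then obtain p where p: "p \<in> short_words g (2 * n)" "\<not> algebraic_elem D (word_prod x p)" by blast
    show ?thesis
      by (rule PI_of_transcendental_word[OF cw prime acc span D(2,3) C x p])
  next
    case False
    \<comment> \<open>The empty word is excluded because its powers are all the empty word; as a
      period it adds no length.\<close>
    have "\<forall>p \<in> short_words g (2 * n). \<exists>e. p \<noteq> [] \<longrightarrow> \<not> W.normal (concat (replicate e p))"
      using W.algebraic_power_not_normal False by (auto simp: short_words_def)
    then obtain e where e: "\<forall>p \<in> short_words g (2 * n). p \<noteq> [] \<longrightarrow> \<not> W.normal (concat (replicate (e p) p))"
      by (elim bchoice[THEN exE])
    define L where "L = Max (e ` short_words g (2 * n))"
    have L: "e p \<le> L" if "p \<in> short_words g (2 * n)" for p
      unfolding L_def using that finite_short_words by (intro Max_ge) auto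
    \<comment> \<open>The summands bound the lengths of u, p^k and v.\<close>
    define M where "M = 2 * n + L * (2 * n) + 2 * n"
    have short: "length w \<le> M" if w: "W.normal w" for w
    proof -
      obtain u p v k where *: "u \<in> short_words g (2 * n)" "p \<in> short_words g (2 * n)" "v \<in> short_words g (2 * n)"
        "w = u @ concat (replicate k p) @ v" using W.normal_periodic[OF n w] by blast
      have "length (concat (replicate k p)) \<le> L * (2 * n)"
      proof (cases "p = []")
        case False
        have "k < e p"
        proof (rule ccontr)
          assume "\<not> k < e p"
          then have "k = e p + (k - e p)" by simp
          then have "concat (replicate k p) = concat (replicate (e p) p) @ concat (replicate (k - e p) p)"
            by (metis concat_append replicate_add)
          then have "w = u @ concat (replicate (e p) p) @ (concat (replicate (k - e p) p) @ v)" using *(4) by simp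
          then have "W.normal (concat (replicate (e p) p))" using W.normal_factor w by metis
          then show False using e *(2) False by blast
        qed
        then have "k \<le> L" using L[OF *(2)] by simp
        moreover have "length p \<le> 2 * n" using *(2) by (simp add: short_words_def)
        ultimately have "k * length p \<le> L * (2 * n)" by (rule mult_le_mono)
        then show ?thesis by (simp add: length_concat sum_list_replicate)
      qed simp
      then show ?thesis using *(1,3,4) by (simp add: M_def short_words_def)
    qed
    show ?thesis
    proof (rule PI_of_finite_rank[OF W.torsion_closed_axioms])
      show "a \<otimes> t \<in> {\<zero>}" if "a \<in> carrier R" "t \<in> {\<zero>}" for a t using that by simp
      show "a = \<zero>" if "a \<in> carrier R" "\<And>m. m \<in> carrier R \<Longrightarrow> a \<otimes> m \<in> {\<zero>}" for a
        using that(2)[of \<one>] that(1) by simp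
      fix J assume J: "finite J" "J \<subseteq> carrier R" "W.indep J id"
      have "\<exists>l. \<forall>j \<in> J. j \<in> word_span scalars x g l"
        by (rule W.word_span_common[OF _ J(1,2)]) (fact span, rule word_span_mono)
      then obtain l where l: "\<forall>j \<in> J. j \<in> word_span scalars x g l" by blast
      have "card J \<le> card (W.normals l)"
        by (rule W.rank_le_card_normals[OF J(1,3) D(3)]) (use l in simp)
      also have "\<dots> \<le> card (W.normals M)"
        by (rule card_mono[OF W.finite_normals]) (use short in \<open>auto simp: W.normals_def\<close>)
      finally show "card J \<le> card (W.normals M)" .
    qed
  qed
qed

text \<open>Adjoin the elements of J one at a time. If B spans F and z satisfies a relation of
  degree n over k, the products b z^i with i < n span F[z]. The relation has coefficients in k, so
  its leading coefficient can be cancelled in a closure over k.\<close>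

lemma algebraic_subring:
  assumes alg: "\<And>z. z \<in> ring_center R \<Longrightarrow> algebraic_elem scalars z"
    and J: "finite J" "J \<subseteq> ring_center R"
  shows "\<exists>F B. subring F R \<and> scalars \<subseteq> F \<and> F \<subseteq> ring_center R \<and> J \<subseteq> F \<and>
    finite B \<and> B \<subseteq> F \<and> F \<subseteq> k.cl B id"
  using J
proof (induction J rule: finite_induct)
  case empty
  have k: "subring scalars R" using subfieldE(1)[OF scalars_subfield] .
  have "scalars \<subseteq> k.cl {\<one>} id"
  proof
    fix c assume c: "c \<in> scalars"
    have "id \<one> \<otimes> c \<in> k.cl {\<one>} id"
      by (rule k.cl_mult[OF k.cl_incl c]) auto
    then show "c \<in> k.cl {\<one>} id" using c by simp
  qed
  moreover have "finite {\<one>}" "{\<one>} \<subseteq> scalars" "{} \<subseteq> scalars" by auto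
  ultimately show ?case using k scalars_sub_center by blast
next
  case (insert z J)
  then obtain F B where F: "subring F R" "scalars \<subseteq> F" "F \<subseteq> ring_center R" "J \<subseteq> F"
    and B: "finite B" "B \<subseteq> F" "F \<subseteq> k.cl B id" by blast
  define \<iota> where "\<iota> = (id :: 'a \<Rightarrow> 'a)"
  have \<iota>: "\<iota> a = a" for a by (simp add: \<iota>_def)
  note B = B(1,2) B(3)[folded \<iota>_def]
  have z: "z \<in> ring_center R" and zc: "z \<in> carrier R" using insert.prems center_carrier by auto
  have Fc: "f \<in> carrier R" if "f \<in> F" for f using F(3) center_carrier that by blast
  have Bc: "b \<in> carrier R" if "b \<in> B" for b using B(2) Fc that by blast
  interpret S: simple_ext R F z by (rule simple_ext_of_center[OF F(1,3) zc])
  obtain n h c where h: "h \<in> polys_below scalars z n" "c \<in> scalars" "c \<noteq> \<zero>" "h \<oplus> z [^] n \<otimes> c = \<zero>"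
    using alg[OF z] unfolding algebraic_elem_def by blast
  define B' where "B' = (\<lambda>(b, i). b \<otimes> z [^] (i :: nat)) ` (B \<times> {..<n})"
  have B': "finite B'" "B' \<subseteq> carrier R" using B(1) Bc zc by (auto simp: B'_def)
  have B'F: "B' \<subseteq> adjoin F z"
  proof
    fix y assume "y \<in> B'"
    then obtain b i where "b \<in> B" "y = b \<otimes> z [^] (i :: nat)" by (auto simp: B'_def)
    then show "y \<in> adjoin F z"
      using subringE(6)[OF S.adjoin_subring S.D_sub_adjoin S.p_power_adjoin] B(2) by blast
  qed
  have idB': "\<iota> b \<in> carrier R" if "b \<in> B'" for b using that B' by (auto simp: \<iota>)
  let ?C = "k.cl B' \<iota>"
  interpret C: additive_subgroup ?C R by (rule k.cl_subgroup[where b = \<iota>, OF B'(1) idB'])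
  \<comment> \<open>Strong induction on the exponent: from n on, the relation multiplied by z^(i -
    n) expresses z^i through lower powers.\<close>
  have power: "\<forall>f \<in> F. z [^] i \<otimes> f \<in> ?C" for i :: nat
  proof (induction i rule: less_induct)
    case (less i)
    show ?case
    proof (cases "i < n")
      case True
      show ?thesis
      proof
        fix f assume "f \<in> F"
        then have f: "f \<in> k.cl B \<iota>" using B(3) by blast
        show "z [^] i \<otimes> f \<in> ?C"
        proof (rule k.cl_map_cl[where f = "\<lambda>f. z [^] i \<otimes> f" and \<beta> = \<iota> and b = \<iota>, OF B'(1) idB' _ _ _ _ _ _ f])
          fix b assume b: "b \<in> B"
          have "b \<otimes> z [^] i \<in> B'" using b True by (auto simp: B'_def)
          then have "b \<otimes> z [^] i \<in> ?C" using k.cl_incl[where b = \<iota>, OF B'(1) idB', of "b \<otimes> z [^] i"] by (simp add: \<iota>)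
          moreover have "b \<otimes> z [^] i = z [^] i \<otimes> b" using center_comm[of b "z [^] i"] b B(2) F(3) zc by blast
          ultimately show "z [^] i \<otimes> \<iota> b \<in> ?C" by (simp add: \<iota>)
        qed (use zc C.zero_closed Bc in \<open>auto simp: r_distr m_assoc \<iota>\<close>)
      qed
    next
      case False
      show ?thesis
      proof
        fix f assume f: "f \<in> F"
        have inC: "m \<le> n \<Longrightarrow> q \<in> polys_below scalars z m \<Longrightarrow> q \<in> carrier R \<and> z [^] (i - n) \<otimes> q \<otimes> f \<in> ?C" for m q
        proof (induction m arbitrary: q)
          case 0
          then have q0: "q = \<zero>" by simp
          have "z [^] (i - n) \<otimes> \<zero> \<otimes> f = \<zero>" using zc Fc[OF f] by simp
          then show ?case unfolding q0 using C.zero_closed by (metis zero_closed)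
        next
          case (Suc m)
          from Suc.prems(2) obtain q' d where q: "q' \<in> polys_below scalars z m" "d \<in> scalars" "q = q' \<oplus> z [^] m \<otimes> d" by auto
          have q': "q' \<in> carrier R" "z [^] (i - n) \<otimes> q' \<otimes> f \<in> ?C" using Suc.IH[OF _ q(1)] Suc.prems(1) by auto
          have "i - n + m < i" using Suc.prems(1) False by linarith
          moreover have "d \<otimes> f \<in> F" using subringE(6)[OF F(1)] q(2) F(2) f by blast
          ultimately have "z [^] (i - n + m) \<otimes> (d \<otimes> f) \<in> ?C" using less.IH by blast
          moreover have "z [^] (i - n) \<otimes> q \<otimes> f = z [^] (i - n) \<otimes> q' \<otimes> f \<oplus> z [^] (i - n + m) \<otimes> (d \<otimes> f)"
            unfolding q(3) using q' q(2) zc Fc[OF f]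
            by (simp add: nat_pow_mult[symmetric] r_distr l_distr m_assoc)
          ultimately show ?case using q' q zc by simp
        qed
        have hC: "h \<in> carrier R" "z [^] (i - n) \<otimes> h \<otimes> f \<in> ?C" using inC[OF order_refl h(1)] by auto
        have cc: "c \<in> carrier R" using h(2) by simp
        have "z [^] n \<otimes> c = \<ominus> h"
          using h(4) hC(1) cc zc by (metis a_comm m_closed minus_equality nat_pow_closed)
        then have "z [^] (i - n) \<otimes> (z [^] n \<otimes> c) \<otimes> f = \<ominus> (z [^] (i - n) \<otimes> h \<otimes> f)"
          using zc hC(1) Fc[OF f] by (simp add: l_minus r_minus)
        also have "\<dots> \<in> ?C" using C.a_inv_closed hC(2) by blast
        also have "z [^] (i - n) \<otimes> (z [^] n \<otimes> c) \<otimes> f = z [^] (i - n) \<otimes> z [^] n \<otimes> (c \<otimes> f)"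
          using zc cc Fc[OF f] by (simp add: m_assoc)
        also have "z [^] (i - n) \<otimes> z [^] n = z [^] i" using False zc by (simp add: nat_pow_mult)
        also have "c \<otimes> f = f \<otimes> c" using scalars_comm[OF h(2) Fc[OF f]] .
        finally have "z [^] i \<otimes> f \<otimes> c \<in> ?C" using zc cc Fc[OF f] by (simp add: m_assoc)
        then show "z [^] i \<otimes> f \<in> ?C" by (rule k.cl_torsion_free) (use h zc Fc[OF f] in auto)
      qed
    qed
  qed
  have "polys_below F z m \<subseteq> ?C" for m
  proof (induction m)
    case (Suc m)
    then show ?case using power[of m] C.a_closed by auto
  qed (use C.zero_closed in auto)
  then have "adjoin F z \<subseteq> ?C" by (auto simp: adjoin_def)
  moreover have "scalars \<subseteq> adjoin F z" "insert z J \<subseteq> adjoin F z"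
    using F(2,4) S.D_sub_adjoin S.p_adjoin by auto
  ultimately show ?case
    using S.adjoin_subring adjoin_sub_center[OF F(1,3) z] B'(1) B'F unfolding \<iota>_def by blast
qed

end

section \<open>The case of an algebraic center\<close>

context nonzero_algebra
begin

lemma center_subfield:
  assumes prime: "prime_ring R" and alg: "\<And>z. z \<in> ring_center R \<Longrightarrow> algebraic_elem scalars z"
  shows "subfield (ring_center R) R"
proof -
  let ?Z = "ring_center R"
  have inverse: "\<exists>y \<in> ?Z. z \<otimes> y = \<one>" if z: "z \<in> ?Z" "z \<noteq> \<zero>" for z
  proof -
    obtain h a where h: "h \<in> adjoin scalars z" "a \<in> scalars" "a \<noteq> \<zero>" "z \<otimes> h = a"
      using algebraic_central_inverse[OF prime z alg[OF z(1)]] by blast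
    have a: "inv a \<in> scalars" "a \<otimes> inv a = \<one>" using subfield_m_inv[OF scalars_subfield, of a] h by auto
    have hZ: "h \<in> ?Z"
      using adjoin_sub_center[OF subfieldE(1)[OF scalars_subfield] scalars_sub_center z(1)] h(1) by blast
    have "z \<otimes> (h \<otimes> inv a) = z \<otimes> h \<otimes> inv a"
      using center_carrier[OF z(1)] center_carrier[OF hZ] a(1) by (simp add: m_assoc)
    then have "z \<otimes> (h \<otimes> inv a) = \<one>" using h(4) a(2) by simp
    moreover have "h \<otimes> inv a \<in> ?Z"
      using subringE(6)[OF center_subring hZ] a(1) scalars_sub_center by blast
    ultimately show ?thesis by blast
  qed
  have "subcring ?Z R"
    using center_subring center_comm center_carrier by (intro subcringI) blast+
  moreover have "Units (R\<lparr>carrier := ?Z\<rparr>) = ?Z - {\<zero>}"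
  proof (intro equalityI subsetI)
    fix u assume "u \<in> Units (R\<lparr>carrier := ?Z\<rparr>)"
    then obtain v where "u \<in> ?Z" "v \<in> ?Z" "v \<otimes> u = \<one>" by (auto simp: Units_def)
    moreover have "\<one> \<noteq> \<zero>" by (rule k.one_not_zero')
    ultimately show "u \<in> ?Z - {\<zero>}" using center_carrier[of v] by auto
  next
    fix u assume u: "u \<in> ?Z - {\<zero>}"
    then obtain y where y: "y \<in> ?Z" "u \<otimes> y = \<one>" using inverse by blast
    then have "y \<otimes> u = \<one>" using center_comm[OF y(1), of u] center_carrier[of u] u by simp
    then show "u \<in> Units (R\<lparr>carrier := ?Z\<rparr>)" using u y by (auto simp: Units_def)
  qed
  ultimately show ?thesis by (rule subfieldI)
qed

lemma center_meets_proper_ideal_trivially: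
  assumes field: "subfield (ring_center R) R" and I: "ideal I R" "I \<noteq> carrier R"
    and z: "z \<in> ring_center R" "z \<in> I"
  shows "z = \<zero>"
proof (rule ccontr)
  interpret I: ideal I R by (rule I(1))
  assume "z \<noteq> \<zero>"
  then have inv: "inv z \<in> ring_center R" "z \<otimes> inv z = \<one>" using subfield_m_inv[OF field, of z] z(1) by auto
  have "z \<otimes> inv z \<in> I" by (rule I.I_r_closed[OF z(2) center_carrier[OF inv(1)]])
  then have "\<one> \<in> I" using inv(2) by simp
  then show False using I.one_imp_carrier I(2) by blast
qed

text \<open>Nonzero central elements are units and avoid every proper ideal, so the center embeds
  into R/I.\<close>

lemma indep_center_mod_ideal:
  assumes field: "subfield (ring_center R) R" and I: "ideal I R" "I \<noteq> carrier R"
    and J: "J \<subseteq> ring_center R" and ind: "lin_indep scalars {\<zero>} J id"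
  shows "lin_indep scalars I J id"
  unfolding lin_indep_def
proof (intro allI impI)
  fix c assume c: "\<forall>j \<in> J. c j \<in> scalars" and s: "finsum R (\<lambda>j. id j \<otimes> c j) J \<in> I"
  have add: "additive_subgroup (ring_center R) R"
    using center_subring by (simp add: subring_def additive_subgroup_def)
  have "finsum R (\<lambda>j. id j \<otimes> c j) J \<in> ring_center R"
  proof (rule finsum_mem_additive_subgroup[OF add])
    fix j assume "j \<in> J"
    then show "id j \<otimes> c j \<in> ring_center R"
      using subringE(6)[OF center_subring, of j "c j"] J c scalars_sub_center by auto
  qed
  from center_meets_proper_ideal_trivially[OF field I this s]
  have "finsum R (\<lambda>j. id j \<otimes> c j) J \<in> {\<zero>}" by simp
  with c ind show "\<forall>j \<in> J. c j = \<zero>" unfolding lin_indep_def by blast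
qed

lemma algebraic_center_finite_dimension:
  assumes prime: "prime_ring R" and goldie: "left_goldie R" and GK: "GKdim < 3" and aff: "affine"
    and I: "ideal I R" "I \<noteq> {\<zero>}" "I \<noteq> carrier R"
    and alg: "\<And>z. z \<in> ring_center R \<Longrightarrow> algebraic_elem scalars z"
  shows "finite_dimension scalars (ring_center R)"
proof (rule ccontr)
  assume inf: "infinite_dimension scalars (ring_center R)"
  have field: "subfield (ring_center R) R" by (rule center_subfield[OF prime alg])
  have Zadd: "additive_subgroup (ring_center R) R"
    using center_subring by (simp add: subring_def additive_subgroup_def)
  have Zk: "c \<otimes> z \<in> ring_center R" if "z \<in> ring_center R" "c \<in> scalars" for z c
    using subringE(6)[OF center_subring, of c z] that scalars_sub_center by blast
  have many: "\<exists>J. finite J \<and> J \<subseteq> ring_center R \<and> card J = n \<and> lin_indep scalars {\<zero>} J id" for n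
    by (rule infinite_dimension_indep[OF Zadd Zk inf])
  interpret I: ideal I R by (rule I(1))
  obtain y where y: "y \<in> I" "\<And>m. m \<in> carrier R \<Longrightarrow> m \<otimes> y = \<zero> \<Longrightarrow> m = \<zero>"
    using prime_goldie_ideal_regular[OF prime goldie I(1,2)] by blast
  obtain x g where x: "\<And>i. x i \<in> carrier R" and span: "\<And>m. m \<in> carrier R \<Longrightarrow> \<exists>N. m \<in> word_span scalars x g N"
    by (rule affine_words[OF aff]) (rule that)
  have tc: "torsion_closed R scalars I" by (rule scalars_torsion_closed[OF I(1,3)])
  have cw: "central_words R scalars I x g"
    by (rule central_words_of_center[OF tc scalars_sub_center I(1) x])
  interpret W: central_words R scalars I x g by (rule cw)
  have yc: "y \<in> carrier R" using y(1) by simp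
  have "\<exists>n \<ge> 1. card {w. W.normal w \<and> length w = n} \<le> n"
  proof (rule gap_exists[OF cw GK yc])
    fix n :: nat
    show "lin_indep scalars {\<zero>} (W.normals n \<times> {..<n}) (\<lambda>(w, s). word_prod x w \<otimes> y [^] (s :: nat))"
    proof (rule regular_powers_indep[OF tc I(1) W.finite_normals W.normals_closed _ y])
      show "W.indep (W.normals n) (word_prod x)"
        by (rule W.normal_indep[OF W.finite_normals]) (simp add: W.normals_def)
    qed
  qed
  then obtain n where n: "n \<ge> 1" "card {w. W.normal w \<and> length w = n} \<le> n" by blast
  from W.normals_linear_growth[OF n] obtain C where C: "\<And>N. card (W.normals N) \<le> C * (N + 1)" by blast
  \<comment> \<open>One element more than the slope C of the growth of R/I.\<close>
  obtain J where J: "finite J" "J \<subseteq> ring_center R" "card J = C + 1" "lin_indep scalars {\<zero>} J id"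
    using many by blast
  from algebraic_subring[OF alg J(1,2)] obtain F B where
    F: "subring F R" "scalars \<subseteq> F" "F \<subseteq> ring_center R" "J \<subseteq> F"
    and B: "finite B" "B \<subseteq> F" "F \<subseteq> k.cl B id" by blast
  have Fc: "f \<in> carrier R" if "f \<in> F" for f using F(3) center_carrier that by blast
  have Jc: "J \<subseteq> carrier R" using F(4) Fc by blast
  \<comment> \<open>F is given only as a subring; nonzero multiples in k serve as inverses.\<close>
  have Finv: "\<exists>h \<in> F. \<exists>a \<in> scalars - {\<zero>}. f \<otimes> h = a" if f: "f \<in> F" "f \<noteq> \<zero>" for f
  proof -
    have "f \<in> ring_center R" using f(1) F(3) by blast
    from algebraic_central_inverse[OF prime this f(2) alg[OF this]] adjoin_subset_subring[OF F(1,2) f(1)]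
    show ?thesis by blast
  qed
  have tcF: "torsion_closed R F I"
  proof (intro torsion_closed.intro ring_axioms torsion_closed_axioms.intro F(1) I(3))
    show "e \<otimes> f = f \<otimes> e" if "e \<in> F" "f \<in> F" for e f using center_comm Fc F(3) that by blast
    show "additive_subgroup I R" ..
    show "t \<otimes> e \<in> I" if "t \<in> I" "e \<in> F" for t e by (rule I.I_r_closed[OF that(1) Fc[OF that(2)]])
    show "m \<in> I" if m: "m \<in> carrier R" "f \<in> F" "f \<noteq> \<zero>" "m \<otimes> f \<in> I" for m f
    proof -
      obtain h a where h: "h \<in> F" "a \<in> scalars" "a \<noteq> \<zero>" "f \<otimes> h = a" using Finv[OF m(2,3)] by blast
      have "m \<otimes> f \<otimes> h \<in> I" by (rule I.I_r_closed[OF m(4) Fc[OF h(1)]])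
      moreover have "m \<otimes> f \<otimes> h = m \<otimes> a" using m(1) Fc m(2) h(1,4) by (simp add: m_assoc)
      ultimately have "m \<otimes> a \<in> I" by simp
      then show ?thesis by (rule W.T_torsion_free[OF m(1) h(2,3)])
    qed
  qed
  interpret V: central_words R F I x g by (rule central_words_of_center[OF tcF F(3) I(1) x])
  have Jid: "id j \<in> F" if "j \<in> J" for j using F(4) that by auto
  \<comment> \<open>Otherwise pick one F-normal word of each length. The first N of them times J are
    N (C + 1) elements, independent over k modulo I, in words of length at most N + l: too many for
    slope C.\<close>
  have "\<exists>m. \<forall>w. V.normal w \<longrightarrow> length w \<noteq> m"
  proof (rule ccontr)
    assume "\<not> ?thesis"
    then have "\<forall>m. \<exists>w. V.normal w \<and> length w = m" by blast
    then obtain w where w: "\<And>m. V.normal (w m)" "\<And>m. length (w m) = m" by metis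
    have "\<exists>l. \<forall>j \<in> J. j \<in> word_span scalars x g l"
      by (rule W.word_span_common[OF _ J(1) Jc]) (fact span, rule word_span_mono)
    then obtain l where l: "\<forall>j \<in> J. j \<in> word_span scalars x g l" by blast
    have "(C + 1) * N \<le> C * (l + 1 * N + 1)" for N
    proof -
      have winj: "inj_on w {..<N}" by (rule inj_onI) (metis w(2))
      let ?S = "w ` {..<N}"
      let ?b = "\<lambda>(v, j). word_prod x v \<otimes> id j"
      have Sc: "word_prod x v \<in> carrier R" if "v \<in> ?S" for v using that w(1) V.normal_letters by auto
      have Sind: "lin_indep F I ?S (word_prod x)" by (rule V.normal_indep) (use w(1) in auto)
      have "lin_indep scalars I (?S \<times> J) ?b"
        by (rule V.tower[OF F(2) W.E_subring _ Sc J(1) Jid J(4) Sind]) auto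
      then have "card (?S \<times> J) \<le> card (W.normals (N + l))"
      proof (rule W.rank_le_card_normals[rotated, OF _ order_refl])
        show "finite (?S \<times> J)" using J(1) by simp
        fix q assume "q \<in> ?S \<times> J"
        then obtain m j where q: "q = (w m, j)" "m < N" "j \<in> J" by auto
        have "w m \<in> short_words g N" using V.normal_letters[OF w(1)] w(2) q(2) by (simp add: short_words_def)
        then have "word_prod x (w m) \<otimes> \<one> \<in> word_span scalars x g N"
          using Sc[of "w m"] q(2) by (intro scalar_word) auto
        then have "word_prod x (w m) \<in> word_span scalars x g N" using Sc[of "w m"] q(2) by simp
        from word_span_mult[of g x _ N j l, OF _ this] show "?b q \<in> word_span scalars x g (N + l)"
          using x l q by auto
      qed
      also have "\<dots> \<le> C * (N + l + 1)" by (rule C)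
      finally have "N * (C + 1) \<le> C * (N + l + 1)" using winj J(3) by (simp add: card_cartesian_product card_image)
      then show ?thesis by (simp add: algebra_simps)
    qed
    then have "C + 1 \<le> C * 1" by (rule rank_bound_arith)
    then show False by simp
  qed
  then obtain m where m: "\<And>w. V.normal w \<Longrightarrow> length w \<noteq> m" by blast
  \<comment> \<open>The prefix of length m of a longer normal word would be normal.\<close>
  have short: "length w < m" if w: "V.normal w" for w
  proof (rule ccontr)
    assume "\<not> length w < m"
    then have "length (take m w) = m" by simp
    moreover have "V.normal (take m w)" using V.normal_factor[of "[]" "take m w" "drop m w"] w by simp
    ultimately show False using m by blast
  qed
  \<comment> \<open>F-normal words times a spanning set of F over k: these products will span R/I
    over k.\<close>
  let ?K = "V.normals m \<times> B"
  let ?b = "\<lambda>(w, e). word_prod x w \<otimes> e"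
  have fin: "finite ?K" using V.finite_normals B(1) by simp
  have bc: "?b q \<in> carrier R" if "q \<in> ?K" for q
    using that V.normals_closed B(2) Fc by (auto intro!: m_closed)
  let ?C = "W.cl ?K ?b"
  have Cadd: "additive_subgroup ?C R" by (rule W.cl_subgroup[OF fin bc])
  interpret C: additive_subgroup ?C R by (rule Cadd)
  have CI: "I \<subseteq> ?C" using W.cl_T[of _ ?K ?b] bc by blast
  have word_F: "word_prod x w \<otimes> f \<in> ?C" if w: "w \<in> V.normals m" and f: "f \<in> F" for w f
  proof -
    have wc: "word_prod x w \<in> carrier R" by (rule V.normals_closed[OF w])
    have "f \<in> k.cl B id" using B(3) f by blast
    then have fB: "f \<in> W.cl B id" by (rule W.cl_of_zero)
    show ?thesis
    proof (rule W.cl_map_cl[where f = "\<lambda>f. word_prod x w \<otimes> f" and b = id, OF fin bc _ _ _ _ _ _ fB])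
      show "word_prod x w \<otimes> t \<in> ?C" if "t \<in> I" for t using I.I_l_closed[OF that wc] CI by blast
      show "word_prod x w \<otimes> id e \<in> ?C" if e: "e \<in> B" for e
      proof -
        have "?b (w, e) \<in> ?C" by (rule W.cl_incl[OF fin bc]) (use w e in auto)
        then show ?thesis by simp
      qed
    qed (use wc B(2) Fc in \<open>auto simp: r_distr m_assoc\<close>)
  qed
  have C_F: "u \<otimes> f \<in> ?C" if u: "u \<in> ?C" and f: "f \<in> F" for u f
  proof -
    have fc: "f \<in> carrier R" by (rule Fc[OF f])
    show ?thesis
    proof (rule W.cl_map_cl[where f = "\<lambda>u. u \<otimes> f", OF fin bc _ _ _ _ bc _ u])
      show "v \<otimes> e \<otimes> f = v \<otimes> f \<otimes> e" if "v \<in> carrier R" "e \<in> scalars" for v e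
        using that fc scalars_comm[OF that(2) fc] by (simp add: m_assoc)
      show "t \<otimes> f \<in> ?C" if "t \<in> I" for t using I.I_r_closed[OF that fc] CI by blast
      show "?b q \<otimes> f \<in> ?C" if q: "q \<in> ?K" for q
      proof -
        obtain w e where we: "q = (w, e)" "w \<in> V.normals m" "e \<in> B" using q by blast
        have "e \<otimes> f \<in> F" using subringE(6)[OF F(1)] we(3) B(2) f by blast
        then have "word_prod x w \<otimes> (e \<otimes> f) \<in> ?C" by (rule word_F[OF we(2)])
        moreover have "e \<in> carrier R" using we(3) B(2) Fc by blast
        ultimately show ?thesis using we V.normals_closed[OF we(2)] fc by (simp add: m_assoc)
      qed
    qed (use fc in \<open>auto simp: l_distr\<close>)
  qed
  \<comment> \<open>The closure over k of these products is stable under F, so it contains the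
    closure over F of the normal words.\<close>
  have "V.cl (V.normals m) (word_prod x) \<subseteq> ?C"
  proof (rule V.cl_min[OF Cadd C_F _ CI])
    show "u \<in> ?C" if u: "u \<in> carrier R" "f \<in> F" "f \<noteq> \<zero>" "u \<otimes> f \<in> ?C" for u f
    proof -
      obtain h a where h: "h \<in> F" "a \<in> scalars" "a \<noteq> \<zero>" "f \<otimes> h = a" using Finv[OF u(2,3)] by blast
      have "u \<otimes> f \<otimes> h \<in> ?C" by (rule C_F[OF u(4) h(1)])
      moreover have "u \<otimes> f \<otimes> h = u \<otimes> a" using u(1) Fc u(2) h(1,4) by (simp add: m_assoc)
      ultimately have "u \<otimes> a \<in> ?C" by simp
      then show ?thesis by (rule W.cl_torsion_free[OF _ u(1) h(2,3)])
    qed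
    show "word_prod x w \<in> ?C" if w: "w \<in> V.normals m" for w
      using word_F[OF w subringE(3)[OF F(1)]] V.normals_closed[OF w] by simp
  qed
  moreover have "V.normals N \<subseteq> V.normals m" for N using short by (auto simp: V.normals_def intro: less_imp_le)
  ultimately have all: "u \<in> ?C" if u: "u \<in> carrier R" for u
  proof -
    obtain N where N: "u \<in> word_span scalars x g N" using span[OF u] by blast
    have "u \<in> V.cl (V.normals N) (word_prod x)" using V.word_span_subset_cl_normals[OF F(2)] N by blast
    moreover have "V.cl (V.normals N) (word_prod x) \<subseteq> V.cl (V.normals m) (word_prod x)"
    proof (rule V.cl_subset[OF V.finite_normals V.normals_closed])
      fix w assume "w \<in> V.normals N"
      then have "w \<in> V.normals m" using \<open>\<And>N. V.normals N \<subseteq> V.normals m\<close> by blast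
      then show "word_prod x w \<in> V.cl (V.normals m) (word_prod x)"
        by (intro V.cl_incl V.finite_normals V.normals_closed)
    qed
    ultimately show ?thesis using \<open>V.cl (V.normals m) (word_prod x) \<subseteq> ?C\<close> by blast
  qed
  \<comment> \<open>One more central element than the spanning set of R/I has members.\<close>
  obtain J' where J': "finite J'" "J' \<subseteq> ring_center R" "card J' = card ?K + 1" "lin_indep scalars {\<zero>} J' id"
    using many by blast
  have "card J' \<le> card ?K"
    by (rule W.exchange[OF J'(1) fin bc indep_center_mod_ideal[OF field I(1,3) J'(2,4)]])
      (use all J'(2) center_carrier in auto)
  then show False using J'(3) by simp
qed

end

theorem theorem2p11:
  fixes K :: "('k, 'n) ring_scheme" and R :: "('a, 'm) ring_scheme" and \<eta> :: "'k \<Rightarrow> 'a"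
  assumes "field_algebra K R \<eta>"
    and "uncountable (carrier K)"
    and "field_algebra.affine K R \<eta>"
    and "prime_ring R"
    and "goldie_ring R"
    and "\<not> simple_ring R"
    and "field_algebra.GKdim K R \<eta> < 3"
  shows "field_algebra.PI_algebra K R \<eta> \<or>
    (subfield (ring_center R) R \<and>
      ring.finite_dimension R (field_algebra.scalars K \<eta>) (ring_center R))"
proof -
  interpret field_algebra K R \<eta> by fact
  have nz: "carrier R \<noteq> {\<zero>\<^bsub>R\<^esub>}" using assms(4) by (simp add: prime_ring_def)
  interpret nonzero_algebra K R \<eta> by unfold_locales (rule nz)
  have goldie: "left_goldie R" using assms(5) by (simp add: goldie_ring_def)
  then have acc: "acc_left_annihilators R" by (simp add: left_goldie_def)
  show ?thesis
  proof (cases "\<forall>z \<in> ring_center R. algebraic_elem scalars z")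
    case True
    obtain I where I: "ideal I R" "I \<noteq> {\<zero>\<^bsub>R\<^esub>}" "I \<noteq> carrier R"
      using assms(4,6) by (auto simp: simple_ring_def prime_ring_def)
    have alg: "algebraic_elem scalars z" if "z \<in> ring_center R" for z using True that by blast
    show ?thesis
      using center_subfield[OF assms(4) alg]
        algebraic_center_finite_dimension[OF assms(4) goldie assms(7,3) I alg] by blast
  next
    case False
    then obtain z where "z \<in> ring_center R" "\<not> algebraic_elem scalars z" by blast
    then show ?thesis using PI_of_transcendental_center[OF assms(4) acc assms(7,3)] by blast
  qed
qed

end
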